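(* Let $\tau$ be a veering triangulation of $M$ and suppose $\mathrm{rank}\,H_1(M)>1$. Let $c_1,\dots,c_n$ be the $AB$-cycles of $\tau$, of lengths $k_i$ and classes $g_i=[c_i]\in G$. Then, up to multiplication by a unit $\pm g$ of $\mathbb{Z}[G]$, $$V_\tau=V^{\mathcal{AB}}_\tau\cdot\Theta_\tau=\Theta_\tau\cdot\prod_{i=1}^n\left(1+(-1)^{k_i+1}g_i\right).$$
   Context: $\tau$ is a veering triangulation of $M$ (taut ideal triangulation with cooriented faces, each tetrahedron having two bottom and two top faces, a bottom edge, a top edge and four side edges, angle sum $2\pi$ around edges, with a consistent right/left veer on edges modelled on a thickened rhombus whose side edges of positive slope are right-veering and of negative slope left-veering); $E,F$ its sets of edges and faces. $G=H_1(M;\mathbb{Z})/\mathrm{torsion}$ (multiplicative), $\hat M$ the cover with deck group $G$, $\tilde\tau$ the lift; choose lifts of edges and faces. Veering polynomial: $V_\tau=\det L$, $L:\mathbb{Z}[G]^E\to\mathbb{Z}[G]^E$ sending each edge $\mathbf b$ to $\mathbf b-(\mathbf t+\mathbf s_1+\mathbf s_2)$, where $\mathbf t$ is the top edge and $\mathbf s_1,\mathbf s_2$ the side edges with veer opposite to $\mathbf t$ of the lifted tetrahedron whose bottom edge is $\mathbf b$. Taut polynomial: each face $f$ is a bottom face of a unique tetrahedron whose bottom edge $\mathbf b$ lies in $f$; with $\mathbf x,\mathbf y$ the other edges of $f$, $L^\triangle:\mathbb{Z}[G]^F\to\mathbb{Z}[G]^E$ sends $f\mapsto\mathbf b-(\mathbf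 x+\mathbf y)$, and $\Theta_\tau$ is the gcd of the $|E|\times|E|$ minors of $L^\triangle$. $AB$-cycles: for a face $f$ with $t$ the tetrahedron having $f$ as a bottom face, $A(f)$ is the top face of $t$ meeting $f$ along the edge of $t$ with the same veer as the top edge of $t$; the cycles of the permutation $A$ of $F$ are the $AB$-cycles, the length is the number of faces, and each determines a closed directed curve in $M$ with class in $G$. $V^{\mathcal{AB}}_\tau=\det(I+A)$ for the lift of $A$ to $\mathbb{Z}[G]^F$. *)

theory Defs
  imports "HOL-Analysis.Finite_Cartesian_Product" "HOL-Library.Poly_Mapping"
          "HOL-Combinatorics.Permutations"
begin

text \<open>Tetrahedra are 0..n-1, vertices of each tetrahedron are 0..3, face i of a
tetrahedron is the face opposite vertex i.  gl t i = (t', p) means: face i of t is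
glued to face (p i) of t' by the vertex map p.  An edge instance is (t, s) with s a
2-element subset of {0..3}; a face instance is (t, i).\<close>

type_synonym gluing = "nat \<Rightarrow> nat \<Rightarrow> nat \<times> (nat \<Rightarrow> nat)"

definition inv_count :: "nat list \<Rightarrow> nat" where
  "inv_count xs = card {(i, j). i < j \<and> j < length xs \<and> xs ! j < xs ! i}"

definition pos4 :: "nat \<Rightarrow> nat \<Rightarrow> nat \<Rightarrow> nat \<Rightarrow> bool" where
  "pos4 a b c d \<longleftrightarrow> distinct [a, b, c, d] \<and> {a, b, c, d} = {0..<4} \<and> even (inv_count [a, b, c, d])"

definition ideal_tri :: "nat \<Rightarrow> gluing \<Rightarrow> bool" where
  "ideal_tri n gl \<longleftrightarrow> 0 < n \<and>
     (\<forall>t<n. \<forall>i<4. fst (gl t i) < n \<and> bij_betw (snd (gl t i)) {0..<4} {0..<4} \<and>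
        (fst (gl t i), snd (gl t i) i) \<noteq> (t, i) \<and>
        fst (gl (fst (gl t i)) (snd (gl t i) i)) = t \<and>
        (\<forall>v<4. snd (gl (fst (gl t i)) (snd (gl t i) i)) (snd (gl t i) v) = v))"

text \<open>Orientation: vertex orderings of all tetrahedra are positively oriented,
i.e. all gluing maps are odd permutations.\<close>
definition oriented_tri :: "nat \<Rightarrow> gluing \<Rightarrow> bool" where
  "oriented_tri n gl \<longleftrightarrow>
     (\<forall>t<n. \<forall>i<4. odd (inv_count (map (snd (gl t i)) [0, 1, 2, 3])))"

definition estep :: "gluing \<Rightarrow> nat \<times> nat set \<Rightarrow> nat \<times> nat set \<Rightarrow> bool" where
  "estep gl x y \<longleftrightarrow> (\<exists>i<4. i \<notin> snd x \<and>
      y = (fst (gl (fst x) i), snd (gl (fst x) i) ` snd x))"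

definition ostep :: "gluing \<Rightarrow> nat \<times> nat \<times> nat \<Rightarrow> nat \<times> nat \<times> nat \<Rightarrow> bool" where
  "ostep gl x y \<longleftrightarrow> (case x of (t, a, b) \<Rightarrow> \<exists>i<4. i \<noteq> a \<and> i \<noteq> b \<and>
      y = (fst (gl t i), snd (gl t i) a, snd (gl t i) b))"

definition edge_inst :: "nat \<Rightarrow> (nat \<times> nat set) set" where
  "edge_inst n = {(t, s). t < n \<and> s \<subseteq> {0..<4} \<and> card s = 2}"

definition ecls :: "gluing \<Rightarrow> nat \<times> nat set \<Rightarrow> (nat \<times> nat set) set" where
  "ecls gl x = {y. (estep gl)\<^sup>*\<^sup>* x y}"

definition edges :: "nat \<Rightarrow> gluing \<Rightarrow> (nat \<times> nat set) set set" where
  "edges n gl = ecls gl ` edge_inst n"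

definition ocls :: "gluing \<Rightarrow> nat \<times> nat \<times> nat \<Rightarrow> (nat \<times> nat \<times> nat) set" where
  "ocls gl x = {y. (ostep gl)\<^sup>*\<^sup>* x y}"

definition fcls :: "gluing \<Rightarrow> nat \<times> nat \<Rightarrow> (nat \<times> nat) set" where
  "fcls gl x = {x, (fst (gl (fst x) (snd x)), snd (gl (fst x) (snd x)) (snd x))}"

definition faces :: "nat \<Rightarrow> gluing \<Rightarrow> (nat \<times> nat) set set" where
  "faces n gl = fcls gl ` {(t, i). t < n \<and> i < 4}"

text \<open>M is a connected 3-manifold: the dual graph is connected and no edge is
identified with itself in reverse.\<close>
definition manifold_tri :: "nat \<Rightarrow> gluing \<Rightarrow> bool" where
  "manifold_tri n gl \<longleftrightarrow>
     (\<forall>t<n. (\<lambda>x y. \<exists>i<4. y = fst (gl x i))\<^sup>*\<^sup>* 0 t) \<and>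
     (\<forall>t<n. \<forall>a<4. \<forall>b<4. a \<noteq> b \<longrightarrow> \<not> (ostep gl)\<^sup>*\<^sup>* (t, a, b) (t, b, a))"

text \<open>bt t = vertices of the bottom edge of t; the top edge is the complementary pair.
Face i of t is a top face iff i is a vertex of the bottom edge.\<close>
definition top_e :: "(nat \<Rightarrow> nat set) \<Rightarrow> nat \<Rightarrow> nat set" where
  "top_e bt t = {0..<4} - bt t"

definition taut :: "nat \<Rightarrow> gluing \<Rightarrow> (nat \<Rightarrow> nat set) \<Rightarrow> bool" where
  "taut n gl bt \<longleftrightarrow>
     (\<forall>t<n. bt t \<subseteq> {0..<4} \<and> card (bt t) = 2) \<and>
     (\<forall>t<n. \<forall>i<4. (i \<in> bt t) \<longleftrightarrow> (snd (gl t i) i \<notin> bt (fst (gl t i)))) \<and>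
     (\<forall>e\<in>edges n gl. card {x \<in> e. snd x = bt (fst x) \<or> snd x = top_e bt (fst x)} = 2)"

text \<open>veer e = True means right-veering.  Thickened rhombus convention: for a positively
oriented ordering (a,b,c,d) with bottom edge ab and top edge cd, the side edges ad, bc
(positive slope) are right-veering and ac, bd (negative slope) left-veering.\<close>
definition veering :: "nat \<Rightarrow> gluing \<Rightarrow> (nat \<Rightarrow> nat set) \<Rightarrow> ((nat \<times> nat set) set \<Rightarrow> bool) \<Rightarrow> bool" where
  "veering n gl bt veer \<longleftrightarrow>
     (\<forall>t<n. \<forall>a b c d. pos4 a b c d \<and> {a, b} = bt t \<longrightarrow>
        veer (ecls gl (t, {a, d})) \<and> veer (ecls gl (t, {b, c})) \<and>
        \<not> veer (ecls gl (t, {a, c})) \<and> \<not> veer (ecls gl (t, {b, d})))"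

definition veering_triangulation ::
  "nat \<Rightarrow> gluing \<Rightarrow> (nat \<Rightarrow> nat set) \<Rightarrow> ((nat \<times> nat set) set \<Rightarrow> bool) \<Rightarrow> bool" where
  "veering_triangulation n gl bt veer \<longleftrightarrow>
     ideal_tri n gl \<and> oriented_tri n gl \<and> manifold_tri n gl \<and> taut n gl bt \<and> veering n gl bt veer"

text \<open>exitf a b: for the oriented edge a->b of a positively oriented tetrahedron, the face
through which the loop encircling the edge (right hand rule) leaves the tetrahedron.\<close>
definition exitf :: "nat \<Rightarrow> nat \<Rightarrow> nat" where
  "exitf a b = (THE c. \<exists>d. pos4 a b c d)"

text \<open>Cellular 1-cocycles of the dual 2-complex (a spine of M): z t i is the value on the
dual edge crossing face i of t out of t.\<close>
definition cocycle :: "nat \<Rightarrow> gluing \<Rightarrow> (nat \<Rightarrow> nat \<Rightarrow> 'g::ab_group_add) \<Rightarrow> bool" where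
  "cocycle n gl z \<longleftrightarrow>
     (\<forall>t<n. \<forall>i<4. z (fst (gl t i)) (snd (gl t i) i) = - z t i) \<and>
     (\<forall>t<n. \<forall>a<4. \<forall>b<4. a \<noteq> b \<longrightarrow>
        (\<Sum>x\<in>ocls gl (t, a, b). z (fst x) (exitf (fst (snd x)) (snd (snd x)))) = 0)"

definition dotv :: "int ^ 'r \<Rightarrow> int ^ 'r \<Rightarrow> int" where
  "dotv u v = (\<Sum>k\<in>UNIV. u $ k * v $ k)"

text \<open>w is a G-valued cocycle (G = int^'r) inducing an isomorphism
H_1(M)/torsion -> G (equivalently G* -> H^1(M;Z) is an isomorphism).  It describes the
cover hat M: lifts (t,g); crossing face i of (t,g) leads to (t', g + w t i).\<close>
definition homology_cover :: "nat \<Rightarrow> gluing \<Rightarrow> (nat \<Rightarrow> nat \<Rightarrow> int ^ 'r) \<Rightarrow> bool" where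
  "homology_cover n gl w \<longleftrightarrow> cocycle n gl w \<and>
     (\<forall>z :: nat \<Rightarrow> nat \<Rightarrow> int. cocycle n gl z \<longrightarrow>
        (\<exists>lam h. \<forall>t<n. \<forall>i<4. z t i = dotv lam (w t i) + (h (fst (gl t i)) - h t))) \<and>
     (\<forall>lam (h :: nat \<Rightarrow> int). (\<forall>t<n. \<forall>i<4. dotv lam (w t i) = h (fst (gl t i)) - h t) \<longrightarrow> lam = 0)"

text \<open>Choice of lifts of edges: the instance s of tetrahedron lift (t,0) is the translate
by l t s of the chosen lift of its edge.  Similarly for faces with m.\<close>
definition edge_lifts :: "nat \<Rightarrow> gluing \<Rightarrow> (nat \<Rightarrow> nat \<Rightarrow> int ^ 'r) \<Rightarrow> (nat \<Rightarrow> nat set \<Rightarrow> int ^ 'r) \<Rightarrow> bool" where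
  "edge_lifts n gl w l \<longleftrightarrow> (\<forall>t<n. \<forall>s. s \<subseteq> {0..<4} \<and> card s = 2 \<longrightarrow>
     (\<forall>i<4. i \<notin> s \<longrightarrow> l t s = w t i + l (fst (gl t i)) (snd (gl t i) ` s)))"

definition face_lifts :: "nat \<Rightarrow> gluing \<Rightarrow> (nat \<Rightarrow> nat \<Rightarrow> int ^ 'r) \<Rightarrow> (nat \<Rightarrow> nat \<Rightarrow> int ^ 'r) \<Rightarrow> bool" where
  "face_lifts n gl w m \<longleftrightarrow> (\<forall>t<n. \<forall>i<4. m t i = w t i + m (fst (gl t i)) (snd (gl t i) i))"

definition gX :: "'g \<Rightarrow> ('g \<Rightarrow>\<^sub>0 int)" where
  "gX g = Poly_Mapping.single g 1"

definition det_on :: "'a set \<Rightarrow> ('a \<Rightarrow> 'a \<Rightarrow> 'b::comm_ring_1) \<Rightarrow> 'b" where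
  "det_on S M = (\<Sum>p\<in>{p. p permutes S}. of_int (sign p) * (\<Prod>x\<in>S. M (p x) x))"

definition assoc_pm :: "('g::comm_monoid_add \<Rightarrow>\<^sub>0 int) \<Rightarrow> ('g \<Rightarrow>\<^sub>0 int) \<Rightarrow> bool" where
  "assoc_pm x y \<longleftrightarrow> (\<exists>g (s::int). (s = 1 \<or> s = -1) \<and> x = of_int s * gX g * y)"

definition is_gcd_of :: "'a::comm_ring_1 \<Rightarrow> 'a set \<Rightarrow> bool" where
  "is_gcd_of d S \<longleftrightarrow> (\<forall>x\<in>S. d dvd x) \<and> (\<forall>c. (\<forall>x\<in>S. c dvd x) \<longrightarrow> c dvd d)"

definition Lset :: "gluing \<Rightarrow> (nat \<Rightarrow> nat set) \<Rightarrow> ((nat \<times> nat set) set \<Rightarrow> bool) \<Rightarrow> nat \<Rightarrow> nat set set" where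
  "Lset gl bt veer t = insert (top_e bt t)
     {s. s \<subseteq> {0..<4} \<and> card s = 2 \<and> s \<noteq> bt t \<and> s \<noteq> top_e bt t \<and>
         veer (ecls gl (t, s)) \<noteq> veer (ecls gl (t, top_e bt t))}"

definition Lmat :: "nat \<Rightarrow> gluing \<Rightarrow> (nat \<Rightarrow> nat set) \<Rightarrow> ((nat \<times> nat set) set \<Rightarrow> bool) \<Rightarrow>
    (nat \<Rightarrow> nat set \<Rightarrow> 'g::ab_group_add) \<Rightarrow> (nat \<times> nat set) set \<Rightarrow> (nat \<times> nat set) set \<Rightarrow> ('g \<Rightarrow>\<^sub>0 int)" where
  "Lmat n gl bt veer l e' e = (if e' = e then 1 else 0) -
     (\<Sum>t\<in>{t. t < n \<and> ecls gl (t, bt t) = e}. \<Sum>s\<in>Lset gl bt veer t.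
        if ecls gl (t, s) = e' then gX (l t s - l t (bt t)) else 0)"

definition veering_poly where
  "veering_poly n gl bt veer l = det_on (edges n gl) (Lmat n gl bt veer l)"

text \<open>L^triangle: the column of face f uses the tetrahedron t having f as bottom face
(instance (t,i) with i not in bt t); b = bottom edge of t, x,y the other edges of face i.\<close>
definition LTmat :: "gluing \<Rightarrow> (nat \<Rightarrow> nat set) \<Rightarrow> (nat \<Rightarrow> nat set \<Rightarrow> 'g::ab_group_add) \<Rightarrow> (nat \<Rightarrow> nat \<Rightarrow> 'g) \<Rightarrow>
    (nat \<times> nat set) set \<Rightarrow> (nat \<times> nat) set \<Rightarrow> ('g \<Rightarrow>\<^sub>0 int)" where
  "LTmat gl bt l m e' f = (\<Sum>x\<in>{x\<in>f. snd x \<notin> bt (fst x)}.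
     (if ecls gl (fst x, bt (fst x)) = e' then gX (l (fst x) (bt (fst x)) - m (fst x) (snd x)) else 0)
     - (\<Sum>s\<in>{s. s \<subseteq> {0..<4} - {snd x} \<and> card s = 2 \<and> s \<noteq> bt (fst x)}.
          if ecls gl (fst x, s) = e' then gX (l (fst x) s - m (fst x) (snd x)) else 0))"

definition minors where
  "minors n gl bt l m = {det_on (edges n gl) (\<lambda>e e'. LTmat gl bt l m e (\<beta> e')) | \<beta>.
      inj_on \<beta> (edges n gl) \<and> \<beta> ` edges n gl \<subseteq> faces n gl}"

text \<open>AB permutation: bfi f = the instance (t,i) of f with f a bottom face of t;
A(f) = the top face k of t containing the edge of f (other than the bottom edge) with the
same veer as the top edge of t; lab f = deck translation of the lifted step.\<close>
definition bfi :: "(nat \<Rightarrow> nat set) \<Rightarrow> (nat \<times> nat) set \<Rightarrow> nat \<times> nat" where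
  "bfi bt f = (THE x. x \<in> f \<and> snd x \<notin> bt (fst x))"

definition Anext :: "gluing \<Rightarrow> (nat \<Rightarrow> nat set) \<Rightarrow> ((nat \<times> nat set) set \<Rightarrow> bool) \<Rightarrow> nat \<Rightarrow> nat \<Rightarrow> nat" where
  "Anext gl bt veer t i = (THE k. k \<in> bt t \<and>
      veer (ecls gl (t, {0..<4} - {i, k})) = veer (ecls gl (t, top_e bt t)))"

definition Afun where
  "Afun gl bt veer f = (let x = bfi bt f in fcls gl (fst x, Anext gl bt veer (fst x) (snd x)))"

definition Alab where
  "Alab gl bt veer m f = (let x = bfi bt f in
      m (fst x) (Anext gl bt veer (fst x) (snd x)) - m (fst x) (snd x))"

definition Amat where
  "Amat gl bt veer m f' f = (if f' = Afun gl bt veer f then gX (Alab gl bt veer m f) else 0)"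

definition AB_poly where
  "AB_poly n gl bt veer m =
     det_on (faces n gl) (\<lambda>f' f. (if f' = f then 1 else 0) + Amat gl bt veer m f' f)"

definition AB_cycles where
  "AB_cycles n gl bt veer = (\<lambda>f. {(Afun gl bt veer ^^ j) f | j. True}) ` faces n gl"

definition AB_product where
  "AB_product n gl bt veer m = (\<Prod>C\<in>AB_cycles n gl bt veer.
      1 + (-1) ^ (card C + 1) * gX (\<Sum>f\<in>C. Alab gl bt veer m f))"

end

theory Submission
  imports Defs "HOL-Library.FuncSet"
begin

text \<open>
  Let \<open>L\<close> be the matrix of the veering polynomial, \<open>N\<close> the face matrix defining the taut polynomial,
  \<open>A\<close> the matrix of the AB permutation and \<open>B\<close> the map from a face to its bottom edge. Veering
  forces \<open>N (I + A) = L B\<close>. The kernel of \<open>B\<close> is free, with a basis \<open>K\<close> indexed by tetrahedra;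
  put \<open>D = (I + A) K\<close>. Completing \<open>N\<close> to a square matrix by unit rows gives, for every maximal
  minor of \<open>N\<close>,
  \<open>det (I + A) * minor = unit * det L * complementary minor of D\<close>.
  A row of \<open>D\<close> has two entries, both units, and relates the two tetrahedra at a face, so for
  every closed walk of class \<open>g\<close> in the dual graph the row space of \<open>D\<close> contains all multiples of
  \<open>1 - \<epsilon> g\<close>, where \<open>\<epsilon>\<close> is a sign. As the rank exceeds 1, two such binomials are coprime, and hence
  \<open>det L\<close> and \<open>det (I + A) * \<Theta>\<close> differ by a unit of the group ring.
\<close>

section \<open>Determinants over finite index sets\<close>

text \<open>\<open>N\<close> has twice as many columns as rows, so no determinant can be taken of
  \<open>N (I + A) = L B\<close> as it stands. Completing \<open>N\<close> by unit rows and
  splitting off the kernel of \<open>B\<close> makes every factor square; the price is the minors of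
  \<open>D\<close>. They are removed as follows. Write \<open>p = det (I + A)\<close>,
  \<open>d = det L\<close>, and let \<alpha> be a binomial of a closed walk. Some \<open>X\<close>
  satisfies \<open>X D = \<alpha> I\<close>, so by the Cauchy-Binet expansion the power of \<alpha>
  with exponent \<open>card E\<close> is a combination of maximal minors of \<open>D\<close>. Hence
  \<open>p a\<close> equals \<open>d\<close> times that power for some \<open>a\<close> divisible by
  \<Theta>. One binomial leaves open whether \<open>p * \<Theta>\<close> and \<open>d\<close> differ
  by a divisor of its powers; a second binomial \<beta> coprime to the first closes this gap.
  Coprimality is used as a cancellation rule: if \<alpha> divides \<open>x * \<beta>\<close>, then
  \<alpha> divides \<open>x\<close>. It is obtained from a linear functional that vanishes on the
  class of the first walk and is positive, up to sign, on the class of the second; rank greater than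
  1 is what provides such a functional. The lemmas carry the sign of a walk as an arbitrary
  integer.\<close>

lemma det_on_cong:
  assumes "\<And>x y. x \<in> S \<Longrightarrow> y \<in> S \<Longrightarrow> M x y = N x y"
  shows "det_on S M = det_on S N"
  unfolding det_on_def
  by (intro sum.cong refl arg_cong2[where f="(*)"] prod.cong assms)
     (auto simp: permutes_in_image)

lemma det_on_transpose:
  assumes "finite S"
  shows "det_on S (\<lambda>x y. M y x) = det_on S M"
proof -
  have "det_on S M = (\<Sum>p\<in>{p. p permutes S}. of_int (sign (inv p)) * (\<Prod>x\<in>S. M (inv p x) x))"
    unfolding det_on_def by (rule sum_permutations_inverse)
  also have "\<dots> = (\<Sum>p\<in>{p. p permutes S}. of_int (sign p) * (\<Prod>x\<in>S. M x (p x)))"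
  proof (rule sum.cong[OF refl])
    fix p assume "p \<in> {p. p permutes S}"
    then have p: "p permutes S" by simp
    have "(\<Prod>x\<in>S. M (inv p x) x) = (\<Prod>x\<in>S. M (inv p (p x)) (p x))"
      by (rule prod.reindex_bij_betw[OF permutes_imp_bij[OF p], symmetric])
    also have "\<dots> = (\<Prod>x\<in>S. M x (p x))"
      by (simp add: permutes_inverses[OF p])
    finally show "of_int (sign (inv p)) * (\<Prod>x\<in>S. M (inv p x) x)
        = of_int (sign p) * (\<Prod>x\<in>S. M x (p x))"
      using permutes_imp_permutation[OF assms p] by (simp add: sign_inverse)
  qed
  finally show ?thesis by (simp add: det_on_def)
qed

lemma det_on_permute_rows:
  assumes "finite S" and q: "q permutes S"
  shows "det_on S (\<lambda>x y. M (q x) y) = of_int (sign q) * det_on S M"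
proof -
  have "det_on S M = (\<Sum>p\<in>{p. p permutes S}. of_int (sign (q \<circ> p)) * (\<Prod>x\<in>S. M ((q \<circ> p) x) x))"
    unfolding det_on_def by (rule setum_permutations_compose_left[OF q])
  also have "\<dots> = (\<Sum>p\<in>{p. p permutes S}. of_int (sign q) * (of_int (sign p) * (\<Prod>x\<in>S. M (q (p x)) x)))"
    by (rule sum.cong[OF refl])
       (use assms in \<open>auto simp: sign_compose permutes_imp_permutation mult.assoc\<close>)
  also have "\<dots> = of_int (sign q) * det_on S (\<lambda>x y. M (q x) y)"
    by (simp add: det_on_def sum_distrib_left)
  finally have "of_int (sign q) * det_on S M = of_int (sign q * sign q) * det_on S (\<lambda>x y. M (q x) y)"
    by (simp only: of_int_mult mult.assoc)
  then show ?thesis by simp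
qed

text \<open>Composition with the transposition of the two rows pairs even with odd permutations
  whose terms cancel. The pairing avoids deducing the claim from \<open>det = - det\<close>, which
  would require dividing by 2.\<close>

lemma det_on_identical_rows:
  assumes "finite S" and xy: "x \<in> S" "y \<in> S" "x \<noteq> y" and eq: "\<And>z. z \<in> S \<Longrightarrow> M x z = M y z"
  shows "det_on S M = 0"
proof -
  let ?\<tau> = "transpose x y" and ?f = "\<lambda>p. of_int (sign p) * (\<Prod>x\<in>S. M (p x) x)"
  have t: "?\<tau> permutes S" using xy by (intro permutes_swap_id)
  have fin: "finite {p. p permutes S}" using assms(1) by (rule finite_permutations)
  have sgn: "sign (?\<tau> \<circ> p) = - sign p" if "p permutes S" for p
    using that t xy(3) assms(1)
    by (simp add: sign_compose permutes_imp_permutation sign_swap_id)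
  have even: "evenperm (?\<tau> \<circ> p) = (\<not> evenperm p)" if "p permutes S" for p
    using sgn[OF that] by (auto simp: sign_def split: if_splits)
  have M: "M (?\<tau> u) z = M u z" if "z \<in> S" for u z
    using eq[OF that] by (auto simp: transpose_def)
  have inv: "?\<tau> \<circ> (?\<tau> \<circ> p) = p" for p by (simp add: fun_eq_iff)
  have "(\<Sum>p\<in>{p. p permutes S \<and> \<not> evenperm p}. ?f p) = (\<Sum>p\<in>{p. p permutes S \<and> evenperm p}. - ?f p)"
    by (rule sum.reindex_bij_witness[where i="\<lambda>p. ?\<tau> \<circ> p" and j="\<lambda>p. ?\<tau> \<circ> p"])
       (auto simp: inv even sgn M intro: permutes_compose t)
  moreover have "det_on S M = (\<Sum>p\<in>{p. p permutes S \<and> evenperm p}. ?f p)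
      + (\<Sum>p\<in>{p. p permutes S \<and> \<not> evenperm p}. ?f p)"
    unfolding det_on_def
    by (subst sum.union_disjoint[symmetric]) (auto intro: finite_subset[OF _ fin] sum.cong)
  ultimately show ?thesis by (simp add: sum_negf)
qed

text \<open>Multilinearity in the rows, for a rectangular product. This is Cauchy-Binet before the
  choice functions are grouped by their image; it serves both multiplicativity and the later
  argument with the minors of \<open>Dmat\<close>.\<close>

lemma det_on_mult_expand:
  assumes "finite S" "finite F"
  shows "det_on S (\<lambda>x y. \<Sum>z\<in>F. X x z * D z y)
    = (\<Sum>\<phi>\<in>PiE S (\<lambda>_. F). (\<Prod>x\<in>S. X x (\<phi> x)) * det_on S (\<lambda>x y. D (\<phi> x) y))"
proof -
  let ?P = "{p. p permutes S}" and ?\<Phi> = "PiE S (\<lambda>_. F)"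
  have tr: "det_on S N = (\<Sum>p\<in>?P. of_int (sign p) * (\<Prod>x\<in>S. N x (p x)))" for N :: "'a \<Rightarrow> 'a \<Rightarrow> 'c"
    using det_on_transpose[OF assms(1), of "\<lambda>x y. N y x"] by (simp add: det_on_def)
  have "det_on S (\<lambda>x y. \<Sum>z\<in>F. X x z * D z y)
      = (\<Sum>p\<in>?P. of_int (sign p) * (\<Sum>\<phi>\<in>?\<Phi>. \<Prod>x\<in>S. X x (\<phi> x) * D (\<phi> x) (p x)))"
    unfolding tr by (simp add: prod_sum_PiE assms)
  also have "\<dots> = (\<Sum>p\<in>?P. \<Sum>\<phi>\<in>?\<Phi>. (\<Prod>x\<in>S. X x (\<phi> x)) * (of_int (sign p) * (\<Prod>x\<in>S. D (\<phi> x) (p x))))"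
    by (simp add: sum_distrib_left prod.distrib mult_ac)
  also have "\<dots> = (\<Sum>\<phi>\<in>?\<Phi>. (\<Prod>x\<in>S. X x (\<phi> x)) * det_on S (\<lambda>x y. D (\<phi> x) y))"
    unfolding tr by (subst sum.swap) (simp add: sum_distrib_left)
  finally show ?thesis .
qed

lemma det_on_mult:
  assumes "finite S"
  shows "det_on S (\<lambda>x y. \<Sum>z\<in>S. M x z * N z y) = det_on S M * det_on S N"
proof -
  let ?P = "{p. p permutes S}" and ?\<Phi> = "PiE S (\<lambda>_. S)"
  let ?g = "\<lambda>\<phi>. (\<Prod>x\<in>S. M x (\<phi> x)) * det_on S (\<lambda>x y. N (\<phi> x) y)"
  have fin: "finite ?\<Phi>" using assms by (intro finite_PiE) auto
  have "det_on S (\<lambda>x y. \<Sum>z\<in>S. M x z * N z y) = (\<Sum>\<phi>\<in>?\<Phi>. ?g \<phi>)"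
    using assms by (intro det_on_mult_expand)
  also have "\<dots> = (\<Sum>\<phi>\<in>{\<phi>\<in>?\<Phi>. inj_on \<phi> S}. ?g \<phi>)"
  proof (rule sum.mono_neutral_right[OF fin])
    show "\<forall>\<phi>\<in>?\<Phi> - {\<phi> \<in> ?\<Phi>. inj_on \<phi> S}. ?g \<phi> = 0"
    proof
      fix \<phi> assume "\<phi> \<in> ?\<Phi> - {\<phi> \<in> ?\<Phi>. inj_on \<phi> S}"
      then obtain x y where "x \<in> S" "y \<in> S" "x \<noteq> y" "\<phi> x = \<phi> y" by (auto simp: inj_on_def)
      then have "det_on S (\<lambda>x y. N (\<phi> x) y) = 0"
        by (intro det_on_identical_rows[OF assms, of x y]) auto
      then show "?g \<phi> = 0" by simp
    qed
  qed auto
  also have "\<dots> = (\<Sum>p\<in>?P. ?g p)"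
  \<comment> \<open>Functions in \<open>PiE\<close> are \<open>undefined\<close> outside
    \<open>S\<close>, while permutations of \<open>S\<close> are the identity there; the two maps
    only exchange these default values.\<close>
  proof (rule sum.reindex_bij_witness[where j="\<lambda>\<phi> x. if x \<in> S then \<phi> x else x" and i="\<lambda>p. restrict p S"])
    fix \<phi> assume a: "\<phi> \<in> {\<phi>\<in>?\<Phi>. inj_on \<phi> S}"
    then have "bij_betw \<phi> S S"
      using assms endo_inj_surj[of S \<phi>] by (auto simp: bij_betw_def)
    then have "bij_betw (\<lambda>x. if x \<in> S then \<phi> x else x) S S"
      by (subst bij_betw_cong[of S _ \<phi>]) auto
    then show "(\<lambda>x. if x \<in> S then \<phi> x else x) \<in> ?P" by (auto intro!: bij_imp_permutes)
    show "restrict (\<lambda>x. if x \<in> S then \<phi> x else x) S = \<phi>"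
      using a by (auto simp: restrict_def PiE_def extensional_def fun_eq_iff)
    show "?g (\<lambda>x. if x \<in> S then \<phi> x else x) = ?g \<phi>"
      by (intro arg_cong2[where f="(*)"] prod.cong det_on_cong) auto
  next
    fix p assume "p \<in> ?P"
    then have p: "p permutes S" by simp
    show "(\<lambda>x. if x \<in> S then restrict p S x else x) = p"
      using p by (auto simp: fun_eq_iff permutes_not_in)
    show "restrict p S \<in> {\<phi>\<in>?\<Phi>. inj_on \<phi> S}"
      using p permutes_inj_on[OF p, of S] by (auto simp: permutes_in_image inj_on_def)
  qed
  also have "\<dots> = (\<Sum>p\<in>?P. of_int (sign p) * (\<Prod>x\<in>S. M x (p x)) * det_on S N)"
    by (rule sum.cong) (auto simp: det_on_permute_rows[OF assms] mult_ac)
  also have "\<dots> = det_on S (\<lambda>x y. M y x) * det_on S N"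
    unfolding det_on_def sum_distrib_right[symmetric] by simp
  finally show ?thesis using det_on_transpose[OF assms] by metis
qed

lemma det_on_bij_betw:
  assumes b: "bij_betw \<beta> E E'" and "finite E"
  shows "det_on E' M = det_on E (\<lambda>x y. M (\<beta> x) (\<beta> y))"
proof -
  have inj: "inj_on \<beta> E" and im: "\<beta> ` E = E'" using b by (auto simp: bij_betw_def)
  define \<gamma> where "\<gamma> = inv_into E \<beta>"
  have b': "bij_betw \<gamma> E' E" unfolding \<gamma>_def by (rule bij_betw_inv_into[OF b])
  have 1: "map_permutation E' \<gamma> (map_permutation E \<beta> p) = p" if "p permutes E" for p
    by (rule map_permutation_compose_inv[OF b that]) (simp add: \<gamma>_def inj)
  have 2: "map_permutation E \<beta> (map_permutation E' \<gamma> p) = p" if "p permutes E'" for p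
    by (rule map_permutation_compose_inv[OF b' that])
       (use im in \<open>auto simp: \<gamma>_def f_inv_into_f\<close>)
  have "det_on E (\<lambda>x y. M (\<beta> x) (\<beta> y)) = det_on E' M"
    unfolding det_on_def
  proof (rule sum.reindex_bij_witness[where j="map_permutation E \<beta>" and i="map_permutation E' \<gamma>"])
    fix p assume "p \<in> {p. p permutes E}"
    then have p: "p permutes E" by simp
    show "map_permutation E' \<gamma> (map_permutation E \<beta> p) = p" by (rule 1[OF p])
    show "map_permutation E \<beta> p \<in> {p. p permutes E'}"
      using map_permutation_permutes[OF b p] by simp
    have "(\<Prod>x\<in>E'. M (map_permutation E \<beta> p x) x) = (\<Prod>x\<in>E. M (map_permutation E \<beta> p (\<beta> x)) (\<beta> x))"
      by (rule prod.reindex_bij_betw[OF b, symmetric])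
    also have "\<dots> = (\<Prod>x\<in>E. M (\<beta> (p x)) (\<beta> x))"
      using inj by (intro prod.cong refl) (simp add: map_permutation_apply)
    finally show "of_int (sign (map_permutation E \<beta> p)) * (\<Prod>x\<in>E'. M (map_permutation E \<beta> p x) x)
        = of_int (sign p) * (\<Prod>x\<in>E. M (\<beta> (p x)) (\<beta> x))"
      using sign_map_permutation[OF inj p assms(2)] by simp
  next
    fix p assume "p \<in> {p. p permutes E'}"
    then have p: "p permutes E'" by simp
    show "map_permutation E \<beta> (map_permutation E' \<gamma> p) = p" by (rule 2[OF p])
    show "map_permutation E' \<gamma> p \<in> {p. p permutes E}"
      using map_permutation_permutes[OF b' p] by simp
  qed
  then show ?thesis by simp
qed

text \<open>A permutation with a nonzero term cannot send a column of \<open>S\<close> to a row of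
  \<open>R\<close>, so it preserves \<open>S\<close>, hence also \<open>R\<close> by finiteness, and
  is the product of a permutation of \<open>S\<close> and one of \<open>R\<close>.\<close>

lemma det_on_block:
  assumes fin: "finite S" "finite R" and disj: "S \<inter> R = {}"
    and zero: "\<And>x y. x \<in> R \<Longrightarrow> y \<in> S \<Longrightarrow> M x y = 0"
  shows "det_on (S \<union> R) M = det_on S M * det_on R M"
proof -
  let ?f = "\<lambda>A p. of_int (sign p) * (\<Prod>x\<in>A. M (p x) x)"
  let ?Q = "{p. p permutes S \<union> R \<and> p ` S \<subseteq> S}"
  have "det_on (S \<union> R) M = (\<Sum>p\<in>?Q. ?f (S \<union> R) p)"
    unfolding det_on_def
  proof (rule sum.mono_neutral_right)
    show "finite {p. p permutes S \<union> R}" using fin by (intro finite_permutations) auto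
    show "\<forall>p\<in>{p. p permutes S \<union> R} - ?Q. ?f (S \<union> R) p = 0"
    proof
      fix p assume "p \<in> {p. p permutes S \<union> R} - ?Q"
      then obtain y where p: "p permutes S \<union> R" and y: "y \<in> S" "p y \<notin> S" by auto
      then have "p y \<in> R" using permutes_in_image[OF p, of y] by auto
      then have "M (p y) y = 0" using y zero by auto
      then have "(\<Prod>x\<in>S \<union> R. M (p x) x) = 0" using fin y by (intro prod_zero) auto
      then show "?f (S \<union> R) p = 0" by simp
    qed
  qed auto
  also have "\<dots> = (\<Sum>(p, q)\<in>{p. p permutes S} \<times> {q. q permutes R}. ?f S p * ?f R q)"
  proof (rule sum.reindex_bij_witness[where
        j="\<lambda>p. (\<lambda>x. if x \<in> S then p x else x, \<lambda>x. if x \<in> R then p x else x)"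
        and i="\<lambda>(p, q). p \<circ> q"])
    fix p assume a: "p \<in> ?Q"
    then have p: "p permutes S \<union> R" and pS: "p ` S \<subseteq> S" by auto
    have injp: "inj p" using p by (rule permutes_inj)
    have S: "p ` S = S" using fin(1) pS injp by (simp add: endo_inj_surj inj_on_subset)
    have "p ` (S \<union> R) = S \<union> R" using p by (rule permutes_image)
    then have R: "p ` R = R"
      using S disj injp by (auto simp: image_Un) (metis Un_iff disjoint_iff imageE inj_eq rangeI image_eqI)+
    let ?p = "\<lambda>x. if x \<in> S then p x else x" and ?q = "\<lambda>x. if x \<in> R then p x else x"
    have bS: "bij_betw ?p S S"
      using S injp by (subst bij_betw_cong[of S _ p]) (auto simp: bij_betw_def intro: inj_on_subset)
    have bR: "bij_betw ?q R R"
      using R injp by (subst bij_betw_cong[of R _ p]) (auto simp: bij_betw_def intro: inj_on_subset)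
    have 1: "?p permutes S" "?q permutes R" using bS bR by (auto intro!: bij_imp_permutes)
    then show "(?p, ?q) \<in> {p. p permutes S} \<times> {q. q permutes R}" by auto
    show 2: "(case (?p, ?q) of (p, q) \<Rightarrow> p \<circ> q) = p"
      using disj R permutes_not_in[OF p] by (auto simp: fun_eq_iff)
    have "sign p = sign ?p * sign ?q"
      using 2 sign_compose[of ?p ?q] 1 fin by (auto simp: permutes_imp_permutation)
    moreover have "(\<Prod>x\<in>S \<union> R. M (p x) x) = (\<Prod>x\<in>S. M (?p x) x) * (\<Prod>x\<in>R. M (?q x) x)"
      by (subst prod.union_disjoint[OF fin disj]) simp
    ultimately show "(case (?p, ?q) of (p, q) \<Rightarrow> ?f S p * ?f R q) = ?f (S \<union> R) p"
      by (simp add: mult_ac)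
  next
    fix pq assume "pq \<in> {p. p permutes S} \<times> {q. q permutes R}"
    then obtain p q where [simp]: "pq = (p, q)" and p: "p permutes S" and q: "q permutes R" by auto
    have "p (q x) = q x" if "x \<in> R" for x
      using that disj permutes_in_image[OF q, of x] permutes_not_in[OF p, of "q x"] by auto
    then show "(\<lambda>x. if x \<in> S then (case pq of (p, q) \<Rightarrow> p \<circ> q) x else x,
           \<lambda>x. if x \<in> R then (case pq of (p, q) \<Rightarrow> p \<circ> q) x else x) = pq"
      using disj permutes_not_in[OF p] permutes_not_in[OF q] by (auto simp: fun_eq_iff disjoint_iff)
    have "p \<circ> q permutes S \<union> R"
      by (rule permutes_compose[OF permutes_subset[OF q] permutes_subset[OF p]]) auto
    moreover have "(p \<circ> q) ` S \<subseteq> S"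
      using disj permutes_in_image[OF p] permutes_not_in[OF q] by (auto simp: disjoint_iff)
    ultimately show "(case pq of (p, q) \<Rightarrow> p \<circ> q) \<in> ?Q" by simp
  qed
  also have "\<dots> = det_on S M * det_on R M"
    by (simp add: det_on_def sum_product sum.cartesian_product)
  finally show ?thesis .
qed

lemma det_on_scalar:
  assumes "finite S"
  shows "det_on S (\<lambda>x y. if x = y then c else 0) = c ^ card S"
proof -
  have "det_on S (\<lambda>x y. if x = y then c else 0)
      = (\<Sum>p\<in>{id}. of_int (sign p) * (\<Prod>x\<in>S. if p x = x then c else 0))"
    unfolding det_on_def
  proof (rule sum.mono_neutral_right)
    show "finite {p. p permutes S}" using assms by (rule finite_permutations)
    show "\<forall>p\<in>{p. p permutes S} - {id}. of_int (sign p) * (\<Prod>x\<in>S. if p x = x then c else 0) = 0"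
    proof
      fix p assume "p \<in> {p. p permutes S} - {id}"
      then obtain x where "p permutes S" "p x \<noteq> x" by (auto simp: fun_eq_iff)
      then have "x \<in> S" by (meson permutes_not_in)
      with \<open>p x \<noteq> x\<close> have "(\<Prod>x\<in>S. if p x = x then c else 0) = 0"
        using assms by (intro prod_zero) auto
      then show "of_int (sign p) * (\<Prod>x\<in>S. if p x = x then c else 0) = 0" by simp
    qed
  qed (auto simp: permutes_id)
  then show ?thesis by simp
qed

text \<open>Having no proper nonempty invariant subset means that \<open>p\<close> is a single
  cycle. Composing with the transposition of \<open>x\<close> and \<open>p x\<close> makes
  \<open>x\<close> a fixed point, leaves a single cycle on the remaining points, and flips the
  sign.\<close>

lemma sign_cyclic_permutation:
  assumes "finite C" "C \<noteq> {}" "p permutes C"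
    and "\<And>A. A \<subseteq> C \<Longrightarrow> p ` A \<subseteq> A \<Longrightarrow> A = {} \<or> A = C"
  shows "sign p = (-1) ^ (card C + 1)"
  using assms
proof (induction "card C" arbitrary: C p rule: less_induct)
  case less
  then obtain x where x: "x \<in> C" by auto
  have p: "p permutes C" by fact
  have inj: "inj p" using p by (rule permutes_inj)
  show ?case
  proof (cases "p x = x")
    case True
    then have "C = {x}" using less.prems(4)[of "{x}"] x by auto
    then show ?thesis using p by (auto simp: permutes_sing)
  next
    case False
    let ?q = "transpose x (p x) \<circ> p" and ?D = "C - {x}"
    have px: "p x \<in> C" using x permutes_in_image[OF p] by auto
    have "?q permutes C"
      using x px by (intro permutes_compose[OF p] permutes_swap_id)
    then have q: "?q permutes ?D"
      by (rule permutes_superset) simp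
    have tr: "A = {} \<or> A = ?D" if A: "A \<subseteq> ?D" "?q ` A \<subseteq> A" for A
    \<comment> \<open>\<open>?q\<close> differs from \<open>p\<close> only at \<open>x\<close> and
      at the preimage of \<open>x\<close>, which it sends to \<open>p x\<close>. If \<open>A\<close>
      contains that preimage, adjoining \<open>x\<close> to \<open>A\<close> gives a
      \<open>p\<close>-invariant set; otherwise \<open>A\<close> itself is
      \<open>p\<close>-invariant.\<close>
    proof (cases "\<exists>y\<in>A. p y = x")
      case True
      then obtain y where y: "y \<in> A" "p y = x" by auto
      then have "?q y \<in> A" using A(2) by blast
      then have "p x \<in> A" using y by simp
      moreover have "p z \<in> insert x A" if "z \<in> A" for z
      proof -
        have "?q z \<in> A" using A(2) that by blast
        moreover have "p z \<noteq> p x" using A(1) that by (auto simp: inj_eq[OF inj])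
        ultimately show ?thesis by (cases "p z = x") auto
      qed
      ultimately have "p ` insert x A \<subseteq> insert x A" by auto
      then have "insert x A = C" using less.prems(4)[of "insert x A"] A(1) x by auto
      then show ?thesis using A(1) by auto
    next
      case False
      have "p z \<in> A" if "z \<in> A" for z
      proof -
        have "?q z \<in> A" using A(2) that by blast
        moreover have "p z \<noteq> p x" "p z \<noteq> x" using A(1) that False by (auto simp: inj_eq[OF inj])
        ultimately show ?thesis by simp
      qed
      then have "A = {} \<or> A = C" using less.prems(4)[of A] A(1) by auto
      then show ?thesis using A(1) x by auto
    qed
    have D: "card ?D < card C" "?D \<noteq> {}" "finite ?D"
      using card_Diff1_less[OF less.prems(1) x] x px False less.prems(1) by auto
    have "sign ?q = (-1) ^ (card ?D + 1)"
      by (rule less.hyps[OF D(1) D(3) D(2) q tr])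
    moreover have "sign ?q = - sign p"
      using False p x px less.prems(1)
      by (simp add: sign_compose permutes_imp_permutation[of C] sign_swap_id permutation_swap_id)
    moreover have "card C = Suc (card ?D)" by (rule card.remove[OF less.prems(1) x])
    ultimately show ?thesis by simp
  qed
qed

text \<open>A permutation with a nonzero term sends each \<open>x\<close> to \<open>x\<close> or to
  \<open>\<sigma> x\<close>, and the set of points it moves is invariant under \<sigma>. Thus only
  the identity and the cycle itself contribute.\<close>

lemma det_on_one_plus_cycle:
  fixes a :: "'a \<Rightarrow> 'b::comm_ring_1"
  assumes fin: "finite C" and ne: "C \<noteq> {}" and bij: "bij_betw \<sigma> C C"
    and tr: "\<And>A. A \<subseteq> C \<Longrightarrow> \<sigma> ` A \<subseteq> A \<Longrightarrow> A = {} \<or> A = C"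
  shows "det_on C (\<lambda>y x. (if y = x then 1 else 0) + (if y = \<sigma> x then a x else 0))
    = 1 + (-1) ^ (card C + 1) * (\<Prod>x\<in>C. a x)"
\<comment> \<open>A fixed point forces \<open>C\<close> to be a singleton; then both contributions
  sit in the same diagonal entry and the two permutations coincide.\<close>
proof (cases "\<exists>x\<in>C. \<sigma> x = x")
  case True
  then obtain x where "x \<in> C" "\<sigma> x = x" by auto
  then have "C = {x}" using tr[of "{x}"] by auto
  then show ?thesis using \<open>\<sigma> x = x\<close> by (simp add: det_on_def permutes_sing)
next
  case False
  define p where "p x = (if x \<in> C then \<sigma> x else x)" for x
  have "bij_betw p C C" using bij by (subst bij_betw_cong[of C _ \<sigma>]) (auto simp: p_def)
  then have p: "p permutes C" by (rule bij_imp_permutes) (auto simp: p_def)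
  have sg: "sign p = (-1) ^ (card C + 1)"
    by (rule sign_cyclic_permutation[OF fin ne p], rule tr) (auto simp: p_def image_subset_iff subset_iff)
  have pid: "p \<noteq> id" using ne False by (auto simp: p_def fun_eq_iff)
  let ?f = "\<lambda>q. of_int (sign q) * (\<Prod>x\<in>C. (if q x = x then 1 else 0) + (if q x = \<sigma> x then a x else 0))"
  have "det_on C (\<lambda>y x. (if y = x then 1 else 0) + (if y = \<sigma> x then a x else 0)) = (\<Sum>q\<in>{id, p}. ?f q)"
    unfolding det_on_def
  proof (rule sum.mono_neutral_right)
    show "finite {p. p permutes C}" using fin by (rule finite_permutations)
    show "{id, p} \<subseteq> {p. p permutes C}" using p by (auto simp: permutes_id)
    show "\<forall>q\<in>{p. p permutes C} - {id, p}. ?f q = 0"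
    proof
      fix q assume "q \<in> {p. p permutes C} - {id, p}"
      then have q: "q permutes C" "q \<noteq> id" "q \<noteq> p" by auto
      have "\<exists>x\<in>C. q x \<noteq> x \<and> q x \<noteq> \<sigma> x"
      proof (rule ccontr)
        assume neg: "\<not> ?thesis"
        let ?A = "{x \<in> C. q x \<noteq> x}"
        have "\<sigma> x \<in> ?A" if "x \<in> ?A" for x
        proof -
          have "q x = \<sigma> x" "x \<in> C" using neg that by auto
          moreover have "\<sigma> x \<in> C" using that bij by (auto simp: bij_betw_def)
          moreover have "q (\<sigma> x) \<noteq> \<sigma> x"
          proof
            assume "q (\<sigma> x) = \<sigma> x"
            then have "q (\<sigma> x) = q x" using \<open>q x = \<sigma> x\<close> by simp
            then have "\<sigma> x = x" by (rule injD[OF permutes_inj[OF q(1)]])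
            then show False using False \<open>x \<in> C\<close> by auto
          qed
          ultimately show ?thesis by auto
        qed
        then have "?A = {} \<or> ?A = C" using tr[of ?A] by auto
        then show False
        proof
          assume "?A = {}"
          then have "q = id" using permutes_not_in[OF q(1)] by (auto simp: fun_eq_iff)
          then show False using q by simp
        next
          assume "?A = C"
          then have "q = p" using neg permutes_not_in[OF q(1)] by (auto simp: fun_eq_iff p_def)
          then show False using q by simp
        qed
      qed
      then obtain x where "x \<in> C" "q x \<noteq> x" "q x \<noteq> \<sigma> x" by auto
      then have "(\<Prod>x\<in>C. (if q x = x then 1 else 0) + (if q x = \<sigma> x then a x else 0)) = 0"
        using fin by (intro prod_zero) auto
      then show "?f q = 0" by simp
    qed
  qed
  also have "\<dots> = ?f id + ?f p" using pid by simp
  also have "?f id = 1" using False by (auto intro!: prod.neutral)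
  also have "?f p = (-1) ^ (card C + 1) * (\<Prod>x\<in>C. a x)"
    using False by (auto simp: sg p_def intro!: arg_cong2[where f="(*)"] prod.cong)
  finally show ?thesis .
qed

text \<open>The orbit of one element is split off as a diagonal block. Orbits are taken under
  nonnegative powers only; by finiteness \<sigma> maps such an orbit onto itself, so its complement
  is invariant as well.\<close>

lemma det_on_one_plus_permutation:
  fixes a :: "'a \<Rightarrow> 'b::comm_ring_1"
  assumes "finite F" "bij_betw \<sigma> F F"
  shows "det_on F (\<lambda>y x. (if y = x then 1 else 0) + (if y = \<sigma> x then a x else 0))
    = (\<Prod>C\<in>(\<lambda>f. {(\<sigma> ^^ j) f | j. True}) ` F. 1 + (-1) ^ (card C + 1) * (\<Prod>x\<in>C. a x))"
  using assms
proof (induction "card F" arbitrary: F rule: less_induct)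
  case less
  let ?M = "\<lambda>y x. (if y = x then 1 else 0) + (if y = \<sigma> x then a x else 0)"
  let ?o = "\<lambda>f. {(\<sigma> ^^ j) f | j. True}"
  have bij: "bij_betw \<sigma> F F" and fin: "finite F" by fact+
  have inj: "inj_on \<sigma> F" and im: "\<sigma> ` F = F" using bij by (auto simp: bij_betw_def)
  show ?case
  proof (cases "F = {}")
    case True
    then show ?thesis by (simp add: det_on_def)
  next
    case False
    then obtain f where f: "f \<in> F" by auto
    define C where "C = ?o f"
    have pw: "(\<sigma> ^^ j) x \<in> F" if "x \<in> F" for x j using that im by (induction j) auto
    have CF: "C \<subseteq> F" using pw f by (auto simp: C_def)
    have finC: "finite C" using CF fin finite_subset by blast
    have self: "x \<in> ?o x" for x by (rule CollectI, rule exI[of _ 0]) simp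
    have oinv: "\<sigma> ` ?o x \<subseteq> ?o x" for x
    proof (rule image_subsetI)
      fix y assume "y \<in> ?o x"
      then obtain j where "y = (\<sigma> ^^ j) x" by auto
      then show "\<sigma> y \<in> ?o x" by (intro CollectI exI[of _ "Suc j"]) simp
    qed
    have fC: "f \<in> C" unfolding C_def by (rule self)
    have Cinv: "\<sigma> ` C \<subseteq> C" unfolding C_def by (rule oinv)
    have Cim: "\<sigma> ` C = C"
      using Cinv finC CF inj by (meson endo_inj_surj inj_on_subset)
    have bC: "bij_betw \<sigma> C C" using Cim CF inj by (auto simp: bij_betw_def intro: inj_on_subset)
    have cl: "C \<subseteq> A" if "f \<in> A" "\<sigma> ` A \<subseteq> A" for A
    proof -
      have "(\<sigma> ^^ j) f \<in> A" for j using that by (induction j) auto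
      then show ?thesis by (auto simp: C_def)
    qed
    have compl: "\<sigma> ` (B - A) \<subseteq> B - A" if "A \<subseteq> B" "\<sigma> ` A = A" "\<sigma> ` B \<subseteq> B" "B \<subseteq> F" for A B
    proof -
      have "\<sigma> x \<notin> A" if x: "x \<in> B - A" for x
      proof
        assume "\<sigma> x \<in> A"
        then obtain y where "y \<in> A" "\<sigma> x = \<sigma> y" using \<open>\<sigma> ` A = A\<close> by (metis imageE)
        then have "x = y" using inj x \<open>A \<subseteq> B\<close> \<open>B \<subseteq> F\<close> by (auto dest!: inj_onD)
        then show False using x \<open>y \<in> A\<close> by simp
      qed
      then show ?thesis using that by auto
    qed
    have tr: "A = {} \<or> A = C" if A: "A \<subseteq> C" "\<sigma> ` A \<subseteq> A" for A
    proof (cases "f \<in> A")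
      case True
      then show ?thesis using cl A by blast
    next
      case False
      have "\<sigma> ` A = A"
        using A finC CF inj by (meson endo_inj_surj inj_on_subset finite_subset subset_trans)
      then have "\<sigma> ` (C - A) \<subseteq> C - A" using compl A Cinv CF by blast
      then have "C \<subseteq> C - A" using cl[of "C - A"] fC False by auto
      then show ?thesis using A by auto
    qed
    define R where "R = F - C"
    have Rinv: "\<sigma> ` R \<subseteq> R" unfolding R_def using compl[OF CF Cim] im by auto
    have finR: "finite R" unfolding R_def using fin by auto
    have Rim: "\<sigma> ` R = R"
      using Rinv finR inj_on_subset[OF inj, of R] by (intro endo_inj_surj) (auto simp: R_def)
    have bR: "bij_betw \<sigma> R R" using Rim inj by (auto simp: bij_betw_def R_def intro: inj_on_subset)
    have "card R < card F" unfolding R_def using fC CF fin by (intro psubset_card_mono) auto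
    then have IH: "det_on R ?M = (\<Prod>C\<in>?o ` R. 1 + (-1) ^ (card C + 1) * (\<Prod>x\<in>C. a x))"
      using less.hyps finR bR by blast
    have "det_on F ?M = det_on C ?M * det_on R ?M"
    proof -
      have "F = C \<union> R" using CF by (auto simp: R_def)
      moreover have "det_on (C \<union> R) ?M = det_on C ?M * det_on R ?M"
        using Cim by (intro det_on_block[OF finC finR]) (auto simp: R_def)
      ultimately show ?thesis by simp
    qed
    also have "det_on C ?M = 1 + (-1) ^ (card C + 1) * (\<Prod>x\<in>C. a x)"
      using fC by (intro det_on_one_plus_cycle[OF finC _ bC tr]) auto
    also note IH
    also have "?o ` F = insert C (?o ` R)"
    proof -
      have "?o g = C" if "g \<in> C" for g
      proof -
        have "(\<sigma> ^^ j) g \<in> C" for j using that Cinv by (induction j) auto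
        then have "?o g \<subseteq> C" by auto
        then show ?thesis using tr[OF _ oinv] self[of g] by blast
      qed
      moreover have "F = C \<union> R" using CF by (auto simp: R_def)
      ultimately show ?thesis using fC by (auto simp: image_Un)
    qed
    moreover have "C \<notin> ?o ` R"
    proof
      assume "C \<in> ?o ` R"
      then obtain g where g: "g \<in> R" "C = ?o g" by auto
      then show False using self[of g] by (simp add: R_def)
    qed
    ultimately show ?thesis using finR by simp
  qed
qed

text \<open>The hypotheses say that the rows of \<open>B\<close> and \<open>C\<close> invert the
  columns of \<open>S\<close> and \<open>K\<close>. With \<open>NN\<close> the completion of
  \<open>N\<close> by unit rows at \<phi> and \<open>P\<close> the matrix of columns
  \<open>S\<close> and \<open>K\<close>, the product \<open>NN M P\<close> has the rows
  \<open>L B P\<close>, that is \<open>L\<close> followed by 0, at \<beta>, and the lower right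
  block \<open>M K\<close> restricted to \<phi>. Comparing determinants gives the identity with
  \<open>u = det P\<close>, a unit.\<close>

lemma det_on_complementary_minors:
  fixes L :: "'e \<Rightarrow> 'e \<Rightarrow> 'b::comm_ring_1" and M :: "'f \<Rightarrow> 'f \<Rightarrow> 'b"
  assumes finE: "finite E" and finF: "finite F"
    and LM: "\<And>e f. e \<in> E \<Longrightarrow> f \<in> F \<Longrightarrow> (\<Sum>g\<in>F. N e g * M g f) = (\<Sum>e'\<in>E. L e e' * B e' f)"
    and BS: "\<And>e e'. e \<in> E \<Longrightarrow> e' \<in> E \<Longrightarrow> (\<Sum>f\<in>F. B e f * S f e') = (if e = e' then 1 else 0)"
    and BK: "\<And>e e'. e \<in> E \<Longrightarrow> e' \<in> E \<Longrightarrow> (\<Sum>f\<in>F. B e f * K f e') = 0"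
    and CS: "\<And>e e'. e \<in> E \<Longrightarrow> e' \<in> E \<Longrightarrow> (\<Sum>f\<in>F. C e f * S f e') = 0"
    and CK: "\<And>e e'. e \<in> E \<Longrightarrow> e' \<in> E \<Longrightarrow> (\<Sum>f\<in>F. C e f * K f e') = (if e = e' then 1 else 0)"
    and inj: "inj_on \<beta> E" "inj_on \<phi> E" and disj: "\<beta> ` E \<inter> \<phi> ` E = {}" and un: "\<beta> ` E \<union> \<phi> ` E = F"
  obtains u v where "u * v = 1"
    "det_on F M * det_on E (\<lambda>e e'. N e (\<beta> e')) * u
      = det_on E L * det_on E (\<lambda>e e'. \<Sum>g\<in>F. M (\<phi> e) g * K g e')"
proof -
  define b where "b = inv_into E \<beta>"
  define c where "c = inv_into E \<phi>"
  have b: "b (\<beta> e) = e" if "e \<in> E" for e using inj that by (simp add: b_def)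
  have c: "c (\<phi> e) = e" if "e \<in> E" for e using inj that by (simp add: c_def)
  define isb where "isb f \<longleftrightarrow> f \<in> \<beta> ` E" for f
  have isb: "isb (\<beta> e)" "\<not> isb (\<phi> e)" if "e \<in> E" for e using that disj by (auto simp: isb_def)
  \<comment> \<open>Rows and columns are all labelled by \<open>F\<close> itself, through \<beta>
    and \<phi>, so that no sign of a reordering enters.\<close>
  define NN where "NN x y = (if isb x then N (b x) y else if x = y then 1 else 0)" for x y
  define P where "P x y = (if isb y then S x (b y) else K x (c y))" for x y
  define P' where "P' x y = (if isb x then B (b x) y else C (c x) y)" for x y
  have bb: "bij_betw \<beta> E (\<beta> ` E)" "bij_betw \<phi> E (\<phi> ` E)" using inj by (auto simp: bij_betw_def)
  have blk: "det_on F Q = det_on E (\<lambda>x y. Q (\<beta> x) (\<beta> y)) * det_on E (\<lambda>x y. Q (\<phi> x) (\<phi> y))"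
    if "\<And>x y. x \<in> E \<Longrightarrow> y \<in> E \<Longrightarrow> Q (\<phi> x) (\<beta> y) = 0" for Q :: "'f \<Rightarrow> 'f \<Rightarrow> 'b"
    using det_on_block[of "\<beta> ` E" "\<phi> ` E" Q] that disj un finE
      det_on_bij_betw[OF bb(1) finE, of Q] det_on_bij_betw[OF bb(2) finE, of Q] by auto
  have blk': "det_on F Q = det_on E (\<lambda>x y. Q (\<beta> x) (\<beta> y)) * det_on E (\<lambda>x y. Q (\<phi> x) (\<phi> y))"
    if "\<And>x y. x \<in> E \<Longrightarrow> y \<in> E \<Longrightarrow> Q (\<beta> x) (\<phi> y) = 0" for Q :: "'f \<Rightarrow> 'f \<Rightarrow> 'b"
    using det_on_block[of "\<phi> ` E" "\<beta> ` E" Q] that disj un finE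
      det_on_bij_betw[OF bb(1) finE, of Q] det_on_bij_betw[OF bb(2) finE, of Q]
    by (auto simp: Un_commute Int_commute mult.commute)
  have mem: "\<beta> e \<in> F" "\<phi> e \<in> F" if "e \<in> E" for e using that un by auto
  have "det_on F NN = det_on E (\<lambda>e e'. N e (\<beta> e')) * det_on E (\<lambda>x y. if x = y then 1 else 0)"
  proof (subst blk)
    show "NN (\<phi> x) (\<beta> y) = 0" if "x \<in> E" "y \<in> E" for x y
    proof -
      have "\<phi> x \<noteq> \<beta> y" using disj that by blast
      then show ?thesis using that by (simp add: NN_def isb)
    qed
    have "det_on E (\<lambda>x y. NN (\<beta> x) (\<beta> y)) = det_on E (\<lambda>e e'. N e (\<beta> e'))"
      by (rule det_on_cong) (simp add: NN_def isb b)
    moreover have "det_on E (\<lambda>x y. NN (\<phi> x) (\<phi> y)) = det_on E (\<lambda>x y. if x = y then 1 else 0)"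
      using inj by (intro det_on_cong) (auto simp: NN_def isb c inj_on_eq_iff)
    ultimately show "det_on E (\<lambda>x y. NN (\<beta> x) (\<beta> y)) * det_on E (\<lambda>x y. NN (\<phi> x) (\<phi> y))
      = det_on E (\<lambda>e e'. N e (\<beta> e')) * det_on E (\<lambda>x y. if x = y then 1 else 0)" by simp
  qed
  then have dN: "det_on F NN = det_on E (\<lambda>e e'. N e (\<beta> e'))" using finE by (simp add: det_on_scalar)
  have split: "x \<in> F \<Longrightarrow> (\<And>e. e \<in> E \<Longrightarrow> x = \<beta> e \<Longrightarrow> R) \<Longrightarrow> (\<And>e. e \<in> E \<Longrightarrow> x = \<phi> e \<Longrightarrow> R) \<Longrightarrow> R" for x R
    using un by auto
  have "det_on F P' * det_on F P = det_on F (\<lambda>x y. if x = y then 1 else 0)"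
    unfolding det_on_mult[OF finF, symmetric]
  proof (rule det_on_cong)
    fix x y assume x: "x \<in> F" and y: "y \<in> F"
    have ne: "\<beta> e \<noteq> \<phi> e'" if "e \<in> E" "e' \<in> E" for e e' using disj that by blast
    show "(\<Sum>z\<in>F. P' x z * P z y) = (if x = y then 1 else 0)"
    proof (rule split[OF x]; rule split[OF y])
      fix e e' assume *: "e \<in> E" "e' \<in> E"
      show "x = \<beta> e \<Longrightarrow> y = \<beta> e' \<Longrightarrow> ?thesis"
        using * inj by (simp add: P_def P'_def isb b BS inj_on_eq_iff)
      show "x = \<beta> e \<Longrightarrow> y = \<phi> e' \<Longrightarrow> ?thesis"
        using * ne by (simp add: P_def P'_def isb b c BK)
      show "x = \<phi> e \<Longrightarrow> y = \<beta> e' \<Longrightarrow> ?thesis"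
        using * ne[of e' e] by (simp add: P_def P'_def isb b c CS)
      show "x = \<phi> e \<Longrightarrow> y = \<phi> e' \<Longrightarrow> ?thesis"
        using * inj by (simp add: P_def P'_def isb c CK inj_on_eq_iff)
    qed
  qed
  then have u: "det_on F P * det_on F P' = 1" using finF by (simp add: det_on_scalar mult.commute)
  define MP where "MP x y = (\<Sum>z\<in>F. M x z * P z y)" for x y
  define Q where "Q x y = (\<Sum>z\<in>F. NN x z * MP z y)" for x y
  have dQ: "det_on F Q = det_on F NN * (det_on F M * det_on F P)"
    unfolding Q_def MP_def by (simp add: det_on_mult[OF finF])
  have Qb: "Q (\<beta> e) y = (\<Sum>e'\<in>E. L e e' * (\<Sum>z\<in>F. B e' z * P z y))" if "e \<in> E" for e y
  proof -
    have "Q (\<beta> e) y = (\<Sum>g\<in>F. \<Sum>z\<in>F. N e g * M g z * P z y)"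
      using that by (simp add: Q_def MP_def NN_def isb b sum_distrib_left mult.assoc)
    also have "\<dots> = (\<Sum>z\<in>F. (\<Sum>g\<in>F. N e g * M g z) * P z y)"
      by (subst sum.swap) (simp add: sum_distrib_right)
    also have "\<dots> = (\<Sum>z\<in>F. (\<Sum>e'\<in>E. L e e' * B e' z) * P z y)"
      using that by (simp add: LM)
    also have "\<dots> = (\<Sum>e'\<in>E. L e e' * (\<Sum>z\<in>F. B e' z * P z y))"
      by (simp add: sum_distrib_right sum_distrib_left mult.assoc) (rule sum.swap)
    finally show ?thesis .
  qed
  have Q1: "Q (\<beta> e) (\<beta> e') = L e e'" if "e \<in> E" "e' \<in> E" for e e'
    using that finE by (simp add: Qb P_def isb b BS if_distrib cong: if_cong)
  have Q2: "Q (\<beta> e) (\<phi> e') = 0" if "e \<in> E" "e' \<in> E" for e e'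
    using that by (simp add: Qb P_def isb c BK)
  have Q3: "Q (\<phi> e) (\<phi> e') = (\<Sum>g\<in>F. M (\<phi> e) g * K g e')" if "e \<in> E" "e' \<in> E" for e e'
  proof -
    have "Q (\<phi> e) (\<phi> e') = (\<Sum>z\<in>F. if \<phi> e = z then MP z (\<phi> e') else 0)"
      unfolding Q_def using that by (intro sum.cong refl) (simp add: NN_def isb)
    then show ?thesis using that finF mem by (simp add: MP_def P_def isb c)
  qed
  have "det_on F Q = det_on E L * det_on E (\<lambda>e e'. \<Sum>g\<in>F. M (\<phi> e) g * K g e')"
    using blk'[of Q] Q2 det_on_cong[of E "\<lambda>x y. Q (\<beta> x) (\<beta> y)" L] Q1
      det_on_cong[of E "\<lambda>x y. Q (\<phi> x) (\<phi> y)" "\<lambda>e e'. \<Sum>g\<in>F. M (\<phi> e) g * K g e'"] Q3 by simp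
  then show ?thesis using that[OF u] dQ dN by (simp add: mult_ac)
qed

section \<open>The group ring of a free abelian group\<close>

lemma dotv_add_right: "dotv lam (u + v) = dotv lam u + dotv lam v"
  by (simp add: dotv_def algebra_simps sum.distrib)

lemma dotv_diff_right: "dotv lam (u - v) = dotv lam u - dotv lam v"
  by (simp add: dotv_def algebra_simps sum_subtractf)

lemma dotv_zero_right [simp]: "dotv lam 0 = 0"
  by (simp add: dotv_def)

text \<open>Induction with a perturbation: a functional that already works on \<open>D\<close> is
  scaled up and the coordinate \<open>k\<close>, nonzero at the new vector, is added.\<close>

lemma exists_dotv_nonzero:
  assumes "finite D" "0 \<notin> D"
  shows "\<exists>lam :: int ^ 'r. \<forall>v\<in>D. dotv lam v \<noteq> 0"
  using assms
proof (induction D rule: finite_induct)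
  case (insert v D)
  then obtain lam where lam: "\<forall>u\<in>D. dotv lam u \<noteq> 0" by auto
  obtain k where k: "v $ k \<noteq> 0" using insert.prems by (auto simp: vec_eq_iff)
  show ?case
  proof (cases "dotv lam v = 0")
    case False
    then show ?thesis using lam by auto
  next
    case True
    \<comment> \<open>Exceeds every \<open>\<bar>u $ k\<bar>\<close> with \<open>u\<close> in
      \<open>D\<close>, so the added coordinate cannot cancel the nonzero multiple
      \<open>c * dotv lam u\<close>.\<close>
    define c where "c = 1 + (\<Sum>u\<in>D. \<bar>u $ k\<bar>)"
    define mu :: "int ^ 'r" where "mu = (\<chi> j. c * lam $ j + (if j = k then 1 else 0))"
    have mu: "dotv mu u = c * dotv lam u + u $ k" for u
    proof -
      have "dotv mu u = (\<Sum>j\<in>UNIV. c * (lam $ j * u $ j) + (if j = k then u $ j else 0))"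
        unfolding dotv_def mu_def by (rule sum.cong) (auto simp: algebra_simps)
      then show ?thesis by (simp add: dotv_def sum.distrib sum_distrib_left)
    qed
    have "dotv mu u \<noteq> 0" if "u \<in> D" for u
    proof
      assume "dotv mu u = 0"
      then have "\<bar>c\<bar> * \<bar>dotv lam u\<bar> = \<bar>u $ k\<bar>" unfolding mu abs_mult[symmetric] by simp
      moreover have "\<bar>u $ k\<bar> < c"
        unfolding c_def using member_le_sum[of u D "\<lambda>u. \<bar>u $ k\<bar>"] that insert.hyps by auto
      moreover have "1 \<le> \<bar>dotv lam u\<bar>" using lam that by force
      moreover have "\<bar>c\<bar> * 1 \<le> \<bar>c\<bar> * \<bar>dotv lam u\<bar>" using calculation(3) by (intro mult_left_mono) auto
      ultimately show False by linarith
    qed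
    moreover have "dotv mu v \<noteq> 0" using True k mu by simp
    ultimately show ?thesis by auto
  qed
qed auto

text \<open>A functional separating a finite support takes the place of a monomial order: it singles
  out leading terms of elements of the group ring.\<close>

lemma exists_dotv_inj_on:
  assumes "finite (S :: (int ^ 'r) set)"
  shows "\<exists>lam. inj_on (dotv lam) S"
proof -
  let ?D = "(\<lambda>(u, v). u - v) ` (S \<times> S) - {0}"
  obtain lam :: "int ^ 'r" where lam: "\<forall>v\<in>?D. dotv lam v \<noteq> 0"
    using exists_dotv_nonzero[of ?D] assms by auto
  have "inj_on (dotv lam) S"
  proof (rule inj_onI, rule ccontr)
    fix u v assume "u \<in> S" "v \<in> S" "dotv lam u = dotv lam v" "u \<noteq> v"
    then have "u - v \<in> ?D" by force
    then have "dotv lam (u - v) \<noteq> 0" using lam by blast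
    then show False using \<open>dotv lam u = dotv lam v\<close> by (simp add: dotv_diff_right)
  qed
  then show ?thesis by blast
qed

lemma poly_mapping_eq_sum_single:
  fixes x :: "'a \<Rightarrow>\<^sub>0 'b::comm_monoid_add"
  assumes "finite S" "Poly_Mapping.keys x \<subseteq> S"
  shows "x = (\<Sum>k\<in>S. Poly_Mapping.single k (Poly_Mapping.lookup x k))"
proof (rule poly_mapping_eqI)
  fix j
  have "(\<Sum>k\<in>S. Poly_Mapping.lookup (Poly_Mapping.single k (Poly_Mapping.lookup x k)) j)
      = (\<Sum>k\<in>S. if k = j then Poly_Mapping.lookup x k else 0)"
    by (rule sum.cong) (auto simp: lookup_single)
  also have "\<dots> = Poly_Mapping.lookup x j"
    using assms by (auto simp: in_keys_iff subset_iff)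
  finally show "Poly_Mapping.lookup x j
      = Poly_Mapping.lookup (\<Sum>k\<in>S. Poly_Mapping.single k (Poly_Mapping.lookup x k)) j"
    by (simp add: lookup_sum)
qed

text \<open>If \<open>s0 + t0\<close> arises from at most one pair of exponents, the convolution has
  a single term there. The exponents \<open>s0\<close> and \<open>t0\<close> may lie outside the
  supports, which makes the rule usable for scalar and monomial factors too.\<close>

lemma lookup_times_unique:
  fixes x y :: "'g::monoid_add \<Rightarrow>\<^sub>0 'b::semiring_0"
  assumes "\<And>s t. s \<in> Poly_Mapping.keys x \<Longrightarrow> t \<in> Poly_Mapping.keys y \<Longrightarrow> s + t = s0 + t0 \<Longrightarrow> s = s0 \<and> t = t0"
  shows "Poly_Mapping.lookup (x * y) (s0 + t0) = Poly_Mapping.lookup x s0 * Poly_Mapping.lookup y t0"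
proof -
  let ?l = Poly_Mapping.lookup and ?s = Poly_Mapping.single and ?K = Poly_Mapping.keys
  have "x * y = (\<Sum>s\<in>?K x. ?s s (?l x s)) * (\<Sum>t\<in>?K y. ?s t (?l y t))"
    using poly_mapping_eq_sum_single[of "?K x" x] poly_mapping_eq_sum_single[of "?K y" y] by simp
  also have "\<dots> = (\<Sum>s\<in>?K x. \<Sum>t\<in>?K y. ?s (s + t) (?l x s * ?l y t))"
    by (simp add: sum_product mult_single)
  finally have "?l (x * y) (s0 + t0) = (\<Sum>s\<in>?K x. \<Sum>t\<in>?K y. ?l x s * ?l y t when s + t = s0 + t0)"
    by (simp add: lookup_sum lookup_single)
  also have "\<dots> = (\<Sum>s\<in>?K x. \<Sum>t\<in>?K y. if s = s0 then if t = t0 then ?l x s * ?l y t else 0 else 0)"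
    using assms by (intro sum.cong refl) (auto simp: when_def)
  also have "\<dots> = (\<Sum>s\<in>?K x. if s = s0 then \<Sum>t\<in>?K y. if t = t0 then ?l x s * ?l y t else 0 else 0)"
    by (intro sum.cong refl) auto
  also have "\<dots> = ?l x s0 * ?l y t0"
    by (auto simp: in_keys_iff)
  finally show ?thesis .
qed

lemma lookup_times_extremal:
  fixes x y :: "(int ^ 'r) \<Rightarrow>\<^sub>0 int"
  assumes inj: "inj_on (dotv lam) (Poly_Mapping.keys x)" "inj_on (dotv lam) (Poly_Mapping.keys y)"
    and s0: "s0 \<in> Poly_Mapping.keys x" "\<And>s. s \<in> Poly_Mapping.keys x \<Longrightarrow> dotv lam s \<le> dotv lam s0"
    and t0: "t0 \<in> Poly_Mapping.keys y" "\<And>t. t \<in> Poly_Mapping.keys y \<Longrightarrow> dotv lam t \<le> dotv lam t0"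
  shows "s0 + t0 \<in> Poly_Mapping.keys (x * y)"
    and "Poly_Mapping.lookup (x * y) (s0 + t0) = Poly_Mapping.lookup x s0 * Poly_Mapping.lookup y t0"
proof -
  show *: "Poly_Mapping.lookup (x * y) (s0 + t0) = Poly_Mapping.lookup x s0 * Poly_Mapping.lookup y t0"
  proof (rule lookup_times_unique)
    fix s t assume s: "s \<in> Poly_Mapping.keys x" and t: "t \<in> Poly_Mapping.keys y" and eq: "s + t = s0 + t0"
    have "dotv lam s + dotv lam t = dotv lam s0 + dotv lam t0"
      using arg_cong[OF eq, of "dotv lam"] by (simp add: dotv_add_right)
    then have "dotv lam s = dotv lam s0" "dotv lam t = dotv lam t0"
      using s0(2)[OF s] t0(2)[OF t] by linarith+
    then show "s = s0 \<and> t = t0" using inj s t s0(1) t0(1) by (auto dest: inj_onD)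
  qed
  show "s0 + t0 \<in> Poly_Mapping.keys (x * y)"
    using s0(1) t0(1) by (simp add: in_keys_iff *)
qed

lemma exists_dotv_max:
  assumes "finite S" "S \<noteq> {}"
  obtains s0 where "s0 \<in> S" "\<And>s. s \<in> S \<Longrightarrow> dotv lam s \<le> dotv lam s0"
proof -
  have "Max (dotv lam ` S) \<in> dotv lam ` S" using assms by (intro Max_in) auto
  then obtain s0 where "s0 \<in> S" "dotv lam s0 = Max (dotv lam ` S)" by auto
  then show ?thesis using that[of s0] assms by auto
qed

lemma group_ring_no_zero_divisors:
  fixes x y :: "(int ^ 'r) \<Rightarrow>\<^sub>0 int"
  assumes "x * y = 0"
  shows "x = 0 \<or> y = 0"
proof (rule ccontr)
  assume "\<not> ?thesis"
  then have ne: "Poly_Mapping.keys x \<noteq> {}" "Poly_Mapping.keys y \<noteq> {}" by auto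
  obtain lam where "inj_on (dotv lam) (Poly_Mapping.keys x \<union> Poly_Mapping.keys y)"
    using exists_dotv_inj_on[of "Poly_Mapping.keys x \<union> Poly_Mapping.keys y"] by auto
  then have inj: "inj_on (dotv lam) (Poly_Mapping.keys x)" "inj_on (dotv lam) (Poly_Mapping.keys y)"
    by (auto intro: inj_on_subset)
  obtain s0 where s0: "s0 \<in> Poly_Mapping.keys x" "\<And>s. s \<in> Poly_Mapping.keys x \<Longrightarrow> dotv lam s \<le> dotv lam s0"
    using exists_dotv_max[OF finite_keys ne(1)] by blast
  obtain t0 where t0: "t0 \<in> Poly_Mapping.keys y" "\<And>s. s \<in> Poly_Mapping.keys y \<Longrightarrow> dotv lam s \<le> dotv lam t0"
    using exists_dotv_max[OF finite_keys ne(2)] by blast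
  show False using lookup_times_extremal(1)[OF inj s0 t0] assms by simp
qed

lemma group_ring_cancel:
  fixes x y z :: "(int ^ 'r) \<Rightarrow>\<^sub>0 int"
  assumes "x * y = x * z" "x \<noteq> 0"
  shows "y = z"
  using group_ring_no_zero_divisors[of x "y - z"] assms by (simp add: algebra_simps)

lemma dotv_uminus_left: "dotv (- lam) v = - dotv lam v"
  by (simp add: dotv_def sum_negf)

text \<open>The extreme terms of \<open>x\<close> and \<open>y\<close> for \<open>lam\<close> and
  for \<open>- lam\<close> multiply to extreme terms of 1, both at exponent 0. The widths of the
  supports are nonnegative and add up to 0, so \<open>x\<close> is a monomial, whose coefficient is
  invertible in the integers.\<close>

lemma group_ring_unit:
  fixes x y :: "(int ^ 'r) \<Rightarrow>\<^sub>0 int"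
  assumes "x * y = 1"
  shows "\<exists>g s. (s = 1 \<or> s = - 1) \<and> x = of_int s * gX g"
proof -
  let ?K = Poly_Mapping.keys
  have ne: "?K x \<noteq> {}" "?K y \<noteq> {}" using assms by auto
  obtain lam where "inj_on (dotv lam) (?K x \<union> ?K y)"
    using exists_dotv_inj_on[of "?K x \<union> ?K y"] by auto
  then have inj: "inj_on (dotv lam) (?K x)" "inj_on (dotv lam) (?K y)"
    by (auto intro: inj_on_subset)
  have inj': "inj_on (dotv (- lam)) (?K x)" "inj_on (dotv (- lam)) (?K y)"
    using inj by (auto simp: inj_on_def dotv_uminus_left)
  obtain s0 where s0: "s0 \<in> ?K x" "\<And>s. s \<in> ?K x \<Longrightarrow> dotv lam s \<le> dotv lam s0"
    using exists_dotv_max[OF finite_keys ne(1)] by blast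
  obtain t0 where t0: "t0 \<in> ?K y" "\<And>s. s \<in> ?K y \<Longrightarrow> dotv lam s \<le> dotv lam t0"
    using exists_dotv_max[OF finite_keys ne(2)] by blast
  obtain s1 where s1: "s1 \<in> ?K x" "\<And>s. s \<in> ?K x \<Longrightarrow> dotv (-lam) s \<le> dotv (-lam) s1"
    using exists_dotv_max[OF finite_keys ne(1)] by blast
  obtain t1 where t1: "t1 \<in> ?K y" "\<And>s. s \<in> ?K y \<Longrightarrow> dotv (-lam) s \<le> dotv (-lam) t1"
    using exists_dotv_max[OF finite_keys ne(2)] by blast
  have "s0 + t0 \<in> ?K (1 :: (int ^ 'r) \<Rightarrow>\<^sub>0 int)" "s1 + t1 \<in> ?K (1 :: (int ^ 'r) \<Rightarrow>\<^sub>0 int)"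
    using lookup_times_extremal(1)[OF inj s0 t0] lookup_times_extremal(1)[OF inj' s1 t1] assms by auto
  then have z: "s0 + t0 = 0" "s1 + t1 = 0" by auto
  then have "dotv lam s0 + dotv lam t0 = 0" "dotv lam s1 + dotv lam t1 = 0"
    by (metis dotv_add_right dotv_zero_right)+
  moreover have "dotv lam s1 \<le> dotv lam s0" "dotv lam t1 \<le> dotv lam t0"
    using s0(2)[OF s1(1)] t0(2)[OF t1(1)] .
  ultimately have eq: "dotv lam s1 = dotv lam s0" by linarith
  have "?K x \<subseteq> {s0}"
  proof
    fix s assume s: "s \<in> ?K x"
    have "dotv lam s = dotv lam s0"
      using s0(2)[OF s] s1(2)[OF s] eq by (simp add: dotv_uminus_left)
    then show "s \<in> {s0}" using inj(1) s s0(1) by (auto dest: inj_onD)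
  qed
  then have x: "x = Poly_Mapping.single s0 (Poly_Mapping.lookup x s0)"
    using poly_mapping_eq_sum_single[of "{s0}" x] by simp
  have "Poly_Mapping.lookup x s0 * Poly_Mapping.lookup y t0 = 1"
    using lookup_times_extremal(2)[OF inj s0 t0] z assms by simp
  then have "Poly_Mapping.lookup x s0 = 1 \<or> Poly_Mapping.lookup x s0 = - 1"
    by (rule pos_zmult_eq_1_iff_lemma)
  moreover have "of_int c * gX g = Poly_Mapping.single g c" for c and g :: "int ^ 'r"
    by (simp add: gX_def mult_single flip: single_of_int)
  ultimately show ?thesis using x by metis
qed

section \<open>Gradings of the group ring and coprime binomials\<close>

lemma gX_add: "gX (g + h) = gX g * gX h" for g h :: "'g::monoid_add"
  by (simp add: gX_def mult_single)

lemma gX_zero: "gX (0 :: 'g::monoid_add) = 1"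
  by (simp add: gX_def)

lift_definition graded_part :: "('g \<Rightarrow> int) \<Rightarrow> int \<Rightarrow> ('g \<Rightarrow>\<^sub>0 int) \<Rightarrow> ('g \<Rightarrow>\<^sub>0 int)"
  is "\<lambda>f j x g. if f g = j then x g else 0"
  by (rule finite_subset[rotated], assumption) auto

lemma graded_part_diff: "graded_part f j (x - y) = graded_part f j x - graded_part f j y"
  by (rule poly_mapping_eqI) (simp add: graded_part.rep_eq lookup_minus)

lemma graded_part_of_int:
  fixes x :: "'g::monoid_add \<Rightarrow>\<^sub>0 int"
  shows "graded_part f j (of_int c * x) = of_int c * graded_part f j x"
proof -
  have "Poly_Mapping.lookup (of_int c * x) g = c * Poly_Mapping.lookup x g" for x :: "'g \<Rightarrow>\<^sub>0 int" and g
    using lookup_times_unique[where x="Poly_Mapping.single 0 c" and y=x and ?s0.0=0 and ?t0.0=g]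
    by (cases "c = 0") (auto simp flip: single_of_int)
  then show ?thesis
    by (intro poly_mapping_eqI) (simp add: graded_part.rep_eq)
qed

lemma lookup_gX_times:
  fixes g h :: "'g::ab_group_add"
  shows "Poly_Mapping.lookup (gX g * x) h = Poly_Mapping.lookup x (h - g)"
  using lookup_times_unique[of "gX g" x g "h - g"] by (auto simp: gX_def algebra_simps)

lemma graded_part_gX_times:
  fixes g :: "'g::ab_group_add"
  assumes "\<And>u v. f (u - v) = f u - f v"
  shows "graded_part f j (gX g * x) = gX g * graded_part f (j - f g) x"
  by (rule poly_mapping_eqI) (auto simp: graded_part.rep_eq lookup_gX_times assms)

lemma graded_part_eq_0:
  assumes "j \<notin> f ` Poly_Mapping.keys x"
  shows "graded_part f j x = 0"
  using assms by (intro poly_mapping_eqI) (auto simp: graded_part.rep_eq in_keys_iff image_iff)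

lemma sum_graded_parts: "x = (\<Sum>j\<in>f ` Poly_Mapping.keys x. graded_part f j x)"
  by (rule poly_mapping_eqI)
     (auto simp: lookup_sum graded_part.rep_eq image_iff in_keys_iff)

text \<open>Grade the group ring by \<open>f\<close>: the first binomial is homogeneous of degree 0, so it divides a
  product if and only if it divides every graded part, and the parts of \<open>x\<close> can be recovered
  from those of the product one at a time.\<close>

lemma binomial_dvd_cancel:
  fixes g h :: "'g::ab_group_add"
  assumes add: "\<And>u v. f (u - v) = f u - f v" and g: "f g = 0" and h: "f h > (0::int)"
    and dvd: "1 - of_int \<epsilon> * gX g dvd x * (1 - of_int \<delta> * gX h)"
  shows "1 - of_int \<epsilon> * gX g dvd x"
proof -
  let ?\<alpha> = "1 - of_int \<epsilon> * gX g"
  define z where "z = x * (1 - of_int \<delta> * gX h)"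
  obtain y where y: "z = ?\<alpha> * y" using dvd unfolding z_def by (elim dvdE)
  have z: "?\<alpha> dvd graded_part f j z" for j
  proof
    have "z = y - of_int \<epsilon> * (gX g * y)" by (simp add: y algebra_simps)
    then show "graded_part f j z = ?\<alpha> * graded_part f j y"
      using g by (simp add: graded_part_diff graded_part_of_int graded_part_gX_times[of f, OF add] left_diff_distrib mult.assoc)
  qed
  \<comment> \<open>Comparing degrees \<open>j\<close> in \<open>z = x - \<delta> h x\<close>; since
    \<open>f h\<close> is positive, the part of \<open>x\<close> on the right has smaller
    degree.\<close>
  have rec: "graded_part f j x = graded_part f j z + of_int \<delta> * gX h * graded_part f (j - f h) x" for j
  proof -
    have "z = x - of_int \<delta> * (gX h * x)" by (simp add: z_def algebra_simps)
    then show ?thesis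
      by (simp add: graded_part_diff graded_part_of_int graded_part_gX_times[of f, OF add] mult.assoc)
  qed
  obtain N where N: "\<And>j. j \<in> f ` Poly_Mapping.keys x \<Longrightarrow> N \<le> j"
    using that[of "Min (f ` Poly_Mapping.keys x)"] by simp
  have "?\<alpha> dvd graded_part f j x" for j
  \<comment> \<open>Below the least degree \<open>N\<close> of \<open>x\<close> all parts vanish.
    The summand 1 keeps the measure positive at \<open>j = N\<close>, where one more descent is
    still made.\<close>
  proof (induction "nat (j - N + 1)" arbitrary: j rule: less_induct)
    case less
    show ?case
    proof (cases "j < N")
      case True
      then have "j \<notin> f ` Poly_Mapping.keys x" using N by force
      then show ?thesis by (simp add: graded_part_eq_0)
    next
      case False
      then have "?\<alpha> dvd graded_part f (j - f h) x" using h by (intro less) auto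
      then show ?thesis by (subst rec) (intro dvd_add dvd_mult z)
    qed
  qed
  then show ?thesis by (subst sum_graded_parts[of x f]) (intro dvd_sum)
qed

text \<open>First all factors \<beta> are cancelled against a single \<alpha>; then one \<alpha> is
  divided out of both sides and the exponent drops.\<close>

lemma pow_dvd_cancel:
  fixes \<alpha> \<beta> x :: "(int ^ 'r) \<Rightarrow>\<^sub>0 int"
  assumes "\<alpha> \<noteq> 0" and coprime: "\<And>x. \<alpha> dvd x * \<beta> \<Longrightarrow> \<alpha> dvd x"
  shows "\<alpha> ^ j dvd x * \<beta> ^ k \<Longrightarrow> \<alpha> ^ j dvd x"
proof (induction j arbitrary: x)
  case (Suc j)
  have one: "\<alpha> dvd x * \<beta> ^ i \<Longrightarrow> \<alpha> dvd x" for i x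
  proof (induction i arbitrary: x)
    case (Suc i)
    have "\<alpha> dvd x * \<beta> ^ i * \<beta>" using Suc.prems by (simp add: mult_ac)
    then show ?case by (rule Suc.IH[OF coprime])
  qed simp
  have "\<alpha> dvd x * \<beta> ^ k" using Suc.prems by (rule dvd_trans[rotated]) simp
  then obtain y where y: "x = \<alpha> * y" using one by (blast elim: dvdE)
  obtain z where "x * \<beta> ^ k = \<alpha> ^ Suc j * z" using Suc.prems by (elim dvdE)
  then have "\<alpha> * (y * \<beta> ^ k) = \<alpha> * (\<alpha> ^ j * z)" by (simp add: y mult_ac)
  then have "y * \<beta> ^ k = \<alpha> ^ j * z" using group_ring_cancel assms(1) by blast
  then have "\<alpha> ^ j dvd y" by (rule Suc.IH[OF dvdI])
  then show ?case by (simp add: y mult_dvd_mono)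
qed simp

text \<open>In the application \<open>p\<close> and \<open>d\<close> are the AB and veering
  polynomials. Cross multiplication gives \<open>a * \<beta> ^ N = \<alpha> ^ N * b\<close>, so
  \<open>\<alpha> ^ N\<close> divides \<open>a\<close> and \<open>d = p * c\<close>. Then
  \<open>c\<close> divides every element of \<open>X\<close>, hence \<open>\<Theta> = c * e\<close>;
  and \<open>e\<close> divides both \<open>\<alpha> ^ N\<close> and \<open>\<beta> ^ N\<close>, so
  coprimality makes it a unit.\<close>

lemma assoc_pm_of_coprime_multiples:
  fixes p d \<Theta> \<alpha> \<beta> :: "(int ^ 'r) \<Rightarrow>\<^sub>0 int"
  assumes gcd: "is_gcd_of \<Theta> X"
    and minor: "\<And>x. x \<in> X \<Longrightarrow> \<exists>u v c. u * v = 1 \<and> p * x * u = d * c"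
    and a: "p * a = d * \<alpha> ^ N" "\<Theta> dvd a" and b: "p * b = d * \<beta> ^ N" "\<Theta> dvd b"
    and \<alpha>: "\<alpha> \<noteq> 0" and coprime: "\<And>x. \<alpha> dvd x * \<beta> \<Longrightarrow> \<alpha> dvd x"
  shows "assoc_pm d (p * \<Theta>)"
proof -
  have nz: "x * y = 0 \<Longrightarrow> x = 0 \<or> y = 0" for x y :: "(int ^ 'r) \<Rightarrow>\<^sub>0 int"
    by (rule group_ring_no_zero_divisors)
  have \<alpha>N: "\<alpha> ^ N \<noteq> 0" using \<alpha> nz by (induction N) auto
  have cop: "\<alpha> ^ N dvd x" if "x * \<beta> ^ N = \<alpha> ^ N * y" for x y
    by (rule pow_dvd_cancel[OF \<alpha> coprime, where k=N]) (auto simp: that)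
  show ?thesis
  proof (cases "d = 0")
    case True
    have "p * \<Theta> = 0"
    proof (cases "p = 0")
      case False
      have "0 dvd x" if x: "x \<in> X" for x
      proof -
        obtain u v c where "u * v = 1" "p * x * u = 0" using minor[OF x] True by auto
        moreover from this have "p * x = 0" using nz[of "p * x" u] by auto
        ultimately show ?thesis using nz[of p x] False by auto
      qed
      then have "0 dvd \<Theta>" using gcd unfolding is_gcd_of_def by blast
      then show ?thesis by simp
    qed simp
    then show ?thesis using True by (auto simp: assoc_pm_def intro!: exI[of _ 1])
  next
    case False
    then have p0: "p \<noteq> 0" using a(1) \<alpha>N nz[of d "\<alpha> ^ N"] by auto
    have "d * (a * \<beta> ^ N) = d * (\<alpha> ^ N * b)"
    proof -
      have "d * (a * \<beta> ^ N) = a * (p * b)" unfolding b(1) by (simp add: mult_ac)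
      also have "\<dots> = b * (p * a)" by (simp add: mult_ac)
      also have "\<dots> = d * (\<alpha> ^ N * b)" unfolding a(1) by (simp add: mult_ac)
      finally show ?thesis .
    qed
    then have "a * \<beta> ^ N = \<alpha> ^ N * b" using False group_ring_cancel by blast
    then obtain c where c: "a = \<alpha> ^ N * c" using cop by (blast elim: dvdE)
    have "\<alpha> ^ N * (p * c) = \<alpha> ^ N * d" using a(1) by (simp add: c mult_ac)
    then have d: "d = p * c" using \<alpha>N group_ring_cancel by blast
    then have c0: "c \<noteq> 0" using False by auto
    have "c dvd x" if x: "x \<in> X" for x
    proof -
      obtain u v c' where u: "u * v = 1" "p * x * u = d * c'" using minor[OF x] by blast
      then have "p * (x * u) = p * (c * c')" by (simp add: d mult_ac)
      then have "x * u = c * c'" using p0 group_ring_cancel by blast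
      then have "x * (u * v) = c * (c' * v)" by (metis mult.assoc)
      then show ?thesis by (simp add: u)
    qed
    then obtain e where e: "\<Theta> = c * e" using gcd unfolding is_gcd_of_def by (blast elim: dvdE)
    obtain k where "a = \<Theta> * k" using a(2) by (elim dvdE)
    then have "c * (e * k) = c * \<alpha> ^ N" by (simp add: c e mult_ac)
    then have k: "e * k = \<alpha> ^ N" using c0 group_ring_cancel by blast
    have "p * b = p * (c * \<beta> ^ N)" unfolding b(1) by (simp add: d mult_ac)
    then have b': "b = c * \<beta> ^ N" using p0 group_ring_cancel by blast
    obtain k' where "b = \<Theta> * k'" using b(2) by (elim dvdE)
    then have "c * (e * k') = c * \<beta> ^ N" by (simp add: b' e mult_ac)
    then have k': "e * k' = \<beta> ^ N" using c0 group_ring_cancel by blast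
    have "k * \<beta> ^ N = \<alpha> ^ N * k'" by (simp add: k[symmetric] k'[symmetric] mult_ac)
    then obtain z where "k = \<alpha> ^ N * z" using cop by (blast elim: dvdE)
    then have "\<alpha> ^ N * (z * e) = \<alpha> ^ N * 1" using k by (simp add: mult_ac)
    then have ze: "z * e = 1" using \<alpha>N group_ring_cancel by blast
    have "z * (p * \<Theta>) = (z * e) * (p * c)" by (simp only: e mult_ac)
    then have "d = z * (p * \<Theta>)" by (simp add: ze d)
    then show ?thesis using group_ring_unit[OF ze] by (auto simp: assoc_pm_def)
  qed
qed

section \<open>Edges and faces of a veering triangulation\<close>

lemma inv_count_4:
  "inv_count [a, b, c, d] = of_bool (b < a) + of_bool (c < a) + of_bool (d < a)
     + of_bool (c < b) + of_bool (d < b) + of_bool (d < c)"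
proof -
  let ?xs = "[a, b, c, d]"
  let ?S = "{(0, 1), (0, 2), (0, 3), (1, 2), (1, 3), (2, 3)} :: (nat \<times> nat) set"
  have "{(i, j). i < j \<and> j < length ?xs \<and> ?xs ! j < ?xs ! i} = {x \<in> ?S. ?xs ! snd x < ?xs ! fst x}"
    by (auto simp: less_Suc_eq numeral_eq_Suc)
  then have "inv_count ?xs = (\<Sum>x\<in>?S. of_bool (?xs ! snd x < ?xs ! fst x))"
    by (simp only: inv_count_def) (simp only: of_bool_def sum.inter_filter[symmetric] finite.intros
        card_eq_sum)
  also have "\<dots> = of_bool (b < a) + of_bool (c < a) + of_bool (d < a)
     + of_bool (c < b) + of_bool (d < b) + of_bool (d < c)"
    by (simp add: numeral_eq_Suc)
  finally show ?thesis .
qed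

text \<open>An iterated equivalence is true iff an even number of its members are false; with six
  members this is the parity of the true ones. The form turns orientation questions into
  propositional logic.\<close>

lemma even_inv_count_4:
  "even (inv_count [a, b, c, d]) \<longleftrightarrow>
    ((b < a) = ((c < a) = ((d < a) = ((c < b) = ((d < b) = (d < c))))))"
  unfolding inv_count_4 by (cases "b < a"; cases "c < a"; cases "d < a"; cases "c < b"; cases "d < b"; cases "d < c") simp_all

lemma pos4_swaps:
  assumes d: "distinct [a, b, c, d]" and s: "{a, b, c, d} = {0..<4}"
  shows "pos4 b a c d \<longleftrightarrow> \<not> pos4 a b c d" "pos4 a b d c \<longleftrightarrow> \<not> pos4 a b c d"
    "pos4 c d a b \<longleftrightarrow> pos4 a b c d"
proof -
  have *: "a < b \<longleftrightarrow> \<not> b < a" "a < c \<longleftrightarrow> \<not> c < a" "a < d \<longleftrightarrow> \<not> d < a"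
    "b < c \<longleftrightarrow> \<not> c < b" "b < d \<longleftrightarrow> \<not> d < b" "c < d \<longleftrightarrow> \<not> d < c"
    using d by auto
  have sets: "{b, a, c, d} = {0..<4}" "{a, b, d, c} = {0..<4}" "{c, d, a, b} = {0..<4}"
    using s by auto
  have dist: "distinct [b, a, c, d]" "distinct [a, b, d, c]" "distinct [c, d, a, b]"
    using d by auto
  show "pos4 b a c d \<longleftrightarrow> \<not> pos4 a b c d"
    unfolding pos4_def even_inv_count_4 * using d s sets dist by argo
  show "pos4 a b d c \<longleftrightarrow> \<not> pos4 a b c d"
    unfolding pos4_def even_inv_count_4 * using d s sets dist by argo
  show "pos4 c d a b \<longleftrightarrow> pos4 a b c d"
    unfolding pos4_def even_inv_count_4 * using d s sets dist by argo
qed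

lemma lessThan_4_cases:
  assumes "(a::nat) \<in> {0..<4}"
  shows "a = 0 \<or> a = 1 \<or> a = 2 \<or> a = 3"
  using assms by auto

lemma pos4_cases:
  assumes "pos4 a b c d"
  shows "(a, b, c, d) \<in> {(0,1,2,3), (0,2,3,1), (0,3,1,2), (1,0,3,2), (1,2,0,3), (1,3,2,0),
    (2,0,1,3), (2,1,3,0), (2,3,0,1), (3,0,2,1), (3,1,0,2), (3,2,1,0)}"
proof -
  have mem: "a \<in> {0..<4}" "b \<in> {0..<4}" "c \<in> {0..<4}" "d \<in> {0..<4}"
    using assms by (auto simp: pos4_def)
  have e: "(b < a) = ((c < a) = ((d < a) = ((c < b) = ((d < b) = (d < c)))))"
    "a \<noteq> b" "a \<noteq> c" "a \<noteq> d" "b \<noteq> c" "b \<noteq> d" "c \<noteq> d"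
    using assms by (auto simp: pos4_def even_inv_count_4)
  show ?thesis
    using lessThan_4_cases[OF mem(1)] lessThan_4_cases[OF mem(2)]
      lessThan_4_cases[OF mem(3)] lessThan_4_cases[OF mem(4)] e
    by (elim disjE) simp_all
qed

text \<open>An odd permutation composed with an even one is odd. Reordering the arguments only
  permutes and negates the six comparisons between values of \<open>p\<close>, which is checked for
  the twelve even orderings.\<close>

lemma pos4_odd_map:
  assumes inj: "inj_on p {0..<4}" and odd: "odd (inv_count (map p [0, 1, 2, 3]))"
    and pos: "pos4 a b c d"
  shows "\<not> pos4 (p a) (p b) (p c) (p d)"
proof -
  have "p 0 \<noteq> p 1" "p 0 \<noteq> p 2" "p 0 \<noteq> p 3" "p 1 \<noteq> p 2" "p 1 \<noteq> p 3" "p 2 \<noteq> p 3"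
    using inj by (auto simp: inj_on_eq_iff)
  then have swap: "p 0 < p 1 \<longleftrightarrow> \<not> p 1 < p 0" "p 0 < p 2 \<longleftrightarrow> \<not> p 2 < p 0" "p 0 < p 3 \<longleftrightarrow> \<not> p 3 < p 0"
    "p 1 < p 2 \<longleftrightarrow> \<not> p 2 < p 1" "p 1 < p 3 \<longleftrightarrow> \<not> p 3 < p 1" "p 2 < p 3 \<longleftrightarrow> \<not> p 3 < p 2"
    by linarith+
  have "\<not> ((p 1 < p 0) = ((p 2 < p 0) = ((p 3 < p 0) = ((p 2 < p 1) = ((p 3 < p 1) = (p 3 < p 2))))))"
    using odd even_inv_count_4[of "p 0" "p 1" "p 2" "p 3"] by simp
  moreover have "even (inv_count [p a, p b, p c, p d])
      = ((p 1 < p 0) = ((p 2 < p 0) = ((p 3 < p 0) = ((p 2 < p 1) = ((p 3 < p 1) = (p 3 < p 2))))))"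
    using pos4_cases[OF pos] unfolding even_inv_count_4 insert_iff empty_iff prod.inject
    by (elim disjE FalseE conjE; simp only: swap; argo)
  ultimately show ?thesis by (simp add: pos4_def)
qed

section \<open>Edge classes, and the bijection between tetrahedra and edges\<close>

locale veering_tri =
  fixes n :: nat and gl :: gluing and bt :: "nat \<Rightarrow> nat set" and veer :: "(nat \<times> nat set) set \<Rightarrow> bool"
  assumes veering_triangulation: "veering_triangulation n gl bt veer"
begin

abbreviation nbr :: "nat \<Rightarrow> nat \<Rightarrow> nat" where "nbr t i \<equiv> fst (gl t i)"
abbreviation gmap :: "nat \<Rightarrow> nat \<Rightarrow> nat \<Rightarrow> nat" where "gmap t i \<equiv> snd (gl t i)"

lemma n_pos: "0 < n"
  using veering_triangulation by (auto simp: veering_triangulation_def ideal_tri_def)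

lemma glue:
  assumes "t < n" "i < 4"
  shows "nbr t i < n" "bij_betw (gmap t i) {0..<4} {0..<4}" "(nbr t i, gmap t i i) \<noteq> (t, i)"
    "nbr (nbr t i) (gmap t i i) = t" "\<And>v. v < 4 \<Longrightarrow> gmap (nbr t i) (gmap t i i) (gmap t i v) = v"
    "odd (inv_count (map (gmap t i) [0, 1, 2, 3]))"
    "i \<in> bt t \<longleftrightarrow> gmap t i i \<notin> bt (nbr t i)"
  using assms veering_triangulation
  by (auto simp: veering_triangulation_def ideal_tri_def oriented_tri_def taut_def)

lemma gmap_inj: "t < n \<Longrightarrow> i < 4 \<Longrightarrow> inj_on (gmap t i) {0..<4}"
  using glue(2) by (auto simp: bij_betw_def)

lemma gmap_less: "t < n \<Longrightarrow> i < 4 \<Longrightarrow> v < 4 \<Longrightarrow> gmap t i v < 4"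
  using glue(2)[of t i] by (auto simp: bij_betw_def)

lemma bt: "t < n \<Longrightarrow> bt t \<subseteq> {0..<4}" "t < n \<Longrightarrow> card (bt t) = 2"
  using veering_triangulation by (auto simp: veering_triangulation_def taut_def)

text \<open>\<open>ecls\<close> closes under forward steps only; going back through the glued face
  makes the relation symmetric, so that these sets are the classes of an equivalence.\<close>

lemma estep_glue:
  assumes "t < n" "s \<subseteq> {0..<4}" "i < 4" "i \<notin> s"
  shows "estep gl (t, s) (nbr t i, gmap t i ` s)" "estep gl (nbr t i, gmap t i ` s) (t, s)"
proof -
  show "estep gl (t, s) (nbr t i, gmap t i ` s)"
    using assms by (auto simp: estep_def)
  have "gmap t i i \<notin> gmap t i ` s"
    using inj_on_image_mem_iff[OF gmap_inj[of t i], of i s] assms by auto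
  moreover have "gmap (nbr t i) (gmap t i i) ` gmap t i ` s = s"
  proof -
    have "gmap (nbr t i) (gmap t i i) ` gmap t i ` s = (\<lambda>v. v) ` s"
      unfolding image_image using glue(5)[of t i] assms by (intro image_cong refl) auto
    then show ?thesis by simp
  qed
  ultimately show "estep gl (nbr t i, gmap t i ` s) (t, s)"
    using glue(4)[of t i] gmap_less[of t i i] assms
    by (auto simp: estep_def intro!: exI[of _ "gmap t i i"])
qed

lemma ecls_glue:
  assumes "t < n" "s \<subseteq> {0..<4}" "i < 4" "i \<notin> s"
  shows "ecls gl (nbr t i, gmap t i ` s) = ecls gl (t, s)"
  unfolding ecls_def using estep_glue[OF assms] by (auto intro: converse_rtranclp_into_rtranclp)

lemma finite_edge_inst: "finite (edge_inst n)"
  by (rule finite_subset[of _ "{..<n} \<times> Pow {0..<4}"]) (auto simp: edge_inst_def)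

lemma estep_edge_inst:
  assumes "x \<in> edge_inst n" "estep gl x y"
  shows "y \<in> edge_inst n" "ecls gl y = ecls gl x"
proof -
  obtain t s where x: "x = (t, s)" and ts: "t < n" "s \<subseteq> {0..<4}" "card s = 2"
    using assms(1) by (auto simp: edge_inst_def)
  obtain i where i: "i < 4" "i \<notin> s" and y: "y = (nbr t i, gmap t i ` s)"
    using assms(2) by (auto simp: estep_def x)
  have "card (gmap t i ` s) = 2"
    using gmap_inj[OF ts(1) i(1)] ts by (simp add: card_image inj_on_subset)
  moreover have "gmap t i ` s \<subseteq> {0..<4}"
    using gmap_less[OF ts(1) i(1)] ts(2) by (auto simp: subset_iff)
  ultimately show "y \<in> edge_inst n"
    using glue(1)[OF ts(1) i(1)] by (auto simp: edge_inst_def y)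
  show "ecls gl y = ecls gl x" unfolding x y using ecls_glue ts i by blast
qed

lemma ecls_member:
  assumes "x \<in> edge_inst n" "y \<in> ecls gl x"
  shows "y \<in> edge_inst n" "ecls gl y = ecls gl x"
proof -
  have "(estep gl)\<^sup>*\<^sup>* x y" using assms(2) by (simp add: ecls_def)
  then have "y \<in> edge_inst n \<and> ecls gl y = ecls gl x"
  proof (induction rule: rtranclp_induct)
    case (step y z)
    then show ?case using estep_edge_inst[of y z] by simp
  qed (simp add: assms(1))
  then show "y \<in> edge_inst n" "ecls gl y = ecls gl x" by auto
qed

lemma ecls_self: "x \<in> ecls gl x"
  by (simp add: ecls_def)

lemma ecls_eq_iff: "x \<in> edge_inst n \<Longrightarrow> e \<in> edges n gl \<Longrightarrow> ecls gl x = e \<longleftrightarrow> x \<in> e"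
  using ecls_self[of x] ecls_member(2)[of _ x] unfolding edges_def by blast

lemma finite_edges: "finite (edges n gl)"
  using finite_edge_inst by (simp add: edges_def)

lemma edge_subset: "e \<in> edges n gl \<Longrightarrow> e \<subseteq> edge_inst n"
  using ecls_member(1) unfolding edges_def by blast

text \<open>Every edge bounds as many flags on the top side of their tetrahedron as on the bottom side,
  because gluing swaps the two kinds of flags. Only bottom and top edges of tetrahedra contribute
  to the difference.\<close>

lemma card_bottom_eq_card_top:
  assumes e: "e \<in> edges n gl"
  shows "card {x \<in> e. snd x = bt (fst x)} = card {x \<in> e. snd x = top_e bt (fst x)}"
proof -
  have sub: "e \<subseteq> edge_inst n" by (rule edge_subset[OF e])
  have fin: "finite e" using sub finite_edge_inst finite_subset by blast
  \<comment> \<open>A flag is an edge instance with a face \<open>i\<close> containing it, that is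
    \<open>i\<close> not among its two vertices. \<open>U\<close> collects the top faces,
    \<open>D\<close> the bottom faces, and \<open>\<iota>\<close> crosses the face.\<close>
  define U where "U x = {i \<in> {0..<4}. i \<notin> snd x \<and> i \<in> bt (fst x)}" for x :: "nat \<times> nat set"
  define D where "D x = {i \<in> {0..<4}. i \<notin> snd x \<and> i \<notin> bt (fst x)}" for x :: "nat \<times> nat set"
  define \<iota> where "\<iota> = (\<lambda>(x, i). ((nbr (fst x) i, gmap (fst x) i ` snd x), gmap (fst x) i i))"
  have \<iota>: "\<iota> (x, i) = (y, j) \<Longrightarrow> y \<in> e \<and> j < 4 \<and> j \<notin> snd y \<and> (i \<in> bt (fst x) \<longleftrightarrow> j \<notin> bt (fst y)) \<and> \<iota> (y, j) = (x, i)"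
    if xe: "x \<in> e" and i: "i < 4" "i \<notin> snd x" for x i y j
  proof -
    assume eq: "\<iota> (x, i) = (y, j)"
    obtain t s where x: "x = (t, s)" and ts: "t < n" "s \<subseteq> {0..<4}" "card s = 2"
      using xe sub by (auto simp: edge_inst_def)
    have y: "y = (nbr t i, gmap t i ` s)" "j = gmap t i i" using eq by (auto simp: \<iota>_def x)
    have st: "estep gl x y" using estep_glue[OF ts(1,2)] that by (auto simp: x y)
    have "x \<in> edge_inst n" using that sub by auto
    then have "y \<in> edge_inst n" "ecls gl y = ecls gl x" "ecls gl x = e"
      using estep_edge_inst[OF _ st] ecls_eq_iff e that by auto
    then have "y \<in> e" using ecls_self by metis
    moreover have "j < 4" using gmap_less ts that by (auto simp: y)
    moreover have "j \<notin> snd y"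
      using inj_on_image_mem_iff[OF gmap_inj[of t i], of i s] ts that by (auto simp: y x)
    moreover have "i \<in> bt (fst x) \<longleftrightarrow> j \<notin> bt (fst y)" using glue(7)[of t i] ts that by (simp add: x y)
    moreover have "gmap (nbr t i) (gmap t i i) ` gmap t i ` s = (\<lambda>v. v) ` s"
      unfolding image_image using glue(5)[of t i] ts that by (intro image_cong refl) auto
    ultimately show "y \<in> e \<and> j < 4 \<and> j \<notin> snd y \<and> (i \<in> bt (fst x) \<longleftrightarrow> j \<notin> bt (fst y)) \<and> \<iota> (y, j) = (x, i)"
      using glue(4,5)[of t i] ts that by (simp add: \<iota>_def y x)
  qed
  have "(\<Sum>x\<in>e. card (U x)) = card (Sigma e U)"
    using fin by (simp add: U_def)
  also have "\<dots> = card (Sigma e D)"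
  proof (rule bij_betw_same_card, rule bij_betw_byWitness[where f=\<iota> and f'=\<iota>])
    have "\<iota> (\<iota> (x, i)) = (x, i)" if "x \<in> e" "i < 4" "i \<notin> snd x" for x i
      using \<iota>[OF that, of "fst (\<iota> (x, i))" "snd (\<iota> (x, i))"] by simp
    then show "\<forall>a\<in>Sigma e U. \<iota> (\<iota> a) = a" "\<forall>a\<in>Sigma e D. \<iota> (\<iota> a) = a"
      by (auto simp: U_def D_def)
    show "\<iota> ` Sigma e U \<subseteq> Sigma e D"
    proof
      fix b assume "b \<in> \<iota> ` Sigma e U"
      then obtain x i where xi: "x \<in> e" "i \<in> U x" "b = \<iota> (x, i)" by auto
      obtain y j where "b = (y, j)" by (cases b)
      then show "b \<in> Sigma e D" using \<iota>[of x i y j] xi by (auto simp: U_def D_def)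
    qed
    show "\<iota> ` Sigma e D \<subseteq> Sigma e U"
    proof
      fix b assume "b \<in> \<iota> ` Sigma e D"
      then obtain x i where xi: "x \<in> e" "i \<in> D x" "b = \<iota> (x, i)" by auto
      obtain y j where "b = (y, j)" by (cases b)
      then show "b \<in> Sigma e U" using \<iota>[of x i y j] xi by (auto simp: U_def D_def)
    qed
  qed
  also have "\<dots> = (\<Sum>x\<in>e. card (D x))"
    using fin by (simp add: D_def)
  finally have "(\<Sum>x\<in>e. card (U x)) = (\<Sum>x\<in>e. card (D x))" .
  \<comment> \<open>The bottom edge lies in two bottom faces, the top edge in two top faces, and a
    side edge in one of each.\<close>
  moreover have "card (U x) + 2 * of_bool (snd x = bt (fst x)) = card (D x) + 2 * of_bool (snd x = top_e bt (fst x))"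
    if xe: "x \<in> e" for x
  proof -
    obtain t s where x: "x = (t, s)" and ts: "t < n" "s \<subseteq> {0..<4}" "card s = 2"
      using xe sub by (auto simp: edge_inst_def)
    have finb: "finite (bt t)" "finite s" using bt[OF ts(1)] ts finite_subset by blast+
    have "card (bt t) = card (bt t \<inter> s) + card (bt t - s)"
      using finb by (metis card_Diff_subset_Int card_mono finite_Int inf_le1 le_add_diff_inverse)
    then have U: "card (U x) = 2 - card (bt t \<inter> s)"
    proof -
      have "U x = bt t - s" using bt(1)[OF ts(1)] by (auto simp: U_def x)
      then show ?thesis using \<open>card (bt t) = _\<close> bt(2)[OF ts(1)] by simp
    qed
    have D: "card (D x) = card (bt t \<inter> s)"
    proof -
      have Dx: "D x = {0..<4} - (bt t \<union> s)" by (auto simp: D_def x)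
      moreover have "card (bt t \<union> s) + card (bt t \<inter> s) = 4"
        using card_Un_Int[OF finb] bt(2)[OF ts(1)] ts by simp
      ultimately show ?thesis using bt(1)[OF ts(1)] ts(2) finb
        unfolding Dx by (subst card_Diff_subset) auto
    qed
    have le: "card (bt t \<inter> s) \<le> 2" using card_mono[OF finb(1), of "bt t \<inter> s"] bt(2)[OF ts(1)] by auto
    have 1: "s = bt t \<longleftrightarrow> card (bt t \<inter> s) = 2"
    proof
      assume "card (bt t \<inter> s) = 2"
      then have "bt t \<inter> s = bt t"
        by (intro card_subset_eq[OF finb(1)]) (simp_all add: bt(2)[OF ts(1)])
      then have "bt t = s"
        by (intro card_subset_eq[OF finb(2)]) (auto simp: bt(2)[OF ts(1)] ts(3))
      then show "s = bt t" ..
    qed (use bt(2)[OF ts(1)] in auto)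
    have 2: "s = top_e bt t \<longleftrightarrow> card (bt t \<inter> s) = 0"
    proof
      assume "card (bt t \<inter> s) = 0"
      then have "s \<subseteq> top_e bt t" using finb ts by (auto simp: top_e_def)
      moreover have "card (top_e bt t) = 2"
        using bt[OF ts(1)] finb by (simp add: top_e_def card_Diff_subset)
      ultimately show "s = top_e bt t" using ts by (intro card_subset_eq) (auto simp: top_e_def)
    qed (use finb in \<open>auto simp: top_e_def\<close>)
    consider "card (bt t \<inter> s) = 0" | "card (bt t \<inter> s) = 1" | "card (bt t \<inter> s) = 2"
      using le by linarith
    then show ?thesis using U D by cases (simp_all add: x 1 2)
  qed
  then have "(\<Sum>x\<in>e. card (U x) + 2 * of_bool (snd x = bt (fst x)))
      = (\<Sum>x\<in>e. card (D x) + 2 * of_bool (snd x = top_e bt (fst x)))"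
    by (intro sum.cong refl)
  ultimately have "(\<Sum>x\<in>e. of_bool (snd x = bt (fst x)) :: nat) = (\<Sum>x\<in>e. of_bool (snd x = top_e bt (fst x)))"
    by (simp add: sum.distrib flip: sum_distrib_left)
  then show ?thesis using fin by (simp add: Int_def)
qed

lemma bt_ne_top: "t < n \<Longrightarrow> bt t \<noteq> top_e bt t"
proof
  assume t: "t < n" and "bt t = top_e bt t"
  then have "bt t = {}" unfolding top_e_def by blast
  then show False using bt(2)[OF t] by simp
qed

definition edge_of :: "nat \<Rightarrow> (nat \<times> nat set) set" where
  "edge_of t = ecls gl (t, bt t)"

lemma bt_edge_inst: "t < n \<Longrightarrow> (t, bt t) \<in> edge_inst n"
  using bt by (auto simp: edge_inst_def)

text \<open>The angle sum gives each edge exactly two instances as a bottom or top edge; since both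
  kinds are equally frequent, exactly one of them is a bottom edge.\<close>

lemma bij_edge_of: "bij_betw edge_of {..<n} (edges n gl)"
proof -
  have one: "card {x \<in> e. snd x = bt (fst x)} = 1" if e: "e \<in> edges n gl" for e
  proof -
    have "finite e" using edge_subset[OF e] finite_edge_inst finite_subset by blast
    moreover have "{x \<in> e. snd x = bt (fst x)} \<inter> {x \<in> e. snd x = top_e bt (fst x)} = {}"
      using edge_subset[OF e] bt_ne_top by (auto simp: edge_inst_def)
    moreover have "{x \<in> e. snd x = bt (fst x) \<or> snd x = top_e bt (fst x)}
        = {x \<in> e. snd x = bt (fst x)} \<union> {x \<in> e. snd x = top_e bt (fst x)}" by auto
    moreover have "card {x \<in> e. snd x = bt (fst x) \<or> snd x = top_e bt (fst x)} = 2"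
      using veering_triangulation e by (auto simp: veering_triangulation_def taut_def)
    ultimately show ?thesis using card_bottom_eq_card_top[OF e]
      by (simp add: card_Un_disjoint)
  qed
  show ?thesis unfolding bij_betw_def
  proof
    show "inj_on edge_of {..<n}"
    proof (rule inj_onI)
      fix t t' assume a: "t \<in> {..<n}" "t' \<in> {..<n}" "edge_of t = edge_of t'"
      have e: "edge_of t \<in> edges n gl" using a bt_edge_inst by (auto simp: edges_def edge_of_def)
      have "(t, bt t) \<in> edge_of t" "(t', bt t') \<in> edge_of t"
        using a(3) ecls_self by (auto simp: edge_of_def)
      moreover obtain z where "{x \<in> edge_of t. snd x = bt (fst x)} = {z}"
        using one[OF e] by (auto simp: card_1_singleton_iff)
      ultimately have "(t, bt t) = z" "(t', bt t') = z" by auto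
      then show "t = t'" by auto
    qed
    show "edge_of ` {..<n} = edges n gl"
    proof
      show "edge_of ` {..<n} \<subseteq> edges n gl" using bt_edge_inst by (auto simp: edges_def edge_of_def)
      show "edges n gl \<subseteq> edge_of ` {..<n}"
      proof
        fix e assume e: "e \<in> edges n gl"
        obtain z where "{x \<in> e. snd x = bt (fst x)} = {z}"
          using one[OF e] by (auto simp: card_1_singleton_iff)
        then have z: "z \<in> e" "snd z = bt (fst z)" by auto
        then have "fst z < n" "z \<in> edge_inst n" using edge_subset[OF e] by (auto simp: edge_inst_def)
        then have "edge_of (fst z) = e"
          using ecls_eq_iff[of z e] e z by (metis edge_of_def prod.collapse)
        then show "e \<in> edge_of ` {..<n}" using \<open>fst z < n\<close> by auto
      qed
    qed
  qed
qed

end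

text \<open>The converse follows by applying the forward direction to the ordering with its first
  two entries exchanged, on both sides of the map.\<close>

lemma pos4_odd_map_iff:
  assumes "inj_on p {0..<4}" "odd (inv_count (map p [0, 1, 2, 3]))" "p ` {0..<4} = {0..<4}"
    and d: "distinct [a, b, c, d]" and s: "{a, b, c, d} = {0..<4}"
  shows "pos4 (p a) (p b) (p c) (p d) \<longleftrightarrow> \<not> pos4 a b c d"
proof -
  have d': "distinct [p a, p b, p c, p d]"
  proof -
    have "distinct (map p [a, b, c, d])" using assms(1) d s by (subst distinct_map) (simp add: s)
    then show ?thesis by simp
  qed
  have s': "{p a, p b, p c, p d} = {0..<4}"
  proof -
    have "{p a, p b, p c, p d} = p ` {a, b, c, d}" by simp
    then show ?thesis using assms(3) s by simp
  qed
  show ?thesis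
    using pos4_odd_map[OF assms(1,2), of a b c d] pos4_odd_map[OF assms(1,2), of b a c d]
      pos4_swaps(1)[OF d s] pos4_swaps(1)[OF d' s'] by blast
qed

lemma card_2_subset_cases:
  assumes "s \<subseteq> {a, b, c, d}" "card s = 2"
  shows "s = {a, b} \<or> s = {a, c} \<or> s = {a, d} \<or> s = {b, c} \<or> s = {b, d} \<or> s = {c, d}"
proof -
  obtain x y where s: "s = {x, y}" "x \<noteq> y" using assms(2) by (auto simp: card_2_iff)
  then have "x = a \<or> x = b \<or> x = c \<or> x = d" "y = a \<or> y = b \<or> y = c \<or> y = d"
    using assms(1) by auto
  then show ?thesis unfolding s(1) using s(2) by (elim disjE) (simp_all add: insert_commute)
qed

section \<open>Local labels of a tetrahedron and the effect of a gluing on them\<close>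

context veering_tri begin

abbreviation V :: "nat \<Rightarrow> nat set \<Rightarrow> bool" where "V t s \<equiv> veer (ecls gl (t, s))"

text \<open>A labelling that treats both veers of the top edge at once: \<open>k1\<close>,
  \<open>k2\<close> end the bottom edge, \<open>i1\<close>, \<open>i2\<close> the top edge, and the
  indices are matched so that side edges with equal index have the veer of the top edge. The faces
  opposite \<open>i1\<close> and \<open>k1\<close> share the edge \<open>{i2, k2}\<close>, so the AB
  permutation sends face \<open>i1\<close> to face \<open>k1\<close>. The last clause records on
  which side the labelled veers sit.\<close>

definition tet_label :: "nat \<Rightarrow> nat \<Rightarrow> nat \<Rightarrow> nat \<Rightarrow> nat \<Rightarrow> bool" where
  "tet_label t k1 k2 i1 i2 \<longleftrightarrow>
     distinct [k1, k2, i1, i2] \<and> {k1, k2, i1, i2} = {0..<4} \<and> bt t = {k1, k2} \<and>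
     V t {i1, k1} = V t {i1, i2} \<and> V t {i2, k2} = V t {i1, i2} \<and>
     V t {i1, k2} \<noteq> V t {i1, i2} \<and> V t {i2, k1} \<noteq> V t {i1, i2} \<and>
     (pos4 k1 k2 i1 i2 \<longleftrightarrow> \<not> V t {i1, i2})"

text \<open>The half turn of the tetrahedron that reverses its top and bottom edges. Owing to it,
  either bottom face may be called \<open>i1\<close>.\<close>

lemma tet_label_swap:
  assumes "tet_label t k1 k2 i1 i2"
  shows "tet_label t k2 k1 i2 i1"
proof -
  have d: "distinct [k1, k2, i1, i2]" and s: "{k1, k2, i1, i2} = {0..<4}"
    using assms by (auto simp: tet_label_def)
  have d': "distinct [k2, k1, i1, i2]" and s': "{k2, k1, i1, i2} = {0..<4}"
    using d s by auto
  have "pos4 k2 k1 i2 i1 \<longleftrightarrow> pos4 k1 k2 i1 i2"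
    using pos4_swaps(1)[OF d s] pos4_swaps(2)[OF d' s'] by simp
  moreover have "{k2, k1, i2, i1} = {0..<4}" using s by auto
  ultimately show ?thesis
    using assms unfolding tet_label_def by (simp add: insert_commute)
qed

lemma tet_label_exists:
  assumes t: "t < n"
  shows "\<exists>k1 k2 i1 i2. tet_label t k1 k2 i1 i2"
proof -
  obtain a b where ab: "bt t = {a, b}" "a \<noteq> b" using bt(2)[OF t] by (auto simp: card_2_iff)
  have "finite (bt t)" using ab by simp
  then have "card ({0..<4} - bt t) = 2"
    using bt[OF t] by (simp add: card_Diff_subset)
  then obtain c d where cd: "{0..<4} - bt t = {c, d}" "c \<noteq> d" unfolding card_2_iff by blast
  have "bt t \<union> {c, d} = {0..<4}" unfolding cd(1)[symmetric] using bt(1)[OF t] by blast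
  then have s: "{a, b, c, d} = {0..<4}" by (simp only: ab(1) Un_insert_left Un_empty_left)
  have "{a, b} \<inter> {c, d} = {}" using cd(1) ab(1) by blast
  then have d: "distinct [a, b, c, d]" using ab(2) cd(2) by simp
  have "\<exists>a b. bt t = {a, b} \<and> pos4 a b c d"
  proof (cases "pos4 a b c d")
    case False
    then have "pos4 b a c d" using pos4_swaps(1)[OF d s] by simp
    then show ?thesis using ab by (auto simp: insert_commute)
  qed (use ab in auto)
  then obtain a b where ab: "bt t = {a, b}" and pos: "pos4 a b c d" by auto
  have d: "distinct [a, b, c, d]" and s: "{a, b, c, d} = {0..<4}" using pos by (auto simp: pos4_def)
  have v: "V t {a, d}" "V t {b, c}" "\<not> V t {a, c}" "\<not> V t {b, d}"
    using veering_triangulation t pos ab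
    unfolding veering_triangulation_def veering_def by metis+
  show ?thesis
  proof (cases "V t {c, d}")
    case True
    have "\<not> pos4 b a c d" using pos pos4_swaps(1)[OF d s] by simp
    moreover have "{b, a, c, d} = {0..<4}" "distinct [b, a, c, d]" using s d by auto
    ultimately have "tet_label t b a c d"
      using v True ab unfolding tet_label_def by (auto simp: insert_commute)
    then show ?thesis by blast
  next
    case False
    have "tet_label t a b c d"
      using v False ab d s pos unfolding tet_label_def by (auto simp: insert_commute)
    then show ?thesis by blast
  qed
qed

lemma tet_label_exists_bottom:
  assumes "t < n" "i < 4" "i \<notin> bt t"
  shows "\<exists>k1 k2 i2. tet_label t k1 k2 i i2"
proof -
  obtain k1 k2 i1 i2 where l: "tet_label t k1 k2 i1 i2" using tet_label_exists[OF assms(1)] by blast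
  have "i \<in> {k1, k2, i1, i2}" using l assms by (simp add: tet_label_def)
  then have "i = i1 \<or> i = i2" using l assms by (auto simp: tet_label_def)
  then show ?thesis using l tet_label_swap[OF l] by blast
qed

lemma tet_label_top_edge: "tet_label t k1 k2 i1 i2 \<Longrightarrow> top_e bt t = {i1, i2}"
  unfolding tet_label_def top_e_def by auto

lemma tet_label_less:
  assumes "tet_label t k1 k2 i1 i2"
  shows "k1 < 4" "k2 < 4" "i1 < 4" "i2 < 4"
proof -
  have "{k1, k2, i1, i2} = {0..<4}" using assms by (simp add: tet_label_def)
  then have "k1 \<in> {0..<4} \<and> k2 \<in> {0..<4} \<and> i1 \<in> {0..<4} \<and> i2 \<in> {0..<4}" by blast
  then show "k1 < 4" "k2 < 4" "i1 < 4" "i2 < 4" by auto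
qed

text \<open>The veers of the three edges of a face, seen from below and from above, leave two candidates
  for the bottom edge of the upper tetrahedron; the top edge of the lower tetrahedron is excluded
  because the gluing reverses orientation.\<close>

lemma glue_bottom_edge:
  assumes t: "t < n" and l: "tet_label t k1 k2 i1 i2"
  shows "gmap t k1 ` {i2, k2} = bt (nbr t k1)"
proof -
  let ?p = "gmap t k1" and ?t = "nbr t k1"
  have k1: "k1 < 4" using l by (rule tet_label_less)
  have t': "?t < n" using glue(1)[OF t k1] .
  have l': "distinct [k1, k2, i1, i2]" "{k1, k2, i1, i2} = {0..<4}" "bt t = {k1, k2}"
    using l by (auto simp: tet_label_def)
  have inj: "inj_on ?p {0..<4}" and im: "?p ` {0..<4} = {0..<4}"
    using glue(2)[OF t k1] by (auto simp: bij_betw_def)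
  have "?p k1 \<notin> bt ?t" using glue(7)[OF t k1] l' by simp
  moreover have "?p k1 < 4" using gmap_less[OF t k1 k1] .
  ultimately obtain K1 K2 I2 where L: "tet_label ?t K1 K2 (?p k1) I2"
    using tet_label_exists_bottom[OF t'] by blast
  then have L': "distinct [K1, K2, ?p k1, I2]" "{K1, K2, ?p k1, I2} = {0..<4}" "bt ?t = {K1, K2}"
    by (auto simp: tet_label_def)
  have sub: "{i1, i2, k2} \<subseteq> {0..<4}" using l'(2) by blast
  have pd: "distinct [?p k1, ?p k2, ?p i1, ?p i2]"
  proof -
    have "distinct (map ?p [k1, k2, i1, i2])" using inj l' by (subst distinct_map) simp
    then show ?thesis by simp
  qed
  have ps: "{?p k1, ?p k2, ?p i1, ?p i2} = {K1, K2, ?p k1, I2}"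
  proof -
    have "{?p k1, ?p k2, ?p i1, ?p i2} = ?p ` {k1, k2, i1, i2}" by simp
    then show ?thesis using im l' L' by simp
  qed
  have three: "{?p k2, ?p i1, ?p i2} = {K1, K2, I2}"
  proof -
    have "{?p k2, ?p i1, ?p i2} = {?p k1, ?p k2, ?p i1, ?p i2} - {?p k1}" using pd by auto
    also have "\<dots> = {K1, K2, I2}" unfolding ps using L'(1) by auto
    finally show ?thesis .
  qed
  have minus: "{K1, K2} = {?p k2, ?p i1, ?p i2} - {I2}"
    unfolding three using L'(1) by auto
  have V: "V ?t {?p x, ?p y} = V t {x, y}" if "x \<in> {i1, i2, k2}" "y \<in> {i1, i2, k2}" for x y
  proof -
    have "ecls gl (?t, ?p ` {x, y}) = ecls gl (t, {x, y})"
      using that sub k1 l'(1) by (intro ecls_glue[OF t]) auto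
    then show ?thesis by simp
  qed
  have v: "V t {i2, k2} = V t {i1, i2}" "V t {i1, k2} \<noteq> V t {i1, i2}"
    using l by (auto simp: tet_label_def)
  have v': "V ?t {I2, K2} \<noteq> V ?t {I2, K1}" "V ?t {I2, K2} = V ?t {?p k1, I2}"
    using L by (auto simp: tet_label_def)
  have "I2 = ?p k2 \<or> I2 = ?p i1 \<or> I2 = ?p i2" using three by auto
  then consider "I2 = ?p i1" | "I2 = ?p i2" | "I2 = ?p k2" by blast
  then show ?thesis
  proof cases
    case 1
    have "{?p i2, ?p k2} = {K1, K2}" unfolding minus 1 using pd by auto
    then show ?thesis using L'(3) by simp
  next
    case 2
    \<comment> \<open>Seen from above, the two edges of this face at \<open>I2\<close> have
      different veers; seen from below, both edges at \<open>i2\<close> have the veer of the top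
      edge.\<close>
    have "{?p k2, ?p i1} = {K1, K2}" unfolding minus 2 using pd by auto
    then have "V ?t {?p i2, ?p k2} \<noteq> V ?t {?p i2, ?p i1}"
      using v'(1) 2 by (auto simp: doubleton_eq_iff)
    then have "V t {i2, k2} \<noteq> V t {i2, i1}" using V[of i2 k2] V[of i2 i1] by simp
    then show ?thesis using v(1) by (simp add: insert_commute)
  next
    case 3
    have "{?p i1, ?p i2} = {K1, K2}" unfolding minus 3 using pd by auto
    then have pairs: "?p i1 = K1 \<and> ?p i2 = K2 \<or> ?p i1 = K2 \<and> ?p i2 = K1"
      by (simp only: doubleton_eq_iff)
    have e: "V ?t {I2, ?p i2} = V t {i1, i2}" "V ?t {I2, ?p i1} \<noteq> V t {i1, i2}"
      using V[of k2 i2] V[of k2 i1] v 3 by (simp_all add: insert_commute)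
    have "pos4 (?p k1) (?p k2) (?p i1) (?p i2) \<longleftrightarrow> \<not> pos4 k1 k2 i1 i2"
      by (rule pos4_odd_map_iff[OF inj glue(6)[OF t k1] im l'(1,2)])
    then have o: "pos4 (?p k1) I2 (?p i1) (?p i2) \<longleftrightarrow> V t {i1, i2}"
      using l 3 by (simp add: tet_label_def)
    \<comment> \<open>Facts \<open>o\<close> and \<open>q\<close> compute the orientation of one
      ordering, up to exchanging its last two entries, from the lower and from the upper labels; the
      veers in \<open>e\<close> make them contradict each other for either matching in
      \<open>pairs\<close>.\<close>
    have q: "pos4 (?p k1) I2 K1 K2 \<longleftrightarrow> \<not> V ?t {I2, K2}"
      using pos4_swaps(3)[OF L'(1,2)] L v'(2) by (simp add: tet_label_def)
    have dd: "distinct [?p k1, I2, K1, K2]" "{?p k1, I2, K1, K2} = {0..<4}"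
      using L' by auto
    show ?thesis
      using pairs o q e v' pos4_swaps(2)[OF dd] by metis
  qed
qed

lemma Anext_label:
  assumes l: "tet_label t k1 k2 i1 i2"
  shows "Anext gl bt veer t i1 = k1"
proof -
  have d: "distinct [k1, k2, i1, i2]" "{0..<4} = {k1, k2, i1, i2}" "bt t = {k1, k2}"
    using l unfolding tet_label_def by blast+
  have s: "{0..<4} - {i1, k1} = {i2, k2}" "{0..<4} - {i1, k2} = {i2, k1}"
    unfolding d(2) using d(1) by auto
  show ?thesis
    unfolding Anext_def tet_label_top_edge[OF l]
  proof (rule the_equality)
    show "k1 \<in> bt t \<and> V t ({0..<4} - {i1, k1}) = V t {i1, i2}"
      using l s by (simp add: tet_label_def)
  next
    fix k assume k: "k \<in> bt t \<and> V t ({0..<4} - {i1, k}) = V t {i1, i2}"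
    then have "k = k1 \<or> k = k2" using d(3) by simp
    moreover have "k \<noteq> k2" using k s(2) l unfolding tet_label_def by metis
    ultimately show "k = k1" by blast
  qed
qed

lemma Lset_label:
  assumes l: "tet_label t k1 k2 i1 i2"
  shows "Lset gl bt veer t = {{i1, i2}, {i1, k2}, {i2, k1}}"
proof -
  have d: "distinct [k1, k2, i1, i2]" "{0..<4} = {k1, k2, i1, i2}" "bt t = {k1, k2}"
    using l unfolding tet_label_def by blast+
  have v: "V t {i1, k1} = V t {i1, i2}" "V t {i2, k2} = V t {i1, i2}"
     "V t {i1, k2} \<noteq> V t {i1, i2}" "V t {i2, k1} \<noteq> V t {i1, i2}"
    using l by (auto simp: tet_label_def)
  have "{s. s \<subseteq> {0..<4} \<and> card s = 2 \<and> s \<noteq> bt t \<and> s \<noteq> {i1, i2} \<and> V t s \<noteq> V t {i1, i2}}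
      = {{i1, k2}, {i2, k1}}" (is "?A = ?B")
  proof
    show "?A \<subseteq> ?B"
    proof
      fix s assume "s \<in> ?A"
      then have s: "s \<subseteq> {k1, k2, i1, i2}" "card s = 2" "s \<noteq> {k1, k2}" "V t s \<noteq> V t {i1, i2}"
        using d by auto
      show "s \<in> ?B" using card_2_subset_cases[OF s(1,2)] s(3,4) v by (auto simp: insert_commute)
    qed
    show "?B \<subseteq> ?A" using v d by (auto simp: doubleton_eq_iff)
  qed
  then show ?thesis unfolding Lset_def tet_label_top_edge[OF l] by simp
qed

lemma face_edges_label:
  assumes l: "tet_label t k1 k2 i1 i2"
  shows "{s. s \<subseteq> {0..<4} - {i1} \<and> card s = 2 \<and> s \<noteq> bt t} = {{i2, k1}, {i2, k2}}" (is "?A = ?B")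
proof
  have d: "distinct [k1, k2, i1, i2]" "{0..<4} = {k1, k2, i1, i2}" "bt t = {k1, k2}"
    using l unfolding tet_label_def by blast+
  show "?A \<subseteq> ?B"
  proof
    fix s assume "s \<in> ?A"
    then have s: "s \<subseteq> {k1, k2, i1, i2}" "card s = 2" "s \<noteq> {k1, k2}" "i1 \<notin> s"
      using d by auto
    show "s \<in> ?B" using card_2_subset_cases[OF s(1,2)] s(3,4) by (auto simp: insert_commute)
  qed
  show "?B \<subseteq> ?A" using d by (auto simp: doubleton_eq_iff)
qed

section \<open>Faces and the AB permutation\<close>

lemma fcls_glue:
  assumes "t < n" "i < 4"
  shows "fcls gl (nbr t i, gmap t i i) = fcls gl (t, i)"
  using glue(4,5)[OF assms] assms(2) by (auto simp: fcls_def)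

lemma fcls_self: "x \<in> fcls gl x"
  by (simp add: fcls_def)

lemma fcls_bottom_filter:
  assumes "t < n" "i < 4" "i \<notin> bt t"
  shows "{x \<in> fcls gl (t, i). snd x \<notin> bt (fst x)} = {(t, i)}"
  using assms glue(7)[OF assms(1,2)] by (auto simp: fcls_def)

lemma fcls_top_filter:
  assumes "t < n" "i < 4" "i \<in> bt t"
  shows "{x \<in> fcls gl (t, i). snd x \<in> bt (fst x)} = {(t, i)}"
  using assms glue(7)[OF assms(1,2)] by (auto simp: fcls_def)

lemma bfi_fcls:
  assumes "t < n" "i < 4" "i \<notin> bt t"
  shows "bfi bt (fcls gl (t, i)) = (t, i)"
proof -
  have "x \<in> fcls gl (t, i) \<and> snd x \<notin> bt (fst x) \<longleftrightarrow> x = (t, i)" for x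
    using fcls_bottom_filter[OF assms] by blast
  then show ?thesis by (simp add: bfi_def)
qed

definition bot_faces :: "(nat \<times> nat) set" where
  "bot_faces = {(t, i). t < n \<and> i < 4 \<and> i \<notin> bt t}"

lemma bij_fcls: "bij_betw (fcls gl) bot_faces (faces n gl)"
  unfolding bij_betw_def
proof
  show "inj_on (fcls gl) bot_faces"
    by (rule inj_on_inverseI[where g="bfi bt"]) (auto simp: bot_faces_def bfi_fcls)
  show "fcls gl ` bot_faces = faces n gl"
  proof
    show "fcls gl ` bot_faces \<subseteq> faces n gl" unfolding bot_faces_def faces_def by blast
    show "faces n gl \<subseteq> fcls gl ` bot_faces"
    proof
      fix f assume "f \<in> faces n gl"
      then obtain t i where f: "f = fcls gl (t, i)" and ti: "t < n" "i < 4" by (auto simp: faces_def)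
      show "f \<in> fcls gl ` bot_faces"
      proof (cases "i \<in> bt t")
        case True
        then have "(nbr t i, gmap t i i) \<in> bot_faces"
          using glue(1,7)[OF ti] gmap_less[OF ti ti(2)] by (auto simp: bot_faces_def)
        then show ?thesis using fcls_glue[OF ti] f by (metis image_eqI)
      next
        case False
        then show ?thesis using f ti by (auto simp: bot_faces_def)
      qed
    qed
  qed
qed

lemma face_cases:
  assumes "f \<in> faces n gl"
  obtains t k1 k2 i1 i2 where "t < n" "tet_label t k1 k2 i1 i2" "f = fcls gl (t, i1)"
proof -
  have "f \<in> fcls gl ` bot_faces" using assms bij_fcls by (simp add: bij_betw_def)
  then obtain t i where "f = fcls gl (t, i)" "t < n" "i < 4" "i \<notin> bt t" by (auto simp: bot_faces_def)
  then show ?thesis using that tet_label_exists_bottom by blast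
qed

lemma finite_faces: "finite (faces n gl)"
proof -
  have "{(t, i). t < n \<and> i < (4::nat)} = {..<n} \<times> {..<4}" by auto
  then show ?thesis by (simp add: faces_def)
qed

lemma label_bottom: "tet_label t k1 k2 i1 i2 \<Longrightarrow> i1 \<notin> bt t"
  by (auto simp: tet_label_def)

lemma label_top: "tet_label t k1 k2 i1 i2 \<Longrightarrow> k1 \<in> bt t"
  by (auto simp: tet_label_def)

lemma Afun_label:
  assumes "t < n" "tet_label t k1 k2 i1 i2"
  shows "Afun gl bt veer (fcls gl (t, i1)) = fcls gl (t, k1)"
    "Alab gl bt veer m (fcls gl (t, i1)) = m t k1 - m t i1"
  using bfi_fcls[OF assms(1) tet_label_less(3)[OF assms(2)] label_bottom[OF assms(2)]] Anext_label[OF assms(2)]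
  by (auto simp: Afun_def Alab_def)

text \<open>A face is a top face of exactly one tetrahedron, so \<open>Afun f\<close> determines
  \<open>t\<close> and \<open>k1\<close>; the two bottom faces of \<open>t\<close> go to its two
  different top faces, which recovers \<open>i1\<close>. Finiteness gives surjectivity.\<close>

lemma bij_Afun: "bij_betw (Afun gl bt veer) (faces n gl) (faces n gl)"
  unfolding bij_betw_def
proof
  let ?A = "Afun gl bt veer"
  show inj: "inj_on ?A (faces n gl)"
  proof (rule inj_onI)
    fix f g assume f: "f \<in> faces n gl" and g: "g \<in> faces n gl" and eq: "?A f = ?A g"
    obtain t k1 k2 i1 i2 where 1: "t < n" "tet_label t k1 k2 i1 i2" "f = fcls gl (t, i1)"
      using face_cases[OF f] .
    obtain t' k1' k2' i1' i2' where 2: "t' < n" "tet_label t' k1' k2' i1' i2'" "g = fcls gl (t', i1')"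
      using face_cases[OF g] .
    have "fcls gl (t, k1) = fcls gl (t', k1')" 
      using eq Afun_label(1)[OF 1(1,2)] Afun_label(1)[OF 2(1,2)] by (simp only: 1(3) 2(3))
    then have "{(t, k1)} = {(t', k1')}"
      using fcls_top_filter[OF 1(1) tet_label_less(1)[OF 1(2)] label_top[OF 1(2)]]
        fcls_top_filter[OF 2(1) tet_label_less(1)[OF 2(2)] label_top[OF 2(2)]] by metis
    then have tk: "t' = t" "k1' = k1" by auto
    have "i1' = i1"
    proof (rule ccontr)
      assume ne: "i1' \<noteq> i1"
      have "i1' \<in> top_e bt t" using tet_label_top_edge[OF 2(2)] tk by simp
      then have "i1' = i2" using tet_label_top_edge[OF 1(2)] ne by simp
      then have "k1' = k2" using Anext_label[OF 2(2)] Anext_label[OF tet_label_swap[OF 1(2)]] tk by simp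
      then show False using 1(2) tk unfolding tet_label_def by simp
    qed
    then show "f = g" using 1 2 tk by simp
  qed
  have "?A ` faces n gl \<subseteq> faces n gl"
  proof
    fix g assume "g \<in> ?A ` faces n gl"
    then obtain f where f: "f \<in> faces n gl" "g = ?A f" by auto
    obtain t k1 k2 i1 i2 where "t < n" "tet_label t k1 k2 i1 i2" "f = fcls gl (t, i1)"
      using face_cases[OF f(1)] .
    then show "g \<in> faces n gl"
      using Afun_label(1) tet_label_less(1) f(2) unfolding faces_def by blast
  qed
  then show "?A ` faces n gl = faces n gl"
    using inj finite_faces by (intro endo_inj_surj)
qed

end

section \<open>The matrices of the veering and taut polynomials\<close>

locale veering_cover = veering_tri n gl bt veer
  for n :: nat and gl :: gluing and bt :: "nat \<Rightarrow> nat set" and veer :: "(nat \<times> nat set) set \<Rightarrow> bool" +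
  fixes w :: "nat \<Rightarrow> nat \<Rightarrow> int ^ 'r" and l :: "nat \<Rightarrow> nat set \<Rightarrow> int ^ 'r"
    and m :: "nat \<Rightarrow> nat \<Rightarrow> int ^ 'r"
  assumes homology_cover: "homology_cover n gl w"
    and edge_lifts: "edge_lifts n gl w l"
    and face_lifts: "face_lifts n gl w m"
begin

abbreviation E :: "(nat \<times> nat set) set set" where "E \<equiv> edges n gl"
abbreviation F :: "(nat \<times> nat) set set" where "F \<equiv> faces n gl"
abbreviation L where "L \<equiv> Lmat n gl bt veer l"
abbreviation N where "N \<equiv> LTmat gl bt l m"

definition IA :: "(nat \<times> nat) set \<Rightarrow> (nat \<times> nat) set \<Rightarrow> (int ^ 'r) \<Rightarrow>\<^sub>0 int" where
  "IA f' f = (if f' = f then 1 else 0) + Amat gl bt veer m f' f"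

lemma lift_edge:
  assumes "t < n" "s \<subseteq> {0..<4}" "card s = 2" "i < 4" "i \<notin> s"
  shows "l (nbr t i) (gmap t i ` s) = l t s - w t i"
  using edge_lifts assms unfolding edge_lifts_def by (metis add_diff_cancel_left')

lemma lift_face:
  assumes "t < n" "i < 4"
  shows "m (nbr t i) (gmap t i i) = m t i - w t i"
  using face_lifts assms unfolding face_lifts_def by (metis add_diff_cancel_left')

text \<open>Contribution of the edge \<open>s\<close> of \<open>t\<close> to row \<open>e\<close>,
  measured from a reference lift \<open>g\<close>. Leaving \<open>g\<close> free allows columns
  based at faces, with \<open>g = m t i\<close>, to be compared with columns based at edges, with
  \<open>g = l t (bt t)\<close>.\<close>

definition edge_term :: "(nat \<times> nat set) set \<Rightarrow> nat \<Rightarrow> nat set \<Rightarrow> int ^ 'r \<Rightarrow> (int ^ 'r) \<Rightarrow>\<^sub>0 int" where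
  "edge_term e t s g = (if ecls gl (t, s) = e then gX (l t s - g) else 0)"

lemma edge_term_shift: "edge_term e t s g * gX (g - h) = edge_term e t s h"
  by (simp add: edge_term_def flip: gX_add)

lemma edge_term_glue:
  assumes "t < n" "s \<subseteq> {0..<4}" "card s = 2" "i < 4" "i \<notin> s"
  shows "edge_term e (nbr t i) (gmap t i ` s) (m (nbr t i) (gmap t i i)) = edge_term e t s (m t i)"
  using assms by (simp add: edge_term_def ecls_glue lift_edge lift_face)

lemma N_bottom:
  assumes t: "t < n" and i: "i < 4" "i \<notin> bt t"
    and s: "{s. s \<subseteq> {0..<4} - {i} \<and> card s = 2 \<and> s \<noteq> bt t} = {s1, s2}" "s1 \<noteq> s2"
  shows "N e (fcls gl (t, i)) = edge_term e t (bt t) (m t i) - edge_term e t s1 (m t i) - edge_term e t s2 (m t i)"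
  unfolding LTmat_def fcls_bottom_filter[OF t i] using s
  by (simp add: edge_term_def diff_diff_eq)

lemma N_label_bottom:
  assumes t: "t < n" and lab: "tet_label t k1 k2 i1 i2"
  shows "N e (fcls gl (t, i1)) = edge_term e t (bt t) (m t i1)
    - edge_term e t {i2, k1} (m t i1) - edge_term e t {i2, k2} (m t i1)"
proof (rule N_bottom[OF t tet_label_less(3)[OF lab] label_bottom[OF lab] face_edges_label[OF lab]])
  show "{i2, k1} \<noteq> {i2, k2}" using lab unfolding tet_label_def by (auto simp: doubleton_eq_iff)
qed

text \<open>The column of a top face is defined in the tetrahedron above it.
  \<open>glue_bottom_edge\<close> identifies the bottom edge there as the image of
  \<open>{i2, k2}\<close>, and the terms are pulled back through the gluing into labels of
  \<open>t\<close>.\<close>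

lemma N_label_top:
  assumes t: "t < n" and lab: "tet_label t k1 k2 i1 i2"
  shows "N e (fcls gl (t, k1)) = edge_term e t {i2, k2} (m t k1)
    - edge_term e t {i1, i2} (m t k1) - edge_term e t {i1, k2} (m t k1)"
proof -
  let ?p = "gmap t k1" and ?t = "nbr t k1"
  have k1: "k1 < 4" using tet_label_less(1)[OF lab] .
  have d: "distinct [k1, k2, i1, i2]" and s4: "{k1, k2, i1, i2} = {0..<4}" and btt: "bt t = {k1, k2}"
    using lab unfolding tet_label_def by blast+
  have t': "?t < n" using glue(1)[OF t k1] .
  have bot: "?p k1 \<notin> bt ?t" using glue(7)[OF t k1] label_top[OF lab] by simp
  have pk: "?p k1 < 4" using gmap_less[OF t k1 k1] .
  have btt': "bt ?t = ?p ` {i2, k2}" using glue_bottom_edge[OF t lab] by simp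
  have inj: "inj_on ?p {0..<4}" and im: "?p ` {0..<4} = {0..<4}"
    using glue(2)[OF t k1] by (auto simp: bij_betw_def)
  have sub: "{i2, k2} \<subseteq> {0..<4}" "{i1, i2} \<subseteq> {0..<4}" "{i1, k2} \<subseteq> {0..<4}" using s4 by blast+
  have crd: "card {i2, k2} = 2" "card {i1, i2} = 2" "card {i1, k2} = 2" using d by auto
  have nin: "k1 \<notin> {i2, k2}" "k1 \<notin> {i1, i2}" "k1 \<notin> {i1, k2}" using d by auto
  have img: "?p ` A = ?p ` B \<longleftrightarrow> A = B" if "A \<subseteq> {0..<4}" "B \<subseteq> {0..<4}" for A B
    using inj_on_image_eq_iff[OF inj that] .
  have ne: "{i1, i2} \<noteq> {i2, k2}" "{i1, k2} \<noteq> {i2, k2}" "{i1, i2} \<noteq> {i1, k2}"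
    using d by (auto simp: doubleton_eq_iff)
  have faces: "{s. s \<subseteq> {0..<4} - {?p k1} \<and> card s = 2 \<and> s \<noteq> bt ?t} = {?p ` {i1, i2}, ?p ` {i1, k2}}" (is "?A = ?B")
  proof
    show "?A \<subseteq> ?B"
    proof
      fix s assume "s \<in> ?A"
      then have s: "s \<subseteq> {0..<4} - {?p k1}" "card s = 2" "s \<noteq> bt ?t" by blast+
      then have "s \<subseteq> ?p ` {0..<4}" unfolding im by blast
      then obtain r where r: "r \<subseteq> {0..<4}" "s = ?p ` r" unfolding subset_image_iff by blast
      have "card r = 2" using card_image[OF inj_on_subset[OF inj r(1)]] s(2) r(2) by simp
      moreover have "k1 \<notin> r" using s(1) r(2) by blast
      moreover have "r \<noteq> {i2, k2}" using s(3) r(2) btt' by blast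
      moreover have "r \<subseteq> {k1, k2, i1, i2}" using r s4 by simp
      ultimately have "r = {i1, i2} \<or> r = {i1, k2}"
        using card_2_subset_cases[of r k1 k2 i1 i2] by (auto simp: insert_commute)
      then show "s \<in> ?B" using r by auto
    qed
    have notin: "?p k1 \<notin> ?p ` A" if "A \<subseteq> {0..<4}" "k1 \<notin> A" for A
      using inj_on_image_mem_iff[OF inj _ that(1)] that k1 by simp
    have mem: "?p ` A \<in> ?A" if A: "A \<subseteq> {0..<4}" "k1 \<notin> A" "card A = 2" "A \<noteq> {i2, k2}" for A
    proof -
      have "?p ` A \<subseteq> {0..<4}" using image_mono[OF A(1), of ?p] unfolding im .
      moreover have "card (?p ` A) = 2" using card_image[OF inj_on_subset[OF inj A(1)]] A(3) by simp
      moreover have "?p ` A \<noteq> bt ?t" unfolding btt' using img[OF A(1) sub(1)] A(4) by blast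
      ultimately show ?thesis using notin[OF A(1,2)] by blast
    qed
    show "?B \<subseteq> ?A"
      using mem[OF sub(2) nin(2) crd(2) ne(1)] mem[OF sub(3) nin(3) crd(3) ne(2)]
      by (simp only: insert_subset empty_subsetI)
  qed
  have ne': "?p ` {i1, i2} \<noteq> ?p ` {i1, k2}" using img[OF sub(2,3)] ne(3) by blast
  have "N e (fcls gl (?t, ?p k1)) = edge_term e ?t (bt ?t) (m ?t (?p k1))
      - edge_term e ?t (?p ` {i1, i2}) (m ?t (?p k1)) - edge_term e ?t (?p ` {i1, k2}) (m ?t (?p k1))"
    by (rule N_bottom[OF t' pk bot faces ne'])
  then show ?thesis
    unfolding btt' fcls_glue[OF t k1]
      edge_term_glue[OF t sub(1) crd(1) k1 nin(1)]
      edge_term_glue[OF t sub(2) crd(2) k1 nin(2)]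
      edge_term_glue[OF t sub(3) crd(3) k1 nin(3)] .
qed

lemma L_label:
  assumes t: "t < n" and lab: "tet_label t k1 k2 i1 i2"
  shows "L e (edge_of t) * gX (l t (bt t) - g) = edge_term e t (bt t) g
    - edge_term e t {i1, i2} g - edge_term e t {i1, k2} g - edge_term e t {i2, k1} g"
proof -
  have st: "{t'. t' < n \<and> ecls gl (t', bt t') = edge_of t} = {t}"
  proof -
    have "inj_on edge_of {..<n}" using bij_edge_of by (simp add: bij_betw_def)
    then show ?thesis using t by (auto simp: inj_on_def edge_of_def)
  qed
  have "{i1, i2} \<noteq> {i1, k2}" "{i1, i2} \<noteq> {i2, k1}" "{i1, k2} \<noteq> {i2, k1}"
    using lab unfolding tet_label_def by (auto simp: doubleton_eq_iff)
  then have "L e (edge_of t) = (if e = edge_of t then 1 else 0)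
      - edge_term e t {i1, i2} (l t (bt t)) - edge_term e t {i1, k2} (l t (bt t)) - edge_term e t {i2, k1} (l t (bt t))"
    unfolding Lmat_def st by (simp add: Lset_label[OF lab] diff_diff_eq add.assoc flip: edge_term_def)
  moreover have "(if e = edge_of t then 1 else 0) = edge_term e t (bt t) (l t (bt t))"
    by (simp add: edge_term_def edge_of_def gX_zero)
  ultimately show ?thesis
    by (simp only: left_diff_distrib edge_term_shift)
qed

definition bot_edge :: "(nat \<times> nat set) set \<Rightarrow> (nat \<times> nat) set \<Rightarrow> (int ^ 'r) \<Rightarrow>\<^sub>0 int" where
  "bot_edge e f = (let x = bfi bt f in
     if e = edge_of (fst x) then gX (l (fst x) (bt (fst x)) - m (fst x) (snd x)) else 0)"

lemma bot_edge_label: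
  assumes "t < n" "tet_label t k1 k2 i1 i2"
  shows "bot_edge e (fcls gl (t, i1)) = (if e = edge_of t then gX (l t (bt t) - m t i1) else 0)"
  using bfi_fcls[OF assms(1) tet_label_less(3)[OF assms(2)] label_bottom[OF assms(2)]]
  by (simp add: bot_edge_def)

lemma IA_label:
  assumes "t < n" "tet_label t k1 k2 i1 i2"
  shows "IA f (fcls gl (t, i1)) = (if f = fcls gl (t, i1) then 1 else 0)
    + (if f = fcls gl (t, k1) then gX (m t k1 - m t i1) else 0)"
  by (simp add: IA_def Amat_def Afun_label[OF assms])

lemma edge_of_edges: "t < n \<Longrightarrow> edge_of t \<in> E"
  using bij_edge_of by (auto simp: bij_betw_def)

lemma fcls_faces: "t < n \<Longrightarrow> i < 4 \<Longrightarrow> fcls gl (t, i) \<in> F"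
  by (auto simp: faces_def)

text \<open>Adding the translated column of \<open>A f\<close> to the column of \<open>f\<close>
  cancels the edge \<open>{i2, k2}\<close>, which is a subtracted edge of \<open>f\<close> and the
  bottom edge for \<open>A f\<close>. What remains are the top edge and the two side edges of
  opposite veer, which is the column of \<open>L\<close> at the bottom edge.\<close>

lemma N_IA:
  assumes "f \<in> F"
  shows "(\<Sum>g\<in>F. N e g * IA g f) = (\<Sum>e'\<in>E. L e e' * bot_edge e' f)"
proof -
  obtain t k1 k2 i1 i2 where t: "t < n" and lab: "tet_label t k1 k2 i1 i2" and f: "f = fcls gl (t, i1)"
    using face_cases[OF assms] .
  have kF: "fcls gl (t, k1) \<in> F" by (rule fcls_faces[OF t tet_label_less(1)[OF lab]])
  have "(\<Sum>g\<in>F. N e g * IA g f)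
      = (\<Sum>g\<in>F. (if g = f then N e g else 0) + (if g = fcls gl (t, k1) then N e g * gX (m t k1 - m t i1) else 0))"
    unfolding f IA_label[OF t lab] by (intro sum.cong refl) (auto simp: distrib_left)
  also have "\<dots> = N e (fcls gl (t, i1)) + N e (fcls gl (t, k1)) * gX (m t k1 - m t i1)"
    using assms kF finite_faces by (simp add: sum.distrib f)
  also have "\<dots> = L e (edge_of t) * gX (l t (bt t) - m t i1)"
    unfolding N_label_bottom[OF t lab] N_label_top[OF t lab] L_label[OF t lab] left_diff_distrib edge_term_shift
    by simp
  also have "\<dots> = (\<Sum>e'\<in>E. if e' = edge_of t then L e e' * gX (l t (bt t) - m t i1) else 0)"
    using finite_edges edge_of_edges[OF t] by simp
  also have "\<dots> = (\<Sum>e'\<in>E. L e e' * bot_edge e' f)"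
    unfolding f bot_edge_label[OF t lab] by (intro sum.cong refl) auto
  finally show ?thesis .
qed

section \<open>Splitting the bottom-edge map and its kernel\<close>

definition I1 :: "nat \<Rightarrow> nat" where "I1 t = (SOME i1. \<exists>k1 k2 i2. tet_label t k1 k2 i1 i2)"
definition I2 :: "nat \<Rightarrow> nat" where "I2 t = (SOME i2. \<exists>k1 k2. tet_label t k1 k2 (I1 t) i2)"
definition K1 :: "nat \<Rightarrow> nat" where "K1 t = Anext gl bt veer t (I1 t)"
definition K2 :: "nat \<Rightarrow> nat" where "K2 t = Anext gl bt veer t (I2 t)"

lemma label:
  assumes "t < n"
  shows "tet_label t (K1 t) (K2 t) (I1 t) (I2 t)"
proof -
  have "\<exists>i1 k1 k2 i2. tet_label t k1 k2 i1 i2" using tet_label_exists[OF assms] by blast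
  then have "\<exists>k1 k2 i2. tet_label t k1 k2 (I1 t) i2" unfolding I1_def by (rule someI_ex)
  then have "\<exists>i2 k1 k2. tet_label t k1 k2 (I1 t) i2" by blast
  then have "\<exists>k1 k2. tet_label t k1 k2 (I1 t) (I2 t)" unfolding I2_def by (rule someI_ex)
  then obtain k1 k2 where lab: "tet_label t k1 k2 (I1 t) (I2 t)" by blast
  have "K1 t = k1" "K2 t = k2"
    using Anext_label[OF lab] Anext_label[OF tet_label_swap[OF lab]] by (auto simp: K1_def K2_def)
  then show ?thesis using lab by simp
qed

lemmas label' = label[THEN tet_label_swap]

definition tet :: "(nat \<times> nat set) set \<Rightarrow> nat" where
  "tet = the_inv_into {..<n} edge_of"

lemma tet: "e \<in> E \<Longrightarrow> tet e < n" "e \<in> E \<Longrightarrow> edge_of (tet e) = e" "t < n \<Longrightarrow> tet (edge_of t) = t"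
proof -
  have inj: "inj_on edge_of {..<n}" and im: "edge_of ` {..<n} = E"
    using bij_edge_of by (auto simp: bij_betw_def)
  show "e \<in> E \<Longrightarrow> tet e < n" using the_inv_into_into[OF inj, of e "{..<n}"] im by (auto simp: tet_def)
  show "e \<in> E \<Longrightarrow> edge_of (tet e) = e" using f_the_inv_into_f[OF inj] im by (auto simp: tet_def)
  show "t < n \<Longrightarrow> tet (edge_of t) = t" using the_inv_into_f_f[OF inj] by (auto simp: tet_def)
qed

abbreviation face1 :: "(nat \<times> nat set) set \<Rightarrow> (nat \<times> nat) set" where
  "face1 e \<equiv> fcls gl (tet e, I1 (tet e))"
abbreviation face2 :: "(nat \<times> nat set) set \<Rightarrow> (nat \<times> nat) set" where
  "face2 e \<equiv> fcls gl (tet e, I2 (tet e))"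

abbreviation mon :: "nat \<Rightarrow> nat \<Rightarrow> (int ^ 'r) \<Rightarrow>\<^sub>0 int" where
  "mon t i \<equiv> gX (m t i - l t (bt t))"
abbreviation imon :: "nat \<Rightarrow> nat \<Rightarrow> (int ^ 'r) \<Rightarrow>\<^sub>0 int" where
  "imon t i \<equiv> gX (l t (bt t) - m t i)"

lemma mon_imon: "imon t i * mon t i = 1"
  by (simp add: gX_zero flip: gX_add)

text \<open>The columns of \<open>Smat\<close> split \<open>bot_edge\<close> and those of \<open>Kmat\<close> span its kernel; \<open>Cmat\<close> and
  \<open>bot_edge\<close> together invert the square matrix formed by \<open>Smat\<close> and \<open>Kmat\<close>.\<close>

definition Smat :: "(nat \<times> nat) set \<Rightarrow> (nat \<times> nat set) set \<Rightarrow> (int ^ 'r) \<Rightarrow>\<^sub>0 int" where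
  "Smat f e = (if f = face1 e then mon (tet e) (I1 (tet e)) else 0)"

definition Kmat :: "(nat \<times> nat) set \<Rightarrow> (nat \<times> nat set) set \<Rightarrow> (int ^ 'r) \<Rightarrow>\<^sub>0 int" where
  "Kmat f e = (if f = face1 e then mon (tet e) (I1 (tet e)) else 0)
     - (if f = face2 e then mon (tet e) (I2 (tet e)) else 0)"

definition Cmat :: "(nat \<times> nat set) set \<Rightarrow> (nat \<times> nat) set \<Rightarrow> (int ^ 'r) \<Rightarrow>\<^sub>0 int" where
  "Cmat e f = (if f = face2 e then - imon (tet e) (I2 (tet e)) else 0)"

lemma fcls_bottom_eq:
  assumes "t < n" "i < 4" "i \<notin> bt t" "t' < n" "i' < 4" "i' \<notin> bt t'"
  shows "fcls gl (t, i) = fcls gl (t', i') \<longleftrightarrow> t = t' \<and> i = i'"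
proof
  assume "fcls gl (t, i) = fcls gl (t', i')"
  then have "(t, i) = bfi bt (fcls gl (t', i'))" using bfi_fcls[OF assms(1-3)] by simp
  also have "\<dots> = (t', i')" by (rule bfi_fcls[OF assms(4-6)])
  finally show "t = t' \<and> i = i'" by simp
qed simp

lemma face_eq:
  assumes "e \<in> E" "e' \<in> E"
  shows "face1 e = face1 e' \<longleftrightarrow> e = e'" "face2 e = face2 e' \<longleftrightarrow> e = e'"
    "face1 e \<noteq> face2 e'" "face1 e \<in> F" "face2 e \<in> F"
proof -
  note t = tet(1)[OF assms(1)] tet(1)[OF assms(2)]
  have b: "I1 (tet e) \<notin> bt (tet e)" "I1 (tet e') \<notin> bt (tet e')"
    "I2 (tet e) \<notin> bt (tet e)" "I2 (tet e') \<notin> bt (tet e')"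
    using label_bottom[OF label] label_bottom[OF label'] t by auto
  have less: "I1 (tet e) < 4" "I1 (tet e') < 4" "I2 (tet e) < 4" "I2 (tet e') < 4"
    using tet_label_less[OF label] t by auto
  have inj: "tet e = tet e' \<longleftrightarrow> e = e'" using tet(2) assms by metis
  show "face1 e = face1 e' \<longleftrightarrow> e = e'" "face2 e = face2 e' \<longleftrightarrow> e = e'"
    using fcls_bottom_eq b less t inj by auto
  have "I1 (tet e) \<noteq> I2 (tet e)" using label[OF t(1)] by (simp add: tet_label_def)
  then show "face1 e \<noteq> face2 e'" using fcls_bottom_eq b less t by metis
  show "face1 e \<in> F" "face2 e \<in> F" using fcls_faces t less by auto
qed

lemma bot_edge_face:
  assumes "e' \<in> E"
  shows "bot_edge e (face1 e') = (if e = e' then imon (tet e') (I1 (tet e')) else 0)"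
    "bot_edge e (face2 e') = (if e = e' then imon (tet e') (I2 (tet e')) else 0)"
  using bot_edge_label[OF tet(1)[OF assms] label[OF tet(1)[OF assms]]]
    bot_edge_label[OF tet(1)[OF assms] label'[OF tet(1)[OF assms]]] tet(2)[OF assms] by auto

lemma sum_F_delta:
  fixes G :: "(nat \<times> nat) set \<Rightarrow> (int ^ 'r) \<Rightarrow>\<^sub>0 int"
  assumes "g \<in> F"
  shows "(\<Sum>f\<in>F. G f * (if f = g then c else 0)) = G g * c"
proof -
  have "(\<Sum>f\<in>F. G f * (if f = g then c else 0)) = (\<Sum>f\<in>F. if f = g then G f * c else 0)"
    by (intro sum.cong refl) auto
  then show ?thesis using assms finite_faces by simp
qed

lemma sum_Smat: "e \<in> E \<Longrightarrow> (\<Sum>f\<in>F. G f * Smat f e) = G (face1 e) * mon (tet e) (I1 (tet e))"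
  unfolding Smat_def by (rule sum_F_delta) (rule face_eq)

lemma sum_Kmat:
  assumes "e \<in> E"
  shows "(\<Sum>f\<in>F. G f * Kmat f e)
    = G (face1 e) * mon (tet e) (I1 (tet e)) - G (face2 e) * mon (tet e) (I2 (tet e))"
  unfolding Kmat_def right_diff_distrib sum_subtractf
  using sum_F_delta[OF face_eq(4)[OF assms assms]] sum_F_delta[OF face_eq(5)[OF assms assms]] by simp

lemma matrix_relations:
  assumes "e \<in> E" "e' \<in> E"
  shows "(\<Sum>f\<in>F. bot_edge e f * Smat f e') = (if e = e' then 1 else 0)"
    "(\<Sum>f\<in>F. bot_edge e f * Kmat f e') = 0"
    "(\<Sum>f\<in>F. Cmat e f * Smat f e') = 0"
    "(\<Sum>f\<in>F. Cmat e f * Kmat f e') = (if e = e' then 1 else 0)"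
  using face_eq(2)[OF assms(2,1)] face_eq(3)[OF assms(2,1)]
  by (auto simp: sum_Smat[OF assms(2)] sum_Kmat[OF assms(2)] bot_edge_face[OF assms(2)] Cmat_def mon_imon)

lemma faces_decomposition: "F = face1 ` E \<union> face2 ` E"
proof
  show "face1 ` E \<union> face2 ` E \<subseteq> F" using face_eq(4,5) by blast
  show "F \<subseteq> face1 ` E \<union> face2 ` E"
  proof
    fix f assume "f \<in> F"
    then obtain t k1 k2 i1 i2 where t: "t < n" and lab: "tet_label t k1 k2 i1 i2" and f: "f = fcls gl (t, i1)"
      by (rule face_cases)
    have "i1 \<in> {I1 t, I2 t}"
      using tet_label_top_edge[OF lab] tet_label_top_edge[OF label[OF t]] by blast
    then have "f = face1 (edge_of t) \<or> f = face2 (edge_of t)" using f tet(3)[OF t] by auto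
    then show "f \<in> face1 ` E \<union> face2 ` E" using edge_of_edges[OF t] by blast
  qed
qed

text \<open>Hence the faces left over by a maximal minor of \<open>N\<close> can again be indexed by
  the edges.\<close>

lemma card_faces: "card F = 2 * card E"
proof -
  have "card (face1 ` E \<union> face2 ` E) = card (face1 ` E) + card (face2 ` E)"
    using finite_edges face_eq(3) by (intro card_Un_disjoint) auto
  moreover have "inj_on face1 E" "inj_on face2 E" using face_eq(1,2) by (auto intro!: inj_onI)
  ultimately show ?thesis using faces_decomposition by (simp add: card_image)
qed

section \<open>The residual matrix as a signed incidence matrix of the dual graph\<close>

definition Dmat :: "(nat \<times> nat) set \<Rightarrow> (nat \<times> nat set) set \<Rightarrow> (int ^ 'r) \<Rightarrow>\<^sub>0 int" where
  "Dmat f e = (\<Sum>g\<in>F. IA f g * Kmat g e)"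

text \<open>The kernel column at \<open>t\<close> is the difference of its faces \<open>I1\<close>
  and \<open>I2\<close>; applying \<open>I + A\<close> adds \<open>K1\<close> to the first and
  \<open>K2\<close> to the second. These are the resulting signs at the four faces.\<close>

definition orient :: "nat \<Rightarrow> nat \<Rightarrow> int" where
  "orient t i = (if i = I1 t \<or> i = K1 t then 1 else - 1)"

lemma orient_square: "orient t i * orient t i = 1"
  by (simp add: orient_def)

text \<open>The monomial cancels the chosen lift of the bottom edge; in this normalization, crossing
  a face multiplies by the deck translation \<open>w\<close> and an integer only.\<close>

definition unit_row :: "nat \<Rightarrow> (nat \<times> nat set) set \<Rightarrow> (int ^ 'r) \<Rightarrow>\<^sub>0 int" where
  "unit_row t e = (if e = edge_of t then gX (- l t (bt t)) else 0)"

lemma Dmat_eq: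
  assumes t: "t < n"
  shows "Dmat f (edge_of t) = (\<Sum>i<4. if f = fcls gl (t, i) then of_int (orient t i) * mon t i else 0)"
proof -
  define c where "c i = (if f = fcls gl (t, i) then mon t i else 0)" for i
  note lab = label[OF t] and lab' = label'[OF t]
  have d: "distinct [K1 t, K2 t, I1 t, I2 t]" and s4: "{K1 t, K2 t, I1 t, I2 t} = {..<4}"
    using lab unfolding tet_label_def atLeast0LessThan by blast+
  have sh: "gX (m t j - m t i) * mon t i = mon t j" for i j
    by (simp flip: gX_add)
  have IA: "IA f (fcls gl (t, I1 t)) * mon t (I1 t) = c (I1 t) + c (K1 t)"
    "IA f (fcls gl (t, I2 t)) * mon t (I2 t) = c (I2 t) + c (K2 t)"
    unfolding IA_label[OF t lab] IA_label[OF t lab'] c_def by (auto simp: distrib_right sh)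
  have "Dmat f (edge_of t) = (c (I1 t) + c (K1 t)) - (c (I2 t) + c (K2 t))"
    unfolding Dmat_def sum_Kmat[OF edge_of_edges[OF t]] tet(3)[OF t] IA ..
  also have "\<dots> = (\<Sum>i\<in>{K1 t, K2 t, I1 t, I2 t}. of_int (orient t i) * c i)"
    using d by (simp add: orient_def)
  also have "\<dots> = (\<Sum>i<4. if f = fcls gl (t, i) then of_int (orient t i) * mon t i else 0)"
    unfolding s4 by (intro sum.cong refl) (simp add: c_def)
  finally show ?thesis .
qed

lemma Dmat_row:
  assumes t: "t < n" and i: "i < 4" and e: "e \<in> E"
  shows "Dmat (fcls gl (t, i)) e = of_int (orient t i) * gX (m t i) * unit_row t e
    + of_int (orient (nbr t i) (gmap t i i)) * gX (m (nbr t i) (gmap t i i)) * unit_row (nbr t i) e"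
proof -
  obtain s where s: "s < n" "e = edge_of s" using tet(1)[OF e] tet(2)[OF e, symmetric] by (rule that)
  let ?t = "nbr t i" and ?i = "gmap t i i"
  have t': "?t < n" "?i < 4" using glue(1)[OF t i] gmap_less[OF t i i] by auto
  let ?h = "\<lambda>j. of_int (orient s j) * mon s j"
  have eq: "fcls gl (t, i) = fcls gl (s, j) \<longleftrightarrow> (s, j) = (t, i) \<or> (s, j) = (?t, ?i)" if "j < 4" for j
  proof
    assume "fcls gl (t, i) = fcls gl (s, j)"
    then have "(s, j) \<in> fcls gl (t, i)" using fcls_self by metis
    then show "(s, j) = (t, i) \<or> (s, j) = (?t, ?i)" by (simp add: fcls_def)
  next
    assume "(s, j) = (t, i) \<or> (s, j) = (?t, ?i)"
    then show "fcls gl (t, i) = fcls gl (s, j)" using fcls_glue[OF t i] by auto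
  qed
  \<comment> \<open>A face may have the same tetrahedron on both sides; as no face is glued to
    itself, its two instances are still distinct and both terms count.\<close>
  have "Dmat (fcls gl (t, i)) e = (\<Sum>j<4. (if j = i then if s = t then ?h j else 0 else 0)
      + (if j = ?i then if s = ?t then ?h j else 0 else 0))"
    unfolding s(2) Dmat_eq[OF s(1)]
    using glue(3)[OF t i] by (intro sum.cong refl) (auto simp: eq)
  also have "\<dots> = (if s = t then ?h i else 0) + (if s = ?t then ?h ?i else 0)"
    using i t' by (simp add: sum.distrib)
  also have "(if s = t then ?h i else 0) = of_int (orient t i) * gX (m t i) * unit_row t e"
    using tet(3)[OF s(1)] tet(3)[OF t] s(2) by (auto simp: unit_row_def mult.assoc simp flip: gX_add)
  also have "(if s = ?t then ?h ?i else 0) = of_int (orient ?t ?i) * gX (m ?t ?i) * unit_row ?t e"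
    using tet(3)[OF s(1)] tet(3)[OF t'(1)] s(2) by (auto simp: unit_row_def mult.assoc simp flip: gX_add)
  finally show ?thesis .
qed

section \<open>The row space of the residual matrix and closed walks\<close>

definition row_span :: "((nat \<times> nat set) set \<Rightarrow> (int ^ 'r) \<Rightarrow>\<^sub>0 int) \<Rightarrow> bool" where
  "row_span v \<longleftrightarrow> (\<exists>X. \<forall>e\<in>E. v e = (\<Sum>f\<in>F. X f * Dmat f e))"

lemma row_span_add: "row_span u \<Longrightarrow> row_span v \<Longrightarrow> row_span (\<lambda>e. u e + v e)"
  unfolding row_span_def
proof (elim exE)
  fix X Y assume "\<forall>e\<in>E. u e = (\<Sum>f\<in>F. X f * Dmat f e)" "\<forall>e\<in>E. v e = (\<Sum>f\<in>F. Y f * Dmat f e)"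
  then show "\<exists>X. \<forall>e\<in>E. u e + v e = (\<Sum>f\<in>F. X f * Dmat f e)"
    by (intro exI[of _ "\<lambda>f. X f + Y f"]) (simp add: distrib_right sum.distrib)
qed

lemma row_span_mult: "row_span u \<Longrightarrow> row_span (\<lambda>e. c * u e)"
  unfolding row_span_def
proof (elim exE)
  fix X assume "\<forall>e\<in>E. u e = (\<Sum>f\<in>F. X f * Dmat f e)"
  then show "\<exists>X. \<forall>e\<in>E. c * u e = (\<Sum>f\<in>F. X f * Dmat f e)"
    by (intro exI[of _ "\<lambda>f. c * X f"]) (simp add: sum_distrib_left mult.assoc)
qed

lemma row_span_Dmat:
  assumes "f \<in> F"
  shows "row_span (Dmat f)"
  unfolding row_span_def
proof (intro exI ballI)
  fix e
  have "(\<Sum>g\<in>F. (if g = f then 1 else 0) * Dmat g e) = (\<Sum>g\<in>F. if g = f then Dmat g e else 0)"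
    by (intro sum.cong refl) auto
  then show "Dmat f e = (\<Sum>g\<in>F. (if g = f then 1 else 0) * Dmat g e)"
    using assms finite_faces by simp
qed

lemma row_span_cong: "row_span u \<Longrightarrow> (\<And>e. e \<in> E \<Longrightarrow> u e = v e) \<Longrightarrow> row_span v"
  unfolding row_span_def by simp

text \<open>Row \<open>f\<close> of \<open>Dmat\<close>, rescaled by a unit, expresses the basis
  vector behind the face by the one in front. The lifts of faces drop out because their difference
  across a face is \<open>w\<close>.\<close>

lemma row_span_step:
  assumes t: "t < n" and i: "i < 4"
  shows "\<exists>s::int. row_span (\<lambda>e. unit_row (nbr t i) e - of_int s * gX (w t i) * unit_row t e)"
proof -
  let ?t = "nbr t i" and ?i = "gmap t i i"
  let ?o = "of_int (orient ?t ?i) :: (int ^ 'r) \<Rightarrow>\<^sub>0 int"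
  have "row_span (\<lambda>e. (?o * gX (- m ?t ?i)) * Dmat (fcls gl (t, i)) e)"
    by (intro row_span_mult row_span_Dmat fcls_faces t i)
  moreover have "(?o * gX (- m ?t ?i)) * Dmat (fcls gl (t, i)) e
      = unit_row ?t e - of_int (- orient ?t ?i * orient t i) * gX (w t i) * unit_row t e" if "e \<in> E" for e
  proof -
    have o: "?o * ?o = 1" unfolding of_int_mult[symmetric] orient_square by simp
    have g: "gX (- m ?t ?i) * gX (m ?t ?i) = 1" "gX (- m ?t ?i) * gX (m t i) = gX (w t i)"
      using lift_face[OF t i] by (simp_all add: gX_zero flip: gX_add)
    have "(?o * gX (- m ?t ?i)) * Dmat (fcls gl (t, i)) e
      = (?o * of_int (orient t i)) * (gX (- m ?t ?i) * gX (m t i)) * unit_row t e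
        + (?o * ?o) * (gX (- m ?t ?i) * gX (m ?t ?i)) * unit_row ?t e"
      unfolding Dmat_row[OF t i that] by (simp only: distrib_left mult_ac)
    then show ?thesis unfolding o g by simp
  qed
  ultimately show ?thesis by (blast intro: row_span_cong)
qed

text \<open>\<open>walk t g\<close> says that the lift \<open>(t, g)\<close> in the cover is reached
  from \<open>(0, 0)\<close> by a path through faces; a walk ending at tetrahedron 0 is a loop of
  class \<open>g\<close>.\<close>

inductive walk :: "nat \<Rightarrow> int ^ 'r \<Rightarrow> bool" where
  walk_start: "walk 0 0"
| walk_step: "walk t g \<Longrightarrow> i < 4 \<Longrightarrow> walk (nbr t i) (g + w t i)"

lemma walk_less: "walk t g \<Longrightarrow> t < n"
  by (induction rule: walk.induct) (auto simp: n_pos glue)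

lemma walk_row_span:
  "walk t g \<Longrightarrow> \<exists>s::int. row_span (\<lambda>e. unit_row t e - of_int s * gX g * unit_row 0 e)"
proof (induction rule: walk.induct)
  case walk_start
  \<comment> \<open>The empty walk needs only the zero row; \<open>Dmat undefined\<close> is a
    placeholder killed by the factor 0.\<close>
  have "row_span (\<lambda>e. 0 * Dmat undefined e)" unfolding row_span_def by (intro exI[of _ "\<lambda>_. 0"]) simp
  then show ?case by (intro exI[of _ 1]) (simp add: gX_zero)
next
  case (walk_step t g i)
  obtain s :: int where s: "row_span (\<lambda>e. unit_row t e - of_int s * gX g * unit_row 0 e)"
    using walk_step.IH by blast
  obtain s' :: int where s': "row_span (\<lambda>e. unit_row (nbr t i) e - of_int s' * gX (w t i) * unit_row t e)"
    using row_span_step[OF walk_less] walk_step.hyps by blast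
  have "row_span (\<lambda>e. (unit_row (nbr t i) e - of_int s' * gX (w t i) * unit_row t e)
      + (of_int s' * gX (w t i)) * (unit_row t e - of_int s * gX g * unit_row 0 e))"
    by (intro row_span_add row_span_mult s s')
  then have "row_span (\<lambda>e. unit_row (nbr t i) e - of_int (s * s') * gX (g + w t i) * unit_row 0 e)"
    by (rule row_span_cong) (simp add: gX_add algebra_simps)
  then show ?case by blast
qed

lemma walk_exists:
  assumes "t < n"
  shows "\<exists>g. walk t g"
proof -
  have "(\<lambda>x y. \<exists>i<4. y = fst (gl x i))\<^sup>*\<^sup>* 0 t"
    using veering_triangulation assms by (auto simp: veering_triangulation_def manifold_tri_def)
  then show ?thesis
  proof (induction rule: rtranclp_induct)
    case base
    then show ?case using walk_start by blast
  next
    case (step y z)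
    then show ?case using walk_step by blast
  qed
qed

text \<open>A closed walk puts the binomial times the basis vector at tetrahedron 0 into the row
  span. A connecting walk carries this multiple to every other tetrahedron, so one binomial serves
  all rows.\<close>

lemma closed_walk_scalar:
  assumes g: "walk 0 g"
  shows "\<exists>s X. \<forall>e\<in>E. \<forall>e'\<in>E. (\<Sum>f\<in>F. X e f * Dmat f e') = (if e = e' then 1 - of_int s * gX g else 0)"
proof -
  obtain s :: int where s: "row_span (\<lambda>e. unit_row 0 e - of_int s * gX g * unit_row 0 e)"
    using walk_row_span[OF g] by blast
  let ?\<alpha> = "1 - of_int s * gX g"
  have "row_span (\<lambda>e'. if e = e' then ?\<alpha> else 0)" if e: "e \<in> E" for e
  proof -
    let ?t = "tet e"
    have t: "?t < n" "edge_of ?t = e" using tet e by auto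
    obtain h where h: "walk ?t h" using walk_exists[OF t(1)] by blast
    obtain r :: int where r: "row_span (\<lambda>e. unit_row ?t e - of_int r * gX h * unit_row 0 e)"
      using walk_row_span[OF h] by blast
    let ?b = "gX (l ?t (bt ?t))"
    \<comment> \<open>The terms at tetrahedron 0 cancel between the two summands, and
      \<open>?b\<close> undoes the monomial in \<open>unit_row\<close>.\<close>
    have "row_span (\<lambda>e'. ?b * (?\<alpha> * (unit_row ?t e' - of_int r * gX h * unit_row 0 e')
        + (of_int r * gX h) * (unit_row 0 e' - of_int s * gX g * unit_row 0 e')))"
      by (intro row_span_add row_span_mult s r)
    then have "row_span (\<lambda>e'. ?\<alpha> * (?b * unit_row ?t e'))"
      by (rule row_span_cong) (simp add: algebra_simps)
    then show ?thesis
      by (rule row_span_cong) (auto simp: unit_row_def t gX_zero simp flip: gX_add)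
  qed
  then have "\<forall>e\<in>E. \<exists>X. \<forall>e'\<in>E. (if e = e' then ?\<alpha> else 0) = (\<Sum>f\<in>F. X f * Dmat f e')"
    unfolding row_span_def by blast
  then obtain X where "\<forall>e\<in>E. \<forall>e'\<in>E. (if e = e' then ?\<alpha> else 0) = (\<Sum>f\<in>F. X e f * Dmat f e')"
    unfolding bchoice_iff by blast
  then show ?thesis by (intro exI[of _ s] exI[of _ X]) simp
qed

text \<open>If \<open>lam\<close> vanished on all closed walks, its value on any walk from 0 to
  \<open>t\<close> would be a potential, making \<open>lam\<close> applied to \<open>w\<close> a
  coboundary. Injectivity of the map from functionals to cohomology classes then gives
  \<open>lam = 0\<close>.\<close>

lemma closed_walk_nonzero:
  assumes lam: "lam \<noteq> 0"
  shows "\<exists>g. walk 0 g \<and> dotv lam g \<noteq> 0"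
proof (rule ccontr)
  assume neg: "\<not> ?thesis"
  have "cocycle n gl w" using homology_cover unfolding homology_cover_def by (elim conjE)
  then have rev: "w (nbr t i) (gmap t i i) = - w t i" if "t < n" "i < 4" for t i
    using that unfolding cocycle_def by simp
  \<comment> \<open>The steps of the first walk are retraced backwards from the end of the second,
    which yields a loop at 0.\<close>
  have walk_diff: "walk t g \<Longrightarrow> walk t h \<Longrightarrow> \<exists>k. walk 0 k \<and> dotv lam k = dotv lam h - dotv lam g" for t g h
  proof (induction arbitrary: h rule: walk.induct)
    case walk_start
    then show ?case by auto
  next
    case (walk_step t g i)
    have t: "t < n" "i < 4" using walk_step.hyps walk_less by auto
    have "walk (nbr (nbr t i) (gmap t i i)) (h + w (nbr t i) (gmap t i i))"
      by (rule walk.walk_step[OF walk_step.prems gmap_less[OF t t(2)]])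
    then have "walk t (h - w t i)" using glue(4)[OF t] rev[OF t] by simp
    from walk_step.IH[OF this] show ?case by (simp add: dotv_add_right dotv_diff_right algebra_simps)
  qed
  have wd: "dotv lam g = dotv lam h" if "walk t g" "walk t h" for t g h
    using walk_diff[OF that] neg by auto
  define G where "G t = (SOME g. walk t g)" for t
  have G: "walk t (G t)" if "t < n" for t
    unfolding G_def using walk_exists[OF that] by (rule someI_ex)
  have co: "dotv lam (w t i) = dotv lam (G (nbr t i)) - dotv lam (G t)" if t: "t < n" "i < 4" for t i
    using wd[OF G[OF glue(1)[OF t]] walk_step[OF G[OF t(1)] t(2)]] by (simp add: dotv_add_right)
  have inj: "\<forall>lam (h :: nat \<Rightarrow> int).
      (\<forall>t<n. \<forall>i<4. dotv lam (w t i) = h (nbr t i) - h t) \<longrightarrow> lam = 0"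
    using homology_cover unfolding homology_cover_def by (elim conjE)
  have "lam = 0"
    using spec[OF spec[OF inj, of lam], of "\<lambda>t. dotv lam (G t)"] co by simp
  then show False using lam by simp
qed

end

section \<open>Divisibility between the minors and the conclusion\<close>

lemma prod_gX: "(\<Prod>x\<in>A. gX (a x)) = gX (\<Sum>x\<in>A. a x)" for a :: "'b \<Rightarrow> 'g::comm_monoid_add"
  by (induction A rule: infinite_finite_induct) (simp_all add: gX_zero gX_add)

context veering_cover begin

lemma AB_poly_eq_product: "AB_poly n gl bt veer m = AB_product n gl bt veer m"
  unfolding AB_poly_def AB_product_def Amat_def AB_cycles_def
    det_on_one_plus_permutation[OF finite_faces bij_Afun] prod_gX ..

lemma AB_poly_eq: "AB_poly n gl bt veer m = det_on F IA"
  by (simp add: AB_poly_def IA_def[abs_def])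

lemma complementary_minors:
  assumes "inj_on \<beta> E" "inj_on \<phi> E" "\<beta> ` E \<inter> \<phi> ` E = {}" "\<beta> ` E \<union> \<phi> ` E = F"
  obtains u v where "u * v = 1"
    "AB_poly n gl bt veer m * det_on E (\<lambda>e e'. N e (\<beta> e')) * u
      = veering_poly n gl bt veer l * det_on E (\<lambda>e e'. Dmat (\<phi> e) e')"
proof (rule det_on_complementary_minors[OF finite_edges finite_faces N_IA
      matrix_relations(1) matrix_relations(2) matrix_relations(3) matrix_relations(4) assms])
  fix u v :: "(int ^ 'r) \<Rightarrow>\<^sub>0 int"
  assume "u * v = 1" "det_on F IA * det_on E (\<lambda>e e'. N e (\<beta> e')) * u
    = det_on E L * det_on E (\<lambda>e e'. \<Sum>g\<in>F. IA (\<phi> e) g * Kmat g e')"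
  then show thesis by (intro that[of u v]) (simp_all only: AB_poly_eq veering_poly_def Dmat_def)
qed

lemma complement_enumeration:
  assumes "inj_on \<phi> E" "\<phi> ` E \<subseteq> F"
  obtains \<psi> where "inj_on \<psi> E" "\<psi> ` E = F - \<phi> ` E"
proof -
  have "card (F - \<phi> ` E) = card E"
    using assms card_faces finite_edges by (simp add: card_Diff_subset card_image)
  then obtain \<psi> where "bij_betw \<psi> E (F - \<phi> ` E)"
    using finite_same_card_bij[of E "F - \<phi> ` E"] finite_edges finite_faces by auto
  then show ?thesis using that by (auto simp: bij_betw_def)
qed

lemma minor_multiple:
  assumes "x \<in> minors n gl bt l m"
  shows "\<exists>u v c. u * v = 1 \<and> AB_poly n gl bt veer m * x * u = veering_poly n gl bt veer l * c"
proof -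
  obtain \<beta> where \<beta>: "inj_on \<beta> E" "\<beta> ` E \<subseteq> F" and x: "x = det_on E (\<lambda>e e'. N e (\<beta> e'))"
    using assms by (auto simp: minors_def)
  obtain \<phi> where \<phi>: "inj_on \<phi> E" "\<phi> ` E = F - \<beta> ` E" using complement_enumeration[OF \<beta>] .
  have "\<beta> ` E \<inter> \<phi> ` E = {}" "\<beta> ` E \<union> \<phi> ` E = F" using \<phi>(2) \<beta>(2) by auto
  then show ?thesis using complementary_minors[OF \<beta>(1) \<phi>(1)] x by metis
qed

text \<open>The determinant of \<open>X D\<close> is expanded over choices of rows of
  \<open>Dmat\<close>. Each such minor times the veering polynomial is the AB polynomial times a
  unit multiple of the complementary minor of \<open>N\<close>, which \<Theta> divides; choices with
  a repeated row give 0.\<close>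

lemma scalar_multiple:
  assumes X: "\<forall>e\<in>E. \<forall>e'\<in>E. (\<Sum>f\<in>F. X e f * Dmat f e') = (if e = e' then \<alpha> else 0)"
    and dvd: "\<And>x. x \<in> minors n gl bt l m \<Longrightarrow> \<Theta> dvd x"
  shows "\<exists>a. AB_poly n gl bt veer m * a = veering_poly n gl bt veer l * \<alpha> ^ card E \<and> \<Theta> dvd a"
proof -
  let ?p = "AB_poly n gl bt veer m" and ?d = "veering_poly n gl bt veer l"
  have "\<exists>y. ?p * y = ?d * det_on E (\<lambda>e e'. Dmat (\<phi> e) e') \<and> \<Theta> dvd y" if \<phi>: "\<phi> \<in> E \<rightarrow>\<^sub>E F" for \<phi>
  proof (cases "inj_on \<phi> E")
    case True
    have sub: "\<phi> ` E \<subseteq> F" using \<phi> by auto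
    obtain \<beta> where \<beta>: "inj_on \<beta> E" "\<beta> ` E = F - \<phi> ` E" using complement_enumeration[OF True sub] .
    have "\<beta> ` E \<inter> \<phi> ` E = {}" "\<beta> ` E \<union> \<phi> ` E = F" using \<beta>(2) sub by auto
    then obtain u v where "?p * det_on E (\<lambda>e e'. N e (\<beta> e')) * u = ?d * det_on E (\<lambda>e e'. Dmat (\<phi> e) e')"
      using complementary_minors[OF \<beta>(1) True] by metis
    moreover have "det_on E (\<lambda>e e'. N e (\<beta> e')) \<in> minors n gl bt l m"
      using \<beta> by (auto simp: minors_def)
    ultimately show ?thesis
      using dvd by (intro exI[of _ "det_on E (\<lambda>e e'. N e (\<beta> e')) * u"]) (simp add: mult.assoc)
  next
    case False
    then obtain x y where "x \<in> E" "y \<in> E" "x \<noteq> y" "\<phi> x = \<phi> y" by (auto simp: inj_on_def)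
    then have "det_on E (\<lambda>e e'. Dmat (\<phi> e) e') = 0"
      by (intro det_on_identical_rows[OF finite_edges, of x y]) auto
    then show ?thesis by (intro exI[of _ 0]) simp
  qed
  then obtain y where y: "\<And>\<phi>. \<phi> \<in> E \<rightarrow>\<^sub>E F \<Longrightarrow> ?p * y \<phi> = ?d * det_on E (\<lambda>e e'. Dmat (\<phi> e) e')"
    "\<And>\<phi>. \<phi> \<in> E \<rightarrow>\<^sub>E F \<Longrightarrow> \<Theta> dvd y \<phi>"
    by metis
  let ?a = "\<Sum>\<phi>\<in>E \<rightarrow>\<^sub>E F. (\<Prod>e\<in>E. X e (\<phi> e)) * y \<phi>"
  have "?p * ?a = (\<Sum>\<phi>\<in>E \<rightarrow>\<^sub>E F. (\<Prod>e\<in>E. X e (\<phi> e)) * (?p * y \<phi>))"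
    by (simp add: sum_distrib_left mult.left_commute)
  also have "\<dots> = ?d * (\<Sum>\<phi>\<in>E \<rightarrow>\<^sub>E F. (\<Prod>e\<in>E. X e (\<phi> e)) * det_on E (\<lambda>e e'. Dmat (\<phi> e) e'))"
    by (simp add: y(1) sum_distrib_left mult.left_commute)
  also have "\<dots> = ?d * det_on E (\<lambda>e e'. \<Sum>f\<in>F. X e f * Dmat f e')"
    by (simp add: det_on_mult_expand[OF finite_edges finite_faces])
  also have "det_on E (\<lambda>e e'. \<Sum>f\<in>F. X e f * Dmat f e') = det_on E (\<lambda>e e'. if e = e' then \<alpha> else 0)"
    using X by (intro det_on_cong) auto
  also have "\<dots> = \<alpha> ^ card E" by (rule det_on_scalar[OF finite_edges])
  finally have "?p * ?a = ?d * \<alpha> ^ card E" .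
  moreover have "\<Theta> dvd ?a" by (intro dvd_sum dvd_mult y(2))
  ultimately show ?thesis by blast
qed

lemma veering_poly_assoc:
  assumes rank: "CARD('r) > 1" and gcd: "is_gcd_of \<Theta> (minors n gl bt l m)"
  shows "assoc_pm (veering_poly n gl bt veer l) (AB_poly n gl bt veer m * \<Theta>)"
proof -
  have "(\<chi> k. 1) \<noteq> (0 :: int ^ 'r)" by (simp add: vec_eq_iff)
  then obtain g where g: "walk 0 g" "dotv (\<chi> k. 1) g \<noteq> 0" using closed_walk_nonzero by blast
  then have g0: "g \<noteq> 0" by auto
  then obtain i where i: "g $ i \<noteq> 0" by (auto simp: vec_eq_iff)
  have "\<exists>j. j \<noteq> i"
  proof (rule ccontr)
    assume "\<nexists>j. j \<noteq> i"
    then have "(UNIV :: 'r set) = {i}" by auto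
    then have "CARD('r) = card {i}" by simp
    then show False using rank by simp
  qed
  then obtain j where j: "j \<noteq> i" by blast
  \<comment> \<open>A functional orthogonal to \<open>g\<close> supported on two coordinates; it is
    nonzero since \<open>g $ i\<close> is nonzero and \<open>j\<close> differs from
    \<open>i\<close>.\<close>
  define lam :: "int ^ 'r" where "lam = (\<chi> k. (if k = j then g $ i else 0) - (if k = i then g $ j else 0))"
  have "lam $ j \<noteq> 0" using i j by (simp add: lam_def)
  then have "lam \<noteq> 0" by auto
  then obtain h where h: "walk 0 h" "dotv lam h \<noteq> 0" using closed_walk_nonzero by blast
  have lam_g: "dotv lam g = 0"
  proof -
    have "dotv lam g = (\<Sum>k\<in>UNIV. (if k = j then g $ i * g $ k else 0) - (if k = i then g $ j * g $ k else 0))"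
      unfolding dotv_def lam_def by (intro sum.cong refl) (auto simp: left_diff_distrib)
    then show ?thesis by (simp add: sum_subtractf)
  qed
  \<comment> \<open>The sign is chosen so that \<open>h\<close> has positive degree, while
    \<open>g\<close> keeps degree 0.\<close>
  define f where "f v = sgn (dotv lam h) * dotv lam v" for v
  have f: "f (u - v) = f u - f v" "f g = 0" "f h > 0" for u v
    using lam_g h(2) by (auto simp: f_def dotv_diff_right right_diff_distrib linorder_neq_iff sgn_if)
  obtain s X where X: "\<forall>e\<in>E. \<forall>e'\<in>E. (\<Sum>f\<in>F. X e f * Dmat f e') = (if e = e' then 1 - of_int s * gX g else 0)"
    using closed_walk_scalar[OF g(1)] by blast
  obtain s' X' where X': "\<forall>e\<in>E. \<forall>e'\<in>E. (\<Sum>f\<in>F. X' e f * Dmat f e') = (if e = e' then 1 - of_int s' * gX h else 0)"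
    using closed_walk_scalar[OF h(1)] by blast
  have dvd: "\<And>x. x \<in> minors n gl bt l m \<Longrightarrow> \<Theta> dvd x" using gcd by (simp add: is_gcd_of_def)
  obtain a where a: "AB_poly n gl bt veer m * a = veering_poly n gl bt veer l * (1 - of_int s * gX g) ^ card E" "\<Theta> dvd a"
    using scalar_multiple[OF X dvd] by blast
  obtain b where b: "AB_poly n gl bt veer m * b = veering_poly n gl bt veer l * (1 - of_int s' * gX h) ^ card E" "\<Theta> dvd b"
    using scalar_multiple[OF X' dvd] by blast
  \<comment> \<open>Since \<open>g\<close> is nonzero, the coefficient at exponent 0 is 1 for every
    integer \<open>s\<close>.\<close>
  have nz: "1 - of_int s * gX g \<noteq> 0"
  proof
    assume "1 - of_int s * gX g = 0"
    then have "1 = Poly_Mapping.single g s" by (simp add: gX_def mult_single flip: single_of_int)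
    then have "Poly_Mapping.lookup 1 (0 :: int ^ 'r) = Poly_Mapping.lookup (Poly_Mapping.single g s) 0" by simp
    then show False using g0 by (simp add: lookup_single)
  qed
  show ?thesis
  proof (rule assoc_pm_of_coprime_multiples[OF gcd _ a b nz])
    show "\<exists>u v c. u * v = 1 \<and> AB_poly n gl bt veer m * x * u = veering_poly n gl bt veer l * c"
      if "x \<in> minors n gl bt l m" for x using that by (rule minor_multiple)
    show "1 - of_int s * gX g dvd x" if "1 - of_int s * gX g dvd x * (1 - of_int s' * gX h)" for x
      using f(1) f(2) f(3) that by (rule binomial_dvd_cancel[of f])
  qed
qed

end

theorem mainTheorem16:
  fixes n :: nat and gl :: "nat \<Rightarrow> nat \<Rightarrow> nat \<times> (nat \<Rightarrow> nat)"
    and bt :: "nat \<Rightarrow> nat set" and veer :: "(nat \<times> nat set) set \<Rightarrow> bool"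
    and w :: "nat \<Rightarrow> nat \<Rightarrow> int ^ 'r" and l :: "nat \<Rightarrow> nat set \<Rightarrow> int ^ 'r"
    and m :: "nat \<Rightarrow> nat \<Rightarrow> int ^ 'r" and \<Theta> :: "(int ^ 'r) \<Rightarrow>\<^sub>0 int"
  assumes "veering_triangulation n gl bt veer"
    and "homology_cover n gl w"
    and "CARD('r) > 1"
    and "edge_lifts n gl w l"
    and "face_lifts n gl w m"
    and "is_gcd_of \<Theta> (minors n gl bt l m)"
  shows "assoc_pm (veering_poly n gl bt veer l) (AB_poly n gl bt veer m * \<Theta>)
       \<and> assoc_pm (veering_poly n gl bt veer l) (\<Theta> * AB_product n gl bt veer m)"
proof -
  interpret veering_cover n gl bt veer w l m
    using assms by unfold_locales
  have "assoc_pm (veering_poly n gl bt veer l) (AB_poly n gl bt veer m * \<Theta>)"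
    using assms(3,6) by (rule veering_poly_assoc)
  then show ?thesis by (simp add: AB_poly_eq_product mult.commute)
qed

end
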